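(* Let $\mathcal{C}$ be a symmetric monoidal category in which every idempotent is a split idempotent. Let $\xi:A\to B$ be a well-decomposable bimonoid homomorphism between bimonoids in $\mathcal{C}$. There exists a normalized generator integral $\mu_\xi$ along $\xi$ if and only if $\xi$ is weakly pre-Fredholm. Moreover, if a normalized integral along $\xi$ exists, then it is unique.
   Context: Coherence isomorphisms are suppressed; $\mathds{1}$ is the unit object. A bimonoid $A$ has structure maps $\nabla_A,\eta_A,\Delta_A,\epsilon_A$. $\mathsf{Bimon}(\mathcal{C})$ is the category of bimonoids and bimonoid homomorphisms; $\mathds{1}$ is a zero object of it. An idempotent $p:X\to X$ splits if there are $\iota:X^p\to X$, $\pi:X\to X^p$ with $\pi\circ\iota=id$, $\iota\circ\pi=p$. Integrals along a homomorphism. A morphism $\mu:B\to A$ in $\mathcal{C}$ is a right integral along $\xi:A\to B$ if $\nabla_A\circ(\mu\otimes id_A)=\mu\circ\nabla_B\circ(id_B\otimes\xi)$ and $(\mu\otimes id_B)\circ\Delta_B=(id_A\otimes\xi)\circ\Delta_A\circ\mu$; a left integral along $\xi$ if $\nabla_A\circ(id_A\otimes\mu)=\mu\circ\nabla_B\circ(\xi\otimes id_B)$ and $(id_B\otimes\mu)\circ\Delta_B=(\xi\otimes id_A)\circ\Delta_A\circ\mu$; an integral along $\xi$ if both. It is normalized if $\xi\circ\mu\circ\xi=\xi$. An integral $\mu$ along $\xi$ is a generator if $\mu\circ\xi\circ\mu'=\mu'=\mu'\circ\xi\circ\mu$ for every right or left integral $\mu'$ along $\xi$. Actions. A left action $(A,\alpha,X)$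 is a bimonoid $A$, an object $X$ and $\alpha:A\otimes X\to X$ associative and unital; the trivial action is $\epsilon_A\otimes id_X$. Its stabilized object $\alpha\backslash X$ is a coequalizer of $\alpha$ and $\epsilon_A\otimes id_X$. Its invariant object is a morphism $i:\alpha\backslash\backslash X\to X$ with $\alpha\circ(id_A\otimes i)=\epsilon_A\otimes i$, universal with this property (every $f:Z\to X$ with $\alpha\circ(id_A\otimes f)=\epsilon_A\otimes f$ factors uniquely through $i$). Let ${}_\alpha\gamma:\alpha\backslash\backslash X\to X\to\alpha\backslash X$ be the canonical composite. Right actions $(X,\alpha,A)$ are treated in the same way. Dually, for a left coaction $\beta:Y\to A\otimes Y$ of a bimonoid $A$ (coassociative, counital), the stabilized object $\beta/Y\to Y$ is an equalizer of $\beta$ and the trivial coaction $\eta_A\otimes id_Y$, the invariant object is a universal morphism $q:Y\to\beta//Y$ with $(id_A\otimes q)\circ\beta=\eta_A\otimes q$, and ${}^\beta\gamma:\beta/Y\to Y\to\beta//Y$; similarly for right coactions. Small bimonoids. A bimonoid $A$ is small if for every left action and every right action of $A$ the invariant and stabilized objects exist and the canonical morphism from the invariant to the stabilized object is an isomorphism. It is cosmall if for every left and every right coaction of $A$ the invariant and stabilized objects exist and the canonical morphism from the stabilized to the invariant object is an isomorphism. Kernels, normality. $ker(\xi):Ker(\xi)\to A$ and $cok(\xi):B\to Cok(\xi)$ are kernel and cokernel in $\mathsf{Bimon}(\mathcal{C})$ (equalizer/coequalizer of $\xi$ and $\eta_B\circ\epsilon_A$). $\xi$ is normal if the stabilized objects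 of the left action $\nabla_B\circ(\xi\otimes id_B):A\otimes B\to B$ and of the right action $\nabla_B\circ(id_B\otimes\xi):B\otimes A\to B$ carry bimonoid structures such that the canonical morphisms from $B$ to them are bimonoid homomorphisms and are cokernels of $\xi$ in $\mathsf{Bimon}(\mathcal{C})$. Dually, $\xi$ is conormal if the stabilized objects of the left coaction $(\xi\otimes id_A)\circ\Delta_A:A\to B\otimes A$ and right coaction $(id_A\otimes\xi)\circ\Delta_A:A\to A\otimes B$ carry bimonoid structures such that the canonical morphisms from them to $A$ are bimonoid homomorphisms and are kernels of $\xi$ in $\mathsf{Bimon}(\mathcal{C})$. Binormal means normal and conormal. Put $Coim(\xi)=Cok(ker(\xi))$, $coim(\xi)=cok(ker(\xi))$, $Im(\xi)=Ker(cok(\xi))$, $im(\xi)=ker(cok(\xi))$, and let $\bar\xi:Coim(\xi)\to Im(\xi)$ be the canonical homomorphism with $\xi=im(\xi)\circ\bar\xi\circ coim(\xi)$. $\xi$ is well-decomposable if $\xi$ is binormal (so $Ker(\xi)$, $Cok(\xi)$ exist), $ker(\xi)$ is normal, $cok(\xi)$ is conormal (so $Coim(\xi)$, $Im(\xi)$ exist), and $\bar\xi$ is an isomorphism. A well-decomposable $\xi$ is weakly pre-Fredholm if $Ker(\xi)$ is small and $Cok(\xi)$ is cosmall. *)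

theory Defs
  imports Main
begin

section \<open>Symmetric monoidal categories\<close>

text \<open>
  Categories are not assumed strict: the coherence isomorphisms are part of the data, with
  \<open>\<a> X Y Z : (X \<odot> Y) \<odot> Z \<rightarrow> X \<odot> (Y \<odot> Z)\<close>, \<open>\<l> X : \<one> \<odot> X \<rightarrow> X\<close>,
  \<open>\<r> X : X \<odot> \<one> \<rightarrow> X\<close> and \<open>\<s> X Y : X \<odot> Y \<rightarrow> Y \<odot> X\<close>. The tensor product is
  written \<open>\<odot>\<close> on objects and \<open>\<otimes>\<close> on arrows; \<open>g \<cdot> f\<close> is \<open>g\<close> after \<open>f\<close>.
\<close>

record ('o, 'm) sm_category =
  Obj :: "'o set"
  Arr :: "'m set"
  Dom :: "'m \<Rightarrow> 'o"
  Cod :: "'m \<Rightarrow> 'o"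
  Id :: "'o \<Rightarrow> 'm"  ("\<i>\<d>\<index>")
  Comp :: "'m \<Rightarrow> 'm \<Rightarrow> 'm"  (infixl "\<cdot>\<index>" 60)
  TensorObj :: "'o \<Rightarrow> 'o \<Rightarrow> 'o"  (infixl "\<odot>\<index>" 70)
  TensorArr :: "'m \<Rightarrow> 'm \<Rightarrow> 'm"  (infixl "\<otimes>\<index>" 70)
  UnitObj :: "'o"  ("\<one>\<index>")
  Assoc :: "'o \<Rightarrow> 'o \<Rightarrow> 'o \<Rightarrow> 'm"  ("\<a>\<index>")
  Lunit :: "'o \<Rightarrow> 'm"  ("\<l>\<index>")
  Runit :: "'o \<Rightarrow> 'm"  ("\<r>\<index>")
  Braid :: "'o \<Rightarrow> 'o \<Rightarrow> 'm"  ("\<s>\<index>")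

context
  fixes C :: "('o, 'm) sm_category" (structure)
begin

definition hom :: "'o \<Rightarrow> 'o \<Rightarrow> 'm set" where
  "hom X Y = {f \<in> Arr C. Dom C f = X \<and> Cod C f = Y}"

definition inverse_arrows :: "'m \<Rightarrow> 'm \<Rightarrow> bool" where
  "inverse_arrows f g \<longleftrightarrow>
     f \<in> Arr C \<and> g \<in> hom (Cod C f) (Dom C f) \<and>
     g \<cdot> f = \<i>\<d> (Dom C f) \<and> f \<cdot> g = \<i>\<d> (Cod C f)"

definition is_iso :: "'m \<Rightarrow> bool" where
  "is_iso f \<longleftrightarrow> (\<exists>g. inverse_arrows f g)"

definition inv_arrow :: "'m \<Rightarrow> 'm" where
  "inv_arrow f = (THE g. inverse_arrows f g)"

definition idempotents_split :: bool where
  "idempotents_split \<longleftrightarrow>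
     (\<forall>X p. X \<in> Obj C \<and> p \<in> hom X X \<and> p \<cdot> p = p \<longrightarrow>
       (\<exists>Y \<iota> \<pi>. \<iota> \<in> hom Y X \<and> \<pi> \<in> hom X Y \<and> \<pi> \<cdot> \<iota> = \<i>\<d> Y \<and> \<iota> \<cdot> \<pi> = p))"

definition is_equalizer :: "'o \<Rightarrow> 'o \<Rightarrow> 'm \<Rightarrow> 'm \<Rightarrow> 'o \<Rightarrow> 'm \<Rightarrow> bool" where
  "is_equalizer X Y f g E e \<longleftrightarrow>
     f \<in> hom X Y \<and> g \<in> hom X Y \<and> e \<in> hom E X \<and> f \<cdot> e = g \<cdot> e \<and>
     (\<forall>Z h. h \<in> hom Z X \<and> f \<cdot> h = g \<cdot> h \<longrightarrow> (\<exists>!k. k \<in> hom Z E \<and> e \<cdot> k = h))"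

definition is_coequalizer :: "'o \<Rightarrow> 'o \<Rightarrow> 'm \<Rightarrow> 'm \<Rightarrow> 'o \<Rightarrow> 'm \<Rightarrow> bool" where
  "is_coequalizer X Y f g Q q \<longleftrightarrow>
     f \<in> hom X Y \<and> g \<in> hom X Y \<and> q \<in> hom Y Q \<and> q \<cdot> f = q \<cdot> g \<and>
     (\<forall>Z h. h \<in> hom Y Z \<and> h \<cdot> f = h \<cdot> g \<longrightarrow> (\<exists>!k. k \<in> hom Q Z \<and> k \<cdot> q = h))"

end

locale category =
  fixes C :: "('o, 'm) sm_category" (structure)
  assumes dom_closed: "f \<in> Arr C \<Longrightarrow> Dom C f \<in> Obj C"
    and cod_closed: "f \<in> Arr C \<Longrightarrow> Cod C f \<in> Obj C"
    and id_hom: "X \<in> Obj C \<Longrightarrow> \<i>\<d> X \<in> hom C X X"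
    and comp_hom: "\<lbrakk>f \<in> hom C X Y; g \<in> hom C Y Z\<rbrakk> \<Longrightarrow> g \<cdot> f \<in> hom C X Z"
    and comp_id_left: "f \<in> hom C X Y \<Longrightarrow> \<i>\<d> Y \<cdot> f = f"
    and comp_id_right: "f \<in> hom C X Y \<Longrightarrow> f \<cdot> \<i>\<d> X = f"
    and comp_assoc: "\<lbrakk>f \<in> hom C W X; g \<in> hom C X Y; h \<in> hom C Y Z\<rbrakk> \<Longrightarrow>
      (h \<cdot> g) \<cdot> f = h \<cdot> (g \<cdot> f)"

locale monoidal_category = category +
  assumes unit_obj: "\<one> \<in> Obj C"
    and tensor_obj: "\<lbrakk>X \<in> Obj C; Y \<in> Obj C\<rbrakk> \<Longrightarrow> X \<odot> Y \<in> Obj C"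
    and tensor_hom: "\<lbrakk>f \<in> hom C X X'; g \<in> hom C Y Y'\<rbrakk> \<Longrightarrow>
      f \<otimes> g \<in> hom C (X \<odot> Y) (X' \<odot> Y')"
    and tensor_id: "\<lbrakk>X \<in> Obj C; Y \<in> Obj C\<rbrakk> \<Longrightarrow> \<i>\<d> X \<otimes> \<i>\<d> Y = \<i>\<d> (X \<odot> Y)"
    and tensor_comp: "\<lbrakk>f \<in> hom C X X'; f' \<in> hom C X' X''; g \<in> hom C Y Y'; g' \<in> hom C Y' Y''\<rbrakk> \<Longrightarrow>
      (f' \<cdot> f) \<otimes> (g' \<cdot> g) = (f' \<otimes> g') \<cdot> (f \<otimes> g)"
    and assoc_hom: "\<lbrakk>X \<in> Obj C; Y \<in> Obj C; Z \<in> Obj C\<rbrakk> \<Longrightarrow>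
      \<a> X Y Z \<in> hom C ((X \<odot> Y) \<odot> Z) (X \<odot> (Y \<odot> Z))"
    and assoc_iso: "\<lbrakk>X \<in> Obj C; Y \<in> Obj C; Z \<in> Obj C\<rbrakk> \<Longrightarrow> is_iso C (\<a> X Y Z)"
    and assoc_natural: "\<lbrakk>f \<in> hom C X X'; g \<in> hom C Y Y'; h \<in> hom C Z Z'\<rbrakk> \<Longrightarrow>
      \<a> X' Y' Z' \<cdot> ((f \<otimes> g) \<otimes> h) = (f \<otimes> (g \<otimes> h)) \<cdot> \<a> X Y Z"
    and lunit_hom: "X \<in> Obj C \<Longrightarrow> \<l> X \<in> hom C (\<one> \<odot> X) X"
    and lunit_iso: "X \<in> Obj C \<Longrightarrow> is_iso C (\<l> X)"
    and lunit_natural: "f \<in> hom C X Y \<Longrightarrow> \<l> Y \<cdot> (\<i>\<d> \<one> \<otimes> f) = f \<cdot> \<l> X"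
    and runit_hom: "X \<in> Obj C \<Longrightarrow> \<r> X \<in> hom C (X \<odot> \<one>) X"
    and runit_iso: "X \<in> Obj C \<Longrightarrow> is_iso C (\<r> X)"
    and runit_natural: "f \<in> hom C X Y \<Longrightarrow> \<r> Y \<cdot> (f \<otimes> \<i>\<d> \<one>) = f \<cdot> \<r> X"
    and pentagon: "\<lbrakk>W \<in> Obj C; X \<in> Obj C; Y \<in> Obj C; Z \<in> Obj C\<rbrakk> \<Longrightarrow>
      \<a> W X (Y \<odot> Z) \<cdot> \<a> (W \<odot> X) Y Z =
        (\<i>\<d> W \<otimes> \<a> X Y Z) \<cdot> \<a> W (X \<odot> Y) Z \<cdot> (\<a> W X Y \<otimes> \<i>\<d> Z)"
    and triangle: "\<lbrakk>X \<in> Obj C; Y \<in> Obj C\<rbrakk> \<Longrightarrow>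
      (\<i>\<d> X \<otimes> \<l> Y) \<cdot> \<a> X \<one> Y = \<r> X \<otimes> \<i>\<d> Y"

locale symmetric_monoidal_category = monoidal_category +
  assumes braid_hom: "\<lbrakk>X \<in> Obj C; Y \<in> Obj C\<rbrakk> \<Longrightarrow> \<s> X Y \<in> hom C (X \<odot> Y) (Y \<odot> X)"
    and braid_natural: "\<lbrakk>f \<in> hom C X X'; g \<in> hom C Y Y'\<rbrakk> \<Longrightarrow>
      \<s> X' Y' \<cdot> (f \<otimes> g) = (g \<otimes> f) \<cdot> \<s> X Y"
    and braid_symmetric: "\<lbrakk>X \<in> Obj C; Y \<in> Obj C\<rbrakk> \<Longrightarrow> \<s> Y X \<cdot> \<s> X Y = \<i>\<d> (X \<odot> Y)"
    and hexagon: "\<lbrakk>X \<in> Obj C; Y \<in> Obj C; Z \<in> Obj C\<rbrakk> \<Longrightarrow>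
      \<a> Y Z X \<cdot> \<s> X (Y \<odot> Z) \<cdot> \<a> X Y Z =
        (\<i>\<d> Y \<otimes> \<s> X Z) \<cdot> \<a> Y X Z \<cdot> (\<s> X Y \<otimes> \<i>\<d> Z)"

section \<open>Bimonoids\<close>

record ('o, 'm) bimonoid_data =
  obj :: "'o"
  mult :: "'m"  ("\<nabla>\<index>")
  unit :: "'m"  ("\<eta>\<index>")
  comult :: "'m"  ("\<Delta>\<index>")
  counit :: "'m"  ("\<epsilon>\<index>")

context
  fixes C :: "('o, 'm) sm_category" (structure)
begin

text \<open>The canonical arrow \<open>(W \<odot> X) \<odot> (Y \<odot> Z) \<rightarrow> (W \<odot> Y) \<odot> (X \<odot> Z)\<close>.\<close>

definition middle_swap :: "'o \<Rightarrow> 'o \<Rightarrow> 'o \<Rightarrow> 'o \<Rightarrow> 'm" where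
  "middle_swap W X Y Z =
     inv_arrow C (\<a> W Y (X \<odot> Z)) \<cdot>
     (\<i>\<d> W \<otimes> (\<a> Y X Z \<cdot> (\<s> X Y \<otimes> \<i>\<d> Z) \<cdot> inv_arrow C (\<a> X Y Z))) \<cdot>
     \<a> W X (Y \<odot> Z)"

definition monoid_object :: "('o, 'm) bimonoid_data \<Rightarrow> bool" where
  "monoid_object A \<longleftrightarrow>
     obj A \<in> Obj C \<and>
     \<nabla>\<^bsub>A\<^esub> \<in> hom C (obj A \<odot> obj A) (obj A) \<and>
     \<eta>\<^bsub>A\<^esub> \<in> hom C \<one> (obj A) \<and>
     \<nabla>\<^bsub>A\<^esub> \<cdot> (\<nabla>\<^bsub>A\<^esub> \<otimes> \<i>\<d> (obj A)) =
       \<nabla>\<^bsub>A\<^esub> \<cdot> (\<i>\<d> (obj A) \<otimes> \<nabla>\<^bsub>A\<^esub>) \<cdot> \<a> (obj A) (obj A) (obj A) \<and>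
     \<nabla>\<^bsub>A\<^esub> \<cdot> (\<eta>\<^bsub>A\<^esub> \<otimes> \<i>\<d> (obj A)) = \<l> (obj A) \<and>
     \<nabla>\<^bsub>A\<^esub> \<cdot> (\<i>\<d> (obj A) \<otimes> \<eta>\<^bsub>A\<^esub>) = \<r> (obj A)"

definition comonoid_object :: "('o, 'm) bimonoid_data \<Rightarrow> bool" where
  "comonoid_object A \<longleftrightarrow>
     obj A \<in> Obj C \<and>
     \<Delta>\<^bsub>A\<^esub> \<in> hom C (obj A) (obj A \<odot> obj A) \<and>
     \<epsilon>\<^bsub>A\<^esub> \<in> hom C (obj A) \<one> \<and>
     \<a> (obj A) (obj A) (obj A) \<cdot> (\<Delta>\<^bsub>A\<^esub> \<otimes> \<i>\<d> (obj A)) \<cdot> \<Delta>\<^bsub>A\<^esub> =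
       (\<i>\<d> (obj A) \<otimes> \<Delta>\<^bsub>A\<^esub>) \<cdot> \<Delta>\<^bsub>A\<^esub> \<and>
     \<l> (obj A) \<cdot> (\<epsilon>\<^bsub>A\<^esub> \<otimes> \<i>\<d> (obj A)) \<cdot> \<Delta>\<^bsub>A\<^esub> = \<i>\<d> (obj A) \<and>
     \<r> (obj A) \<cdot> (\<i>\<d> (obj A) \<otimes> \<epsilon>\<^bsub>A\<^esub>) \<cdot> \<Delta>\<^bsub>A\<^esub> = \<i>\<d> (obj A)"

definition bimonoid :: "('o, 'm) bimonoid_data \<Rightarrow> bool" where
  "bimonoid A \<longleftrightarrow>
     monoid_object A \<and> comonoid_object A \<and>
     \<Delta>\<^bsub>A\<^esub> \<cdot> \<nabla>\<^bsub>A\<^esub> =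
       (\<nabla>\<^bsub>A\<^esub> \<otimes> \<nabla>\<^bsub>A\<^esub>) \<cdot> middle_swap (obj A) (obj A) (obj A) (obj A) \<cdot> (\<Delta>\<^bsub>A\<^esub> \<otimes> \<Delta>\<^bsub>A\<^esub>) \<and>
     \<Delta>\<^bsub>A\<^esub> \<cdot> \<eta>\<^bsub>A\<^esub> = (\<eta>\<^bsub>A\<^esub> \<otimes> \<eta>\<^bsub>A\<^esub>) \<cdot> inv_arrow C (\<l> \<one>) \<and>
     \<epsilon>\<^bsub>A\<^esub> \<cdot> \<nabla>\<^bsub>A\<^esub> = \<l> \<one> \<cdot> (\<epsilon>\<^bsub>A\<^esub> \<otimes> \<epsilon>\<^bsub>A\<^esub>) \<and>
     \<epsilon>\<^bsub>A\<^esub> \<cdot> \<eta>\<^bsub>A\<^esub> = \<i>\<d> \<one>"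

definition bimonoid_hom :: "('o, 'm) bimonoid_data \<Rightarrow> ('o, 'm) bimonoid_data \<Rightarrow> 'm \<Rightarrow> bool" where
  "bimonoid_hom A B f \<longleftrightarrow>
     bimonoid A \<and> bimonoid B \<and> f \<in> hom C (obj A) (obj B) \<and>
     f \<cdot> \<nabla>\<^bsub>A\<^esub> = \<nabla>\<^bsub>B\<^esub> \<cdot> (f \<otimes> f) \<and> f \<cdot> \<eta>\<^bsub>A\<^esub> = \<eta>\<^bsub>B\<^esub> \<and>
     \<Delta>\<^bsub>B\<^esub> \<cdot> f = (f \<otimes> f) \<cdot> \<Delta>\<^bsub>A\<^esub> \<and> \<epsilon>\<^bsub>B\<^esub> \<cdot> f = \<epsilon>\<^bsub>A\<^esub>"

definition bimonoid_iso :: "('o, 'm) bimonoid_data \<Rightarrow> ('o, 'm) bimonoid_data \<Rightarrow> 'm \<Rightarrow> bool" where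
  "bimonoid_iso A B f \<longleftrightarrow>
     bimonoid_hom A B f \<and>
     (\<exists>g. bimonoid_hom B A g \<and> g \<cdot> f = \<i>\<d> (obj A) \<and> f \<cdot> g = \<i>\<d> (obj B))"

text \<open>
  Kernels and cokernels are taken in the category of bimonoids: they are the equalizer and the
  coequalizer there of \<open>\<xi>\<close> and the zero homomorphism \<open>\<eta>\<^bsub>B\<^esub> \<cdot> \<epsilon>\<^bsub>A\<^esub>\<close>.
\<close>

definition is_kernel ::
    "('o, 'm) bimonoid_data \<Rightarrow> ('o, 'm) bimonoid_data \<Rightarrow> 'm \<Rightarrow> ('o, 'm) bimonoid_data \<Rightarrow> 'm \<Rightarrow> bool" where
  "is_kernel A B \<xi> K k \<longleftrightarrow>
     bimonoid_hom A B \<xi> \<and> bimonoid_hom K A k \<and> \<xi> \<cdot> k = (\<eta>\<^bsub>B\<^esub> \<cdot> \<epsilon>\<^bsub>A\<^esub>) \<cdot> k \<and>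
     (\<forall>L f. bimonoid_hom L A f \<and> \<xi> \<cdot> f = (\<eta>\<^bsub>B\<^esub> \<cdot> \<epsilon>\<^bsub>A\<^esub>) \<cdot> f \<longrightarrow>
       (\<exists>!g. bimonoid_hom L K g \<and> k \<cdot> g = f))"

definition is_cokernel ::
    "('o, 'm) bimonoid_data \<Rightarrow> ('o, 'm) bimonoid_data \<Rightarrow> 'm \<Rightarrow> ('o, 'm) bimonoid_data \<Rightarrow> 'm \<Rightarrow> bool" where
  "is_cokernel A B \<xi> Q q \<longleftrightarrow>
     bimonoid_hom A B \<xi> \<and> bimonoid_hom B Q q \<and> q \<cdot> \<xi> = q \<cdot> (\<eta>\<^bsub>B\<^esub> \<cdot> \<epsilon>\<^bsub>A\<^esub>) \<and>
     (\<forall>L f. bimonoid_hom B L f \<and> f \<cdot> \<xi> = f \<cdot> (\<eta>\<^bsub>B\<^esub> \<cdot> \<epsilon>\<^bsub>A\<^esub>) \<longrightarrow>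
       (\<exists>!g. bimonoid_hom Q L g \<and> g \<cdot> q = f))"

end

section \<open>Actions and coactions\<close>

context
  fixes C :: "('o, 'm) sm_category" (structure)
begin

definition left_action :: "('o, 'm) bimonoid_data \<Rightarrow> 'o \<Rightarrow> 'm \<Rightarrow> bool" where
  "left_action A X \<alpha> \<longleftrightarrow>
     bimonoid C A \<and> X \<in> Obj C \<and> \<alpha> \<in> hom C (obj A \<odot> X) X \<and>
     \<alpha> \<cdot> (\<nabla>\<^bsub>A\<^esub> \<otimes> \<i>\<d> X) = \<alpha> \<cdot> (\<i>\<d> (obj A) \<otimes> \<alpha>) \<cdot> \<a> (obj A) (obj A) X \<and>
     \<alpha> \<cdot> (\<eta>\<^bsub>A\<^esub> \<otimes> \<i>\<d> X) = \<l> X"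

definition right_action :: "('o, 'm) bimonoid_data \<Rightarrow> 'o \<Rightarrow> 'm \<Rightarrow> bool" where
  "right_action A X \<alpha> \<longleftrightarrow>
     bimonoid C A \<and> X \<in> Obj C \<and> \<alpha> \<in> hom C (X \<odot> obj A) X \<and>
     \<alpha> \<cdot> (\<alpha> \<otimes> \<i>\<d> (obj A)) = \<alpha> \<cdot> (\<i>\<d> X \<otimes> \<nabla>\<^bsub>A\<^esub>) \<cdot> \<a> X (obj A) (obj A) \<and>
     \<alpha> \<cdot> (\<i>\<d> X \<otimes> \<eta>\<^bsub>A\<^esub>) = \<r> X"

definition left_coaction :: "('o, 'm) bimonoid_data \<Rightarrow> 'o \<Rightarrow> 'm \<Rightarrow> bool" where
  "left_coaction A Y \<beta> \<longleftrightarrow>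
     bimonoid C A \<and> Y \<in> Obj C \<and> \<beta> \<in> hom C Y (obj A \<odot> Y) \<and>
     \<a> (obj A) (obj A) Y \<cdot> (\<Delta>\<^bsub>A\<^esub> \<otimes> \<i>\<d> Y) \<cdot> \<beta> = (\<i>\<d> (obj A) \<otimes> \<beta>) \<cdot> \<beta> \<and>
     \<l> Y \<cdot> (\<epsilon>\<^bsub>A\<^esub> \<otimes> \<i>\<d> Y) \<cdot> \<beta> = \<i>\<d> Y"

definition right_coaction :: "('o, 'm) bimonoid_data \<Rightarrow> 'o \<Rightarrow> 'm \<Rightarrow> bool" where
  "right_coaction A Y \<beta> \<longleftrightarrow>
     bimonoid C A \<and> Y \<in> Obj C \<and> \<beta> \<in> hom C Y (Y \<odot> obj A) \<and>
     \<a> Y (obj A) (obj A) \<cdot> (\<beta> \<otimes> \<i>\<d> (obj A)) \<cdot> \<beta> = (\<i>\<d> Y \<otimes> \<Delta>\<^bsub>A\<^esub>) \<cdot> \<beta> \<and>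
     \<r> Y \<cdot> (\<i>\<d> Y \<otimes> \<epsilon>\<^bsub>A\<^esub>) \<cdot> \<beta> = \<i>\<d> Y"

definition trivial_left_action :: "('o, 'm) bimonoid_data \<Rightarrow> 'o \<Rightarrow> 'm" where
  "trivial_left_action A X = \<l> X \<cdot> (\<epsilon>\<^bsub>A\<^esub> \<otimes> \<i>\<d> X)"

definition trivial_right_action :: "('o, 'm) bimonoid_data \<Rightarrow> 'o \<Rightarrow> 'm" where
  "trivial_right_action A X = \<r> X \<cdot> (\<i>\<d> X \<otimes> \<epsilon>\<^bsub>A\<^esub>)"

definition trivial_left_coaction :: "('o, 'm) bimonoid_data \<Rightarrow> 'o \<Rightarrow> 'm" where
  "trivial_left_coaction A Y = (\<eta>\<^bsub>A\<^esub> \<otimes> \<i>\<d> Y) \<cdot> inv_arrow C (\<l> Y)"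

definition trivial_right_coaction :: "('o, 'm) bimonoid_data \<Rightarrow> 'o \<Rightarrow> 'm" where
  "trivial_right_coaction A Y = (\<i>\<d> Y \<otimes> \<eta>\<^bsub>A\<^esub>) \<cdot> inv_arrow C (\<r> Y)"

definition left_action_stabilized :: "('o, 'm) bimonoid_data \<Rightarrow> 'o \<Rightarrow> 'm \<Rightarrow> 'o \<Rightarrow> 'm \<Rightarrow> bool" where
  "left_action_stabilized A X \<alpha> S p \<longleftrightarrow>
     is_coequalizer C (obj A \<odot> X) X \<alpha> (trivial_left_action A X) S p"

definition right_action_stabilized :: "('o, 'm) bimonoid_data \<Rightarrow> 'o \<Rightarrow> 'm \<Rightarrow> 'o \<Rightarrow> 'm \<Rightarrow> bool" where
  "right_action_stabilized A X \<alpha> S p \<longleftrightarrow>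
     is_coequalizer C (X \<odot> obj A) X \<alpha> (trivial_right_action A X) S p"

definition left_coaction_stabilized :: "('o, 'm) bimonoid_data \<Rightarrow> 'o \<Rightarrow> 'm \<Rightarrow> 'o \<Rightarrow> 'm \<Rightarrow> bool" where
  "left_coaction_stabilized A Y \<beta> S j \<longleftrightarrow>
     is_equalizer C Y (obj A \<odot> Y) \<beta> (trivial_left_coaction A Y) S j"

definition right_coaction_stabilized :: "('o, 'm) bimonoid_data \<Rightarrow> 'o \<Rightarrow> 'm \<Rightarrow> 'o \<Rightarrow> 'm \<Rightarrow> bool" where
  "right_coaction_stabilized A Y \<beta> S j \<longleftrightarrow>
     is_equalizer C Y (Y \<odot> obj A) \<beta> (trivial_right_coaction A Y) S j"

text \<open>
  The arrows written \<open>\<epsilon>\<^bsub>A\<^esub> \<otimes> f\<close> and \<open>\<eta>\<^bsub>A\<^esub> \<otimes> f\<close> when unitors are suppressed are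
  spelled out below as \<open>\<l> X \<cdot> (\<epsilon>\<^bsub>A\<^esub> \<otimes> f)\<close> and \<open>(\<eta>\<^bsub>A\<^esub> \<otimes> f) \<cdot> inv_arrow C (\<l> Y)\<close>.
\<close>

definition left_action_invariant :: "('o, 'm) bimonoid_data \<Rightarrow> 'o \<Rightarrow> 'm \<Rightarrow> 'o \<Rightarrow> 'm \<Rightarrow> bool" where
  "left_action_invariant A X \<alpha> I i \<longleftrightarrow>
     i \<in> hom C I X \<and> \<alpha> \<cdot> (\<i>\<d> (obj A) \<otimes> i) = \<l> X \<cdot> (\<epsilon>\<^bsub>A\<^esub> \<otimes> i) \<and>
     (\<forall>Z f. f \<in> hom C Z X \<and> \<alpha> \<cdot> (\<i>\<d> (obj A) \<otimes> f) = \<l> X \<cdot> (\<epsilon>\<^bsub>A\<^esub> \<otimes> f) \<longrightarrow>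
       (\<exists>!g. g \<in> hom C Z I \<and> i \<cdot> g = f))"

definition right_action_invariant :: "('o, 'm) bimonoid_data \<Rightarrow> 'o \<Rightarrow> 'm \<Rightarrow> 'o \<Rightarrow> 'm \<Rightarrow> bool" where
  "right_action_invariant A X \<alpha> I i \<longleftrightarrow>
     i \<in> hom C I X \<and> \<alpha> \<cdot> (i \<otimes> \<i>\<d> (obj A)) = \<r> X \<cdot> (i \<otimes> \<epsilon>\<^bsub>A\<^esub>) \<and>
     (\<forall>Z f. f \<in> hom C Z X \<and> \<alpha> \<cdot> (f \<otimes> \<i>\<d> (obj A)) = \<r> X \<cdot> (f \<otimes> \<epsilon>\<^bsub>A\<^esub>) \<longrightarrow>
       (\<exists>!g. g \<in> hom C Z I \<and> i \<cdot> g = f))"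

definition left_coaction_invariant :: "('o, 'm) bimonoid_data \<Rightarrow> 'o \<Rightarrow> 'm \<Rightarrow> 'o \<Rightarrow> 'm \<Rightarrow> bool" where
  "left_coaction_invariant A Y \<beta> Q q \<longleftrightarrow>
     q \<in> hom C Y Q \<and> (\<i>\<d> (obj A) \<otimes> q) \<cdot> \<beta> = (\<eta>\<^bsub>A\<^esub> \<otimes> q) \<cdot> inv_arrow C (\<l> Y) \<and>
     (\<forall>Z f. f \<in> hom C Y Z \<and> (\<i>\<d> (obj A) \<otimes> f) \<cdot> \<beta> = (\<eta>\<^bsub>A\<^esub> \<otimes> f) \<cdot> inv_arrow C (\<l> Y) \<longrightarrow>
       (\<exists>!g. g \<in> hom C Q Z \<and> g \<cdot> q = f))"

definition right_coaction_invariant :: "('o, 'm) bimonoid_data \<Rightarrow> 'o \<Rightarrow> 'm \<Rightarrow> 'o \<Rightarrow> 'm \<Rightarrow> bool" where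
  "right_coaction_invariant A Y \<beta> Q q \<longleftrightarrow>
     q \<in> hom C Y Q \<and> (q \<otimes> \<i>\<d> (obj A)) \<cdot> \<beta> = (q \<otimes> \<eta>\<^bsub>A\<^esub>) \<cdot> inv_arrow C (\<r> Y) \<and>
     (\<forall>Z f. f \<in> hom C Y Z \<and> (f \<otimes> \<i>\<d> (obj A)) \<cdot> \<beta> = (f \<otimes> \<eta>\<^bsub>A\<^esub>) \<cdot> inv_arrow C (\<r> Y) \<longrightarrow>
       (\<exists>!g. g \<in> hom C Q Z \<and> g \<cdot> q = f))"

text \<open>
  Invariant and stabilized objects are unique up to unique isomorphism, so it does not matter
  which ones are used to test the canonical arrows \<open>p \<cdot> i\<close> and \<open>q \<cdot> j\<close>.
\<close>

definition small :: "('o, 'm) bimonoid_data \<Rightarrow> bool" where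
  "small A \<longleftrightarrow>
     bimonoid C A \<and>
     (\<forall>X \<alpha>. left_action A X \<alpha> \<longrightarrow>
       (\<exists>I i S p. left_action_invariant A X \<alpha> I i \<and> left_action_stabilized A X \<alpha> S p \<and>
         is_iso C (p \<cdot> i))) \<and>
     (\<forall>X \<alpha>. right_action A X \<alpha> \<longrightarrow>
       (\<exists>I i S p. right_action_invariant A X \<alpha> I i \<and> right_action_stabilized A X \<alpha> S p \<and>
         is_iso C (p \<cdot> i)))"

definition cosmall :: "('o, 'm) bimonoid_data \<Rightarrow> bool" where
  "cosmall A \<longleftrightarrow>
     bimonoid C A \<and>
     (\<forall>Y \<beta>. left_coaction A Y \<beta> \<longrightarrow>
       (\<exists>S j Q q. left_coaction_stabilized A Y \<beta> S j \<and> left_coaction_invariant A Y \<beta> Q q \<and>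
         is_iso C (q \<cdot> j))) \<and>
     (\<forall>Y \<beta>. right_coaction A Y \<beta> \<longrightarrow>
       (\<exists>S j Q q. right_coaction_stabilized A Y \<beta> S j \<and> right_coaction_invariant A Y \<beta> Q q \<and>
         is_iso C (q \<cdot> j)))"

end

section \<open>Normality and well-decomposable homomorphisms\<close>

context
  fixes C :: "('o, 'm) sm_category" (structure)
begin

definition normal :: "('o, 'm) bimonoid_data \<Rightarrow> ('o, 'm) bimonoid_data \<Rightarrow> 'm \<Rightarrow> bool" where
  "normal A B \<xi> \<longleftrightarrow>
     (\<exists>Q q. left_action_stabilized C A (obj B) (\<nabla>\<^bsub>B\<^esub> \<cdot> (\<xi> \<otimes> \<i>\<d> (obj B))) (obj Q) q \<and>
       is_cokernel C A B \<xi> Q q) \<and>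
     (\<exists>Q q. right_action_stabilized C A (obj B) (\<nabla>\<^bsub>B\<^esub> \<cdot> (\<i>\<d> (obj B) \<otimes> \<xi>)) (obj Q) q \<and>
       is_cokernel C A B \<xi> Q q)"

definition conormal :: "('o, 'm) bimonoid_data \<Rightarrow> ('o, 'm) bimonoid_data \<Rightarrow> 'm \<Rightarrow> bool" where
  "conormal A B \<xi> \<longleftrightarrow>
     (\<exists>K k. left_coaction_stabilized C B (obj A) ((\<xi> \<otimes> \<i>\<d> (obj A)) \<cdot> \<Delta>\<^bsub>A\<^esub>) (obj K) k \<and>
       is_kernel C A B \<xi> K k) \<and>
     (\<exists>K k. right_coaction_stabilized C B (obj A) ((\<i>\<d> (obj A) \<otimes> \<xi>) \<cdot> \<Delta>\<^bsub>A\<^esub>) (obj K) k \<and>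
       is_kernel C A B \<xi> K k)"

definition binormal :: "('o, 'm) bimonoid_data \<Rightarrow> ('o, 'm) bimonoid_data \<Rightarrow> 'm \<Rightarrow> bool" where
  "binormal A B \<xi> \<longleftrightarrow> normal A B \<xi> \<and> conormal A B \<xi>"

text \<open>
  Below \<open>k = ker \<xi>\<close>, \<open>q = cok \<xi>\<close>, \<open>c = coim \<xi>\<close> and \<open>i = im \<xi>\<close>. The homomorphism \<open>\<zeta>\<close> is the
  canonical one: it is determined by its equation because \<open>c\<close> is epic and \<open>i\<close> is monic among
  bimonoid homomorphisms.
\<close>

definition well_decomposable :: "('o, 'm) bimonoid_data \<Rightarrow> ('o, 'm) bimonoid_data \<Rightarrow> 'm \<Rightarrow> bool" where
  "well_decomposable A B \<xi> \<longleftrightarrow>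
     binormal A B \<xi> \<and>
     (\<exists>K k Q q Coim c Im i \<zeta>.
       is_kernel C A B \<xi> K k \<and> normal K A k \<and>
       is_cokernel C A B \<xi> Q q \<and> conormal B Q q \<and>
       is_cokernel C K A k Coim c \<and>
       is_kernel C B Q q Im i \<and>
       \<xi> = i \<cdot> \<zeta> \<cdot> c \<and> bimonoid_iso C Coim Im \<zeta>)"

definition weakly_pre_Fredholm :: "('o, 'm) bimonoid_data \<Rightarrow> ('o, 'm) bimonoid_data \<Rightarrow> 'm \<Rightarrow> bool" where
  "weakly_pre_Fredholm A B \<xi> \<longleftrightarrow>
     well_decomposable A B \<xi> \<and>
     (\<exists>K k. is_kernel C A B \<xi> K k \<and> small C K) \<and>
     (\<exists>Q q. is_cokernel C A B \<xi> Q q \<and> cosmall C Q)"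

end

section \<open>Integrals along a homomorphism\<close>

context
  fixes C :: "('o, 'm) sm_category" (structure)
begin

definition right_integral :: "('o, 'm) bimonoid_data \<Rightarrow> ('o, 'm) bimonoid_data \<Rightarrow> 'm \<Rightarrow> 'm \<Rightarrow> bool" where
  "right_integral A B \<xi> \<mu> \<longleftrightarrow>
     \<mu> \<in> hom C (obj B) (obj A) \<and>
     \<nabla>\<^bsub>A\<^esub> \<cdot> (\<mu> \<otimes> \<i>\<d> (obj A)) = \<mu> \<cdot> \<nabla>\<^bsub>B\<^esub> \<cdot> (\<i>\<d> (obj B) \<otimes> \<xi>) \<and>
     (\<mu> \<otimes> \<i>\<d> (obj B)) \<cdot> \<Delta>\<^bsub>B\<^esub> = (\<i>\<d> (obj A) \<otimes> \<xi>) \<cdot> \<Delta>\<^bsub>A\<^esub> \<cdot> \<mu>"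

definition left_integral :: "('o, 'm) bimonoid_data \<Rightarrow> ('o, 'm) bimonoid_data \<Rightarrow> 'm \<Rightarrow> 'm \<Rightarrow> bool" where
  "left_integral A B \<xi> \<mu> \<longleftrightarrow>
     \<mu> \<in> hom C (obj B) (obj A) \<and>
     \<nabla>\<^bsub>A\<^esub> \<cdot> (\<i>\<d> (obj A) \<otimes> \<mu>) = \<mu> \<cdot> \<nabla>\<^bsub>B\<^esub> \<cdot> (\<xi> \<otimes> \<i>\<d> (obj B)) \<and>
     (\<i>\<d> (obj B) \<otimes> \<mu>) \<cdot> \<Delta>\<^bsub>B\<^esub> = (\<xi> \<otimes> \<i>\<d> (obj A)) \<cdot> \<Delta>\<^bsub>A\<^esub> \<cdot> \<mu>"

definition integral_along :: "('o, 'm) bimonoid_data \<Rightarrow> ('o, 'm) bimonoid_data \<Rightarrow> 'm \<Rightarrow> 'm \<Rightarrow> bool" where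
  "integral_along A B \<xi> \<mu> \<longleftrightarrow> right_integral A B \<xi> \<mu> \<and> left_integral A B \<xi> \<mu>"

definition normalized :: "'m \<Rightarrow> 'm \<Rightarrow> bool" where
  "normalized \<xi> \<mu> \<longleftrightarrow> \<xi> \<cdot> \<mu> \<cdot> \<xi> = \<xi>"

definition generator_integral :: "('o, 'm) bimonoid_data \<Rightarrow> ('o, 'm) bimonoid_data \<Rightarrow> 'm \<Rightarrow> 'm \<Rightarrow> bool" where
  "generator_integral A B \<xi> \<mu> \<longleftrightarrow>
     integral_along A B \<xi> \<mu> \<and>
     (\<forall>\<mu>'. right_integral A B \<xi> \<mu>' \<or> left_integral A B \<xi> \<mu>' \<longrightarrow>
       \<mu> \<cdot> \<xi> \<cdot> \<mu>' = \<mu>' \<and> \<mu>' = \<mu>' \<cdot> \<xi> \<cdot> \<mu>)"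

end

end

theory Submission
  imports Defs
begin

text \<open>
  Write arrows as if they had elements. The kernel \<open>k : K \<rightarrow> A\<close> acts on \<open>A\<close> by translations, and
  normality of \<open>k\<close> says that the coimage \<open>c : A \<rightarrow> D\<close> is the quotient of \<open>A\<close> by the left and also by
  the right translations. Dually, the image \<open>i : D \<rightarrow> B\<close> consists of the coinvariants of the
  cokernel \<open>q : B \<rightarrow> Q\<close>, and \<open>\<xi> = i \<cdot> c\<close> once coimage and image are identified.

  Smallness of \<open>K\<close> is the existence of an element \<open>\<sigma>\<close> of \<open>K\<close> with \<open>x \<sigma> = \<epsilon>(x) \<sigma> = \<sigma> x\<close> and
  \<open>\<epsilon>(\<sigma>) = 1\<close> (\<open>small_iff_normalized_integral\<close>): applied to the regular action, smallness produces
  \<open>\<sigma>\<close>; conversely \<open>\<sigma>\<close> acts on every \<open>K\<close>-object as an idempotent, and a splitting of it is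
  both the invariant and the stabilized object. Cosmallness of \<open>Q\<close> is the same statement for a
  functional \<open>\<tau>\<close> on \<open>Q\<close>.

  Given \<open>\<sigma>\<close>, translation by \<open>k(\<sigma>)\<close> is constant on the fibres of \<open>c\<close> and descends to a section \<open>s\<close>
  of \<open>c\<close>, which turns out to be an integral along \<open>c\<close> (\<open>two_sided_quotient_section\<close>). Dually \<open>\<tau>\<close>
  gives a retraction \<open>t\<close> of \<open>i\<close> that is an integral along \<open>i\<close>. Integrals compose, so
  \<open>\<mu> = s \<cdot> t\<close> is an integral along \<open>\<xi>\<close>. It is normalized because \<open>c \<cdot> s\<close> and \<open>t \<cdot> i\<close> are
  identities. It is a generator because \<open>\<mu> \<cdot> \<xi> = s \<cdot> c\<close> is translation by \<open>k(\<sigma>)\<close>, an element that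
  \<open>\<xi>\<close> sends to \<open>1\<close>, and integrals along \<open>\<xi>\<close> absorb such translations
  (\<open>normalized_generator_exists\<close>).

  Conversely, let \<open>\<mu>\<close> be any normalized integral along \<open>\<xi>\<close>. The element \<open>\<mu>(1)\<close> of \<open>A\<close> lies in the
  kernel because \<open>\<xi>\<close> is conormal, and there it is a normalized integral
  (\<open>normalized_integral_restricts\<close>); dually \<open>\<epsilon> \<cdot> \<mu>\<close> descends to \<open>Q\<close>. Hence a normalized integral
  already forces \<open>K\<close> to be small and \<open>Q\<close> to be cosmall, so a normalized generator exists, and every
  normalized integral coincides with it (\<open>normalized_generator_unique\<close>).
\<close>

section \<open>Computing with arrows\<close>

context category
begin

lemma in_hom_iff [simp]: "f \<in> hom C X Y \<longleftrightarrow> f \<in> Arr C \<and> Dom C f = X \<and> Cod C f = Y"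
  by (simp add: hom_def)

lemma Obj_Dom [simp]: "f \<in> Arr C \<Longrightarrow> Dom C f \<in> Obj C"
  by (rule dom_closed)

lemma Obj_Cod [simp]: "f \<in> Arr C \<Longrightarrow> Cod C f \<in> Obj C"
  by (rule cod_closed)

lemma id_typing [simp]:
  "X \<in> Obj C \<Longrightarrow> \<i>\<d> X \<in> Arr C" "X \<in> Obj C \<Longrightarrow> Dom C (\<i>\<d> X) = X"
  "X \<in> Obj C \<Longrightarrow> Cod C (\<i>\<d> X) = X"
  using id_hom by auto

lemma comp_typing [simp]:
  assumes "f \<in> Arr C" and "g \<in> Arr C" and "Dom C g = Cod C f"
  shows "g \<cdot> f \<in> Arr C" and "Dom C (g \<cdot> f) = Dom C f" and "Cod C (g \<cdot> f) = Cod C g"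
  using comp_hom[of f "Dom C f" "Cod C f" g "Cod C g"] assms by auto

lemma comp_id [simp]:
  "\<lbrakk>f \<in> Arr C; Cod C f = Y\<rbrakk> \<Longrightarrow> \<i>\<d> Y \<cdot> f = f"
  "\<lbrakk>f \<in> Arr C; Dom C f = X\<rbrakk> \<Longrightarrow> f \<cdot> \<i>\<d> X = f"
  using comp_id_left[of f "Dom C f" "Cod C f"] comp_id_right[of f "Dom C f" "Cod C f"] by auto

lemma comp_assoc_right [simp]:
  "\<lbrakk>f \<in> Arr C; g \<in> Arr C; h \<in> Arr C; Dom C g = Cod C f; Dom C h = Cod C g\<rbrakk> \<Longrightarrow>
    (h \<cdot> g) \<cdot> f = h \<cdot> (g \<cdot> f)"
  using comp_assoc[of f "Dom C f" "Cod C f" g "Cod C g" h "Cod C h"] by simp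

text \<open>
  Composites are kept right-nested, so every equation \<open>g \<cdot> f = h\<close> that is to be used in the middle
  of a composite needs a second form with a tail.
\<close>

lemma comp_tail:
  assumes "g \<cdot> f = h" and "f \<in> Arr C" and "g \<in> Arr C" and "Dom C g = Cod C f"
    and "k \<in> Arr C" and "Cod C k = Dom C f"
  shows "g \<cdot> (f \<cdot> k) = h \<cdot> k"
  using comp_assoc_right[of k f g] assms by simp

lemma comp_tail2:
  assumes "g \<cdot> f = h2 \<cdot> h1" and "f \<in> Arr C" and "g \<in> Arr C" and "Dom C g = Cod C f"
    and "h1 \<in> Arr C" and "h2 \<in> Arr C" and "Dom C h2 = Cod C h1" and "Dom C h1 = Dom C f"
    and "k \<in> Arr C" and "Cod C k = Dom C f"
  shows "g \<cdot> (f \<cdot> k) = h2 \<cdot> (h1 \<cdot> k)"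
  using comp_assoc_right[of k f g] comp_assoc_right[of k h1 h2] assms by simp

lemma inverse_arrowsI:
  assumes "f \<in> Arr C" and "g \<in> Arr C" and "Dom C g = Cod C f" and "Cod C g = Dom C f"
    and "g \<cdot> f = \<i>\<d> (Dom C f)" and "f \<cdot> g = \<i>\<d> (Cod C f)"
  shows "inverse_arrows C f g"
  using assms by (simp add: inverse_arrows_def)

lemma inverse_arrowsD:
  assumes "inverse_arrows C f g"
  shows "f \<in> Arr C" "g \<in> Arr C" "Dom C g = Cod C f" "Cod C g = Dom C f"
    "g \<cdot> f = \<i>\<d> (Dom C f)" "f \<cdot> g = \<i>\<d> (Cod C f)"
  using assms by (simp_all add: inverse_arrows_def)

lemma inverse_arrows_sym: "inverse_arrows C f g \<Longrightarrow> inverse_arrows C g f"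
  by (simp add: inverse_arrows_def)

lemma inverse_arrows_unique:
  assumes "inverse_arrows C f g" and "inverse_arrows C f h"
  shows "g = h"
proof -
  note D = inverse_arrowsD[OF assms(1)] inverse_arrowsD[OF assms(2)]
  have "g = g \<cdot> (f \<cdot> h)" using D by simp
  also have "\<dots> = (g \<cdot> f) \<cdot> h" using D(1-4) D(7-10) by simp
  also have "\<dots> = h" using D by simp
  finally show ?thesis .
qed

lemma inv_arrow_eqI: "inverse_arrows C f g \<Longrightarrow> inv_arrow C f = g"
  unfolding inv_arrow_def using inverse_arrows_unique by blast

lemma inverse_arrows_inv: "is_iso C f \<Longrightarrow> inverse_arrows C f (inv_arrow C f)"
  unfolding is_iso_def using inv_arrow_eqI by blast

lemma inverse_arrows_id: "X \<in> Obj C \<Longrightarrow> inverse_arrows C (\<i>\<d> X) (\<i>\<d> X)"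
  by (rule inverse_arrowsI) simp_all

lemma inverse_arrows_comp:
  assumes "inverse_arrows C f f'" and "inverse_arrows C g g'" and "Dom C g = Cod C f"
  shows "inverse_arrows C (g \<cdot> f) (f' \<cdot> g')"
proof -
  note D = inverse_arrowsD[OF assms(1)] inverse_arrowsD[OF assms(2)]
  show ?thesis
    using D assms(3)
    by (intro inverse_arrowsI)
      (simp_all add: comp_tail[OF D(5)] comp_tail[OF D(6)] comp_tail[OF D(11)] comp_tail[OF D(12)])
qed

lemma inv_inv: "is_iso C f \<Longrightarrow> inv_arrow C (inv_arrow C f) = f"
  by (rule inv_arrow_eqI, rule inverse_arrows_sym, rule inverse_arrows_inv)

lemma iso_cancel_left:
  assumes "inverse_arrows C h h'" and "h \<cdot> f = h \<cdot> g" and "f \<in> Arr C" and "g \<in> Arr C"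
    and "Cod C f = Dom C h" and "Cod C g = Dom C h"
  shows "f = g"
proof -
  note D = inverse_arrowsD[OF assms(1)]
  have "h' \<cdot> (h \<cdot> f) = h' \<cdot> (h \<cdot> g)" using assms(2) by simp
  then show ?thesis using D assms(3-) by (simp add: comp_tail[OF D(5)])
qed

lemma iso_cancel_right:
  assumes "inverse_arrows C h h'" and "f \<cdot> h = g \<cdot> h" and "f \<in> Arr C" and "g \<in> Arr C"
    and "Dom C f = Cod C h" and "Dom C g = Cod C h"
  shows "f = g"
proof -
  note D = inverse_arrowsD[OF assms(1)]
  have "(f \<cdot> h) \<cdot> h' = (g \<cdot> h) \<cdot> h'" using assms(2) by simp
  then show ?thesis using D assms(3-) by simp
qed

lemma iso_transpose_left:
  assumes "inverse_arrows C h h'" and "f \<in> Arr C" and "g \<in> Arr C"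
    and "Cod C f = Dom C h" and "Cod C g = Cod C h"
  shows "h \<cdot> f = g \<longleftrightarrow> f = h' \<cdot> g"
proof -
  note D = inverse_arrowsD[OF assms(1)]
  show ?thesis using D assms(2-) by (auto simp: comp_tail[OF D(5)] comp_tail[OF D(6)])
qed

lemma iso_transpose_right:
  assumes "inverse_arrows C h h'" and "f \<in> Arr C" and "g \<in> Arr C"
    and "Dom C f = Cod C h" and "Dom C g = Dom C h"
  shows "f \<cdot> h = g \<longleftrightarrow> f = g \<cdot> h'"
proof -
  note D = inverse_arrowsD[OF assms(1)]
  show ?thesis using D assms(2-) by auto
qed

lemma retraction_epi:
  assumes "c \<cdot> s = \<i>\<d> Y" and "f \<cdot> c = g \<cdot> c" and "s \<in> Arr C" and "c \<in> Arr C" and "Dom C c = Cod C s"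
    and "f \<in> Arr C" and "g \<in> Arr C" and "Dom C f = Cod C c" and "Dom C g = Cod C c" and "Cod C c = Y"
  shows "f = g"
proof -
  have "(f \<cdot> c) \<cdot> s = (g \<cdot> c) \<cdot> s" using assms(2) by simp
  then show ?thesis using assms(1,3-) by simp
qed

lemma is_coequalizer_epi:
  assumes "is_coequalizer C X Y f g Q q" and "h \<cdot> q = k \<cdot> q"
    and "h \<in> Arr C" and "k \<in> Arr C" and "Dom C h = Q" and "Dom C k = Q"
  shows "h = k"
proof -
  from assms(1) have q: "f \<in> Arr C" "Cod C f = Y" "g \<in> Arr C" "Cod C g = Y"
      "q \<in> Arr C" "Dom C q = Y" "Cod C q = Q" "q \<cdot> f = q \<cdot> g"
    and ex: "\<And>Z h. h \<in> hom C Y Z \<and> h \<cdot> f = h \<cdot> g \<Longrightarrow> \<exists>!k. k \<in> hom C Q Z \<and> k \<cdot> q = h"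
    unfolding is_coequalizer_def in_hom_iff by blast+
  have "Cod C (h \<cdot> q) = Cod C (k \<cdot> q)" using assms(2) by simp
  then have same_cod: "Cod C h = Cod C k" using assms(3-6) q by simp
  have "\<exists>!k. k \<in> hom C Q (Cod C h) \<and> k \<cdot> q = h \<cdot> q"
    using assms(3,5) q by (intro ex) simp
  moreover have "h \<in> hom C Q (Cod C h)" and "k \<in> hom C Q (Cod C h)"
    using assms(3-6) same_cod by simp_all
  ultimately show ?thesis using assms(2) by metis
qed

end

section \<open>Coherence in a monoidal category\<close>

context monoidal_category
begin

lemma Obj_unit_tensor [simp]: "\<one> \<in> Obj C" "\<lbrakk>X \<in> Obj C; Y \<in> Obj C\<rbrakk> \<Longrightarrow> X \<odot> Y \<in> Obj C"
  by (simp_all add: unit_obj tensor_obj)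

lemma tensor_typing [simp]:
  assumes "f \<in> Arr C" and "g \<in> Arr C"
  shows "f \<otimes> g \<in> Arr C" and "Dom C (f \<otimes> g) = Dom C f \<odot> Dom C g"
    and "Cod C (f \<otimes> g) = Cod C f \<odot> Cod C g"
  using tensor_hom[of f "Dom C f" "Cod C f" g "Dom C g" "Cod C g"] assms by auto

lemma tensor_ids [simp]: "\<lbrakk>X \<in> Obj C; Y \<in> Obj C\<rbrakk> \<Longrightarrow> \<i>\<d> X \<otimes> \<i>\<d> Y = \<i>\<d> (X \<odot> Y)"
  by (rule tensor_id)

lemma interchange:
  "\<lbrakk>f \<in> Arr C; f' \<in> Arr C; g \<in> Arr C; g' \<in> Arr C; Dom C f' = Cod C f; Dom C g' = Cod C g\<rbrakk> \<Longrightarrow>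
    (f' \<otimes> g') \<cdot> (f \<otimes> g) = (f' \<cdot> f) \<otimes> (g' \<cdot> g)"
  using tensor_comp[of f "Dom C f" "Cod C f" f' "Cod C f'" g "Dom C g" "Cod C g" g' "Cod C g'"]
  by simp

lemma interchange_tail:
  "\<lbrakk>f \<in> Arr C; f' \<in> Arr C; g \<in> Arr C; g' \<in> Arr C; Dom C f' = Cod C f; Dom C g' = Cod C g;
    h \<in> Arr C; Cod C h = Dom C f \<odot> Dom C g\<rbrakk> \<Longrightarrow>
    (f' \<otimes> g') \<cdot> ((f \<otimes> g) \<cdot> h) = ((f' \<cdot> f) \<otimes> (g' \<cdot> g)) \<cdot> h"
  by (simp add: comp_tail interchange)

lemma inverse_arrows_tensor:
  assumes "inverse_arrows C f f'" and "inverse_arrows C g g'"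
  shows "inverse_arrows C (f \<otimes> g) (f' \<otimes> g')"
  using inverse_arrowsD[OF assms(1)] inverse_arrowsD[OF assms(2)]
  by (intro inverse_arrowsI) (simp_all add: interchange)

abbreviation assoc_inv  ("\<a>\<^sup>-") where "\<a>\<^sup>- X Y Z \<equiv> inv_arrow C (\<a> X Y Z)"
abbreviation lunit_inv  ("\<l>\<^sup>-") where "\<l>\<^sup>- X \<equiv> inv_arrow C (\<l> X)"
abbreviation runit_inv  ("\<r>\<^sup>-") where "\<r>\<^sup>- X \<equiv> inv_arrow C (\<r> X)"

lemma coherence_inverses:
  "\<lbrakk>X \<in> Obj C; Y \<in> Obj C; Z \<in> Obj C\<rbrakk> \<Longrightarrow> inverse_arrows C (\<a> X Y Z) (\<a>\<^sup>- X Y Z)"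
  "X \<in> Obj C \<Longrightarrow> inverse_arrows C (\<l> X) (\<l>\<^sup>- X)"
  "X \<in> Obj C \<Longrightarrow> inverse_arrows C (\<r> X) (\<r>\<^sup>- X)"
  by (simp_all add: inverse_arrows_inv assoc_iso lunit_iso runit_iso)

lemma assoc_typing [simp]:
  assumes "X \<in> Obj C" and "Y \<in> Obj C" and "Z \<in> Obj C"
  shows "\<a> X Y Z \<in> Arr C" and "Dom C (\<a> X Y Z) = (X \<odot> Y) \<odot> Z" and "Cod C (\<a> X Y Z) = X \<odot> (Y \<odot> Z)"
    and "\<a>\<^sup>- X Y Z \<in> Arr C" and "Dom C (\<a>\<^sup>- X Y Z) = X \<odot> (Y \<odot> Z)"
    and "Cod C (\<a>\<^sup>- X Y Z) = (X \<odot> Y) \<odot> Z"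
  using assoc_hom[OF assms] inverse_arrowsD[OF coherence_inverses(1)[OF assms]] by simp_all

lemma unitor_typing [simp]:
  assumes "X \<in> Obj C"
  shows "\<l> X \<in> Arr C" and "Dom C (\<l> X) = \<one> \<odot> X" and "Cod C (\<l> X) = X"
    and "\<r> X \<in> Arr C" and "Dom C (\<r> X) = X \<odot> \<one>" and "Cod C (\<r> X) = X"
    and "\<l>\<^sup>- X \<in> Arr C" and "Dom C (\<l>\<^sup>- X) = X" and "Cod C (\<l>\<^sup>- X) = \<one> \<odot> X"
    and "\<r>\<^sup>- X \<in> Arr C" and "Dom C (\<r>\<^sup>- X) = X" and "Cod C (\<r>\<^sup>- X) = X \<odot> \<one>"
  using lunit_hom[OF assms] runit_hom[OF assms] inverse_arrowsD[OF coherence_inverses(2)[OF assms]]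
    inverse_arrowsD[OF coherence_inverses(3)[OF assms]] by simp_all

lemma coherence_cancel [simp]:
  "\<lbrakk>X \<in> Obj C; Y \<in> Obj C; Z \<in> Obj C\<rbrakk> \<Longrightarrow> \<a> X Y Z \<cdot> \<a>\<^sup>- X Y Z = \<i>\<d> (X \<odot> (Y \<odot> Z))"
  "\<lbrakk>X \<in> Obj C; Y \<in> Obj C; Z \<in> Obj C\<rbrakk> \<Longrightarrow> \<a>\<^sup>- X Y Z \<cdot> \<a> X Y Z = \<i>\<d> ((X \<odot> Y) \<odot> Z)"
  "X \<in> Obj C \<Longrightarrow> \<l> X \<cdot> \<l>\<^sup>- X = \<i>\<d> X" "X \<in> Obj C \<Longrightarrow> \<l>\<^sup>- X \<cdot> \<l> X = \<i>\<d> (\<one> \<odot> X)"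
  "X \<in> Obj C \<Longrightarrow> \<r> X \<cdot> \<r>\<^sup>- X = \<i>\<d> X" "X \<in> Obj C \<Longrightarrow> \<r>\<^sup>- X \<cdot> \<r> X = \<i>\<d> (X \<odot> \<one>)"
  using inverse_arrowsD[OF coherence_inverses(1), of X Y Z]
    inverse_arrowsD[OF coherence_inverses(2), of X] inverse_arrowsD[OF coherence_inverses(3), of X]
  by simp_all

lemma coherence_cancel_tail [simp]:
  "\<lbrakk>X \<in> Obj C; Y \<in> Obj C; Z \<in> Obj C; f \<in> Arr C; Cod C f = X \<odot> (Y \<odot> Z)\<rbrakk> \<Longrightarrow>
    \<a> X Y Z \<cdot> (\<a>\<^sup>- X Y Z \<cdot> f) = f"
  "\<lbrakk>X \<in> Obj C; Y \<in> Obj C; Z \<in> Obj C; f \<in> Arr C; Cod C f = (X \<odot> Y) \<odot> Z\<rbrakk> \<Longrightarrow>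
    \<a>\<^sup>- X Y Z \<cdot> (\<a> X Y Z \<cdot> f) = f"
  "\<lbrakk>X \<in> Obj C; f \<in> Arr C; Cod C f = X\<rbrakk> \<Longrightarrow> \<l> X \<cdot> (\<l>\<^sup>- X \<cdot> f) = f"
  "\<lbrakk>X \<in> Obj C; f \<in> Arr C; Cod C f = \<one> \<odot> X\<rbrakk> \<Longrightarrow> \<l>\<^sup>- X \<cdot> (\<l> X \<cdot> f) = f"
  "\<lbrakk>X \<in> Obj C; f \<in> Arr C; Cod C f = X\<rbrakk> \<Longrightarrow> \<r> X \<cdot> (\<r>\<^sup>- X \<cdot> f) = f"
  "\<lbrakk>X \<in> Obj C; f \<in> Arr C; Cod C f = X \<odot> \<one>\<rbrakk> \<Longrightarrow> \<r>\<^sup>- X \<cdot> (\<r> X \<cdot> f) = f"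
  by (simp_all add: comp_tail[OF coherence_cancel(1)] comp_tail[OF coherence_cancel(2)]
      comp_tail[OF coherence_cancel(3)] comp_tail[OF coherence_cancel(4)]
      comp_tail[OF coherence_cancel(5)] comp_tail[OF coherence_cancel(6)])

lemma assoc_nat:
  "\<lbrakk>f \<in> Arr C; g \<in> Arr C; h \<in> Arr C; Cod C f = X; Cod C g = Y; Cod C h = Z\<rbrakk> \<Longrightarrow>
    \<a> X Y Z \<cdot> ((f \<otimes> g) \<otimes> h) = (f \<otimes> (g \<otimes> h)) \<cdot> \<a> (Dom C f) (Dom C g) (Dom C h)"
  using assoc_natural[of f "Dom C f" X g "Dom C g" Y h "Dom C h" Z] by simp

lemma assoc_inv_nat:
  assumes "f \<in> Arr C" and "g \<in> Arr C" and "h \<in> Arr C"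
    and "Cod C f = X" and "Cod C g = Y" and "Cod C h = Z"
  shows "\<a>\<^sup>- X Y Z \<cdot> (f \<otimes> (g \<otimes> h)) = ((f \<otimes> g) \<otimes> h) \<cdot> \<a>\<^sup>- (Dom C f) (Dom C g) (Dom C h)"
proof -
  have X: "X \<in> Obj C" "Y \<in> Obj C" "Z \<in> Obj C" using assms by auto
  show ?thesis
    by (rule iso_cancel_left[OF coherence_inverses(1)[OF X]])
      (use assms X in \<open>simp_all add: comp_tail2[OF assoc_nat]\<close>)
qed

lemma lunit_nat: "\<lbrakk>f \<in> Arr C; Cod C f = Y\<rbrakk> \<Longrightarrow> \<l> Y \<cdot> (\<i>\<d> \<one> \<otimes> f) = f \<cdot> \<l> (Dom C f)"
  using lunit_natural[of f "Dom C f" Y] by simp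

lemma runit_nat: "\<lbrakk>f \<in> Arr C; Cod C f = Y\<rbrakk> \<Longrightarrow> \<r> Y \<cdot> (f \<otimes> \<i>\<d> \<one>) = f \<cdot> \<r> (Dom C f)"
  using runit_natural[of f "Dom C f" Y] by simp

lemma lunit_inv_nat: 
  assumes "f \<in> Arr C" and "Cod C f = Y"
  shows "\<l>\<^sup>- Y \<cdot> f = (\<i>\<d> \<one> \<otimes> f) \<cdot> \<l>\<^sup>- (Dom C f)"
  by (rule iso_cancel_left[OF coherence_inverses(2)[of Y]])
    (use assms in \<open>auto simp: comp_tail2[OF lunit_nat]\<close>)

lemma runit_inv_nat: 
  assumes "f \<in> Arr C" and "Cod C f = Y"
  shows "\<r>\<^sup>- Y \<cdot> f = (f \<otimes> \<i>\<d> \<one>) \<cdot> \<r>\<^sup>- (Dom C f)"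
  by (rule iso_cancel_left[OF coherence_inverses(3)[of Y]])
    (use assms in \<open>auto simp: comp_tail2[OF runit_nat]\<close>)

text \<open>
  Equations may be checked after tensoring with the unit object. This is what lets the pentagon,
  an equation between arrows on four factors, decide equations on fewer factors.
\<close>

lemma unit_tensor_faithful:
  assumes "\<i>\<d> \<one> \<otimes> f = \<i>\<d> \<one> \<otimes> g" and "f \<in> Arr C" and "g \<in> Arr C"
    and "Dom C f = Dom C g" and "Cod C f = Cod C g"
  shows "f = g"
proof (rule iso_cancel_right[OF coherence_inverses(2)])
  show "f \<cdot> \<l> (Dom C f) = g \<cdot> \<l> (Dom C f)"
    using assms lunit_nat[of f] lunit_nat[of g] by simp
qed (use assms in simp_all)

lemma tensor_unit_faithful:
  assumes "f \<otimes> \<i>\<d> \<one> = g \<otimes> \<i>\<d> \<one>" and "f \<in> Arr C" and "g \<in> Arr C"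
    and "Dom C f = Dom C g" and "Cod C f = Cod C g"
  shows "f = g"
proof (rule iso_cancel_right[OF coherence_inverses(3)])
  show "f \<cdot> \<r> (Dom C f) = g \<cdot> \<r> (Dom C f)"
    using assms runit_nat[of f] runit_nat[of g] by simp
qed (use assms in simp_all)

lemma pentagon_right:
  "\<lbrakk>W \<in> Obj C; X \<in> Obj C; Y \<in> Obj C; Z \<in> Obj C\<rbrakk> \<Longrightarrow>
    (\<i>\<d> W \<otimes> \<a> X Y Z) \<cdot> (\<a> W (X \<odot> Y) Z \<cdot> (\<a> W X Y \<otimes> \<i>\<d> Z)) =
      \<a> W X (Y \<odot> Z) \<cdot> \<a> (W \<odot> X) Y Z"
  using pentagon[of W X Y Z] by simp

text \<open>
  Kelly's consequences of the pentagon and the triangle. For the first, tensor with \<open>\<one>\<close> on the left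
  and compare the two sides of the pentagon for \<open>\<one>, \<one>, X, Y\<close>; it implies that the two unitors of
  the unit object agree.
\<close>

lemma lunit_tensor:
  assumes X: "X \<in> Obj C" and Y: "Y \<in> Obj C"
  shows "\<l> (X \<odot> Y) \<cdot> \<a> \<one> X Y = \<l> X \<otimes> \<i>\<d> Y"
proof (rule unit_tensor_faithful)
  let ?p = "\<a> \<one> (\<one> \<odot> X) Y \<cdot> (\<a> \<one> \<one> X \<otimes> \<i>\<d> Y)"
  have iso: "inverse_arrows C ?p ((\<a>\<^sup>- \<one> \<one> X \<otimes> \<i>\<d> Y) \<cdot> \<a>\<^sup>- \<one> (\<one> \<odot> X) Y)"
    using X Y by (intro inverse_arrows_comp inverse_arrows_tensor coherence_inverses inverse_arrows_id) simp_all
  have "(\<i>\<d> \<one> \<otimes> (\<l> (X \<odot> Y) \<cdot> \<a> \<one> X Y)) \<cdot> ?p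
      = (\<i>\<d> \<one> \<otimes> \<l> (X \<odot> Y)) \<cdot> ((\<i>\<d> \<one> \<otimes> \<a> \<one> X Y) \<cdot> ?p)"
    using X Y by (simp add: interchange interchange_tail)
  also have "\<dots> = (\<r> \<one> \<otimes> \<i>\<d> (X \<odot> Y)) \<cdot> \<a> (\<one> \<odot> \<one>) X Y"
    using X Y by (simp add: pentagon_right comp_tail[OF triangle])
  also have "\<dots> = \<a> \<one> X Y \<cdot> (((\<i>\<d> \<one> \<otimes> \<l> X) \<cdot> \<a> \<one> \<one> X) \<otimes> \<i>\<d> Y)"
    using X Y assoc_nat[of "\<r> \<one>" "\<i>\<d> X" "\<i>\<d> Y" \<one> X Y] by (simp add: triangle)
  also have "\<dots> = (\<a> \<one> X Y \<cdot> ((\<i>\<d> \<one> \<otimes> \<l> X) \<otimes> \<i>\<d> Y)) \<cdot> (\<a> \<one> \<one> X \<otimes> \<i>\<d> Y)"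
    using X Y by (simp add: interchange)
  also have "\<dots> = (\<i>\<d> \<one> \<otimes> (\<l> X \<otimes> \<i>\<d> Y)) \<cdot> ?p"
    using X Y by (subst assoc_nat) simp_all
  finally show "\<i>\<d> \<one> \<otimes> (\<l> (X \<odot> Y) \<cdot> \<a> \<one> X Y) = \<i>\<d> \<one> \<otimes> (\<l> X \<otimes> \<i>\<d> Y)"
    using X Y by (elim iso_cancel_right[OF iso]) simp_all
qed (use X Y in simp_all)

lemma lunit_inv_tensor:
  assumes X: "X \<in> Obj C" and Y: "Y \<in> Obj C"
  shows "\<a>\<^sup>- \<one> X Y \<cdot> \<l>\<^sup>- (X \<odot> Y) = \<l>\<^sup>- X \<otimes> \<i>\<d> Y"
proof (rule inverse_arrows_unique)
  show "inverse_arrows C (\<l> (X \<odot> Y) \<cdot> \<a> \<one> X Y) (\<a>\<^sup>- \<one> X Y \<cdot> \<l>\<^sup>- (X \<odot> Y))"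
    using X Y by (intro inverse_arrows_comp coherence_inverses) simp_all
  show "inverse_arrows C (\<l> (X \<odot> Y) \<cdot> \<a> \<one> X Y) (\<l>\<^sup>- X \<otimes> \<i>\<d> Y)"
    unfolding lunit_tensor[OF X Y]
    using X Y by (intro inverse_arrows_tensor coherence_inverses inverse_arrows_id)
qed

lemma triangle_inv:
  assumes X: "X \<in> Obj C" and Y: "Y \<in> Obj C"
  shows "\<a>\<^sup>- X \<one> Y \<cdot> (\<i>\<d> X \<otimes> \<l>\<^sup>- Y) = \<r>\<^sup>- X \<otimes> \<i>\<d> Y"
proof (rule inverse_arrows_unique)
  show "inverse_arrows C ((\<i>\<d> X \<otimes> \<l> Y) \<cdot> \<a> X \<one> Y) (\<a>\<^sup>- X \<one> Y \<cdot> (\<i>\<d> X \<otimes> \<l>\<^sup>- Y))"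
    using X Y by (intro inverse_arrows_comp inverse_arrows_tensor inverse_arrows_id coherence_inverses) simp_all
  show "inverse_arrows C ((\<i>\<d> X \<otimes> \<l> Y) \<cdot> \<a> X \<one> Y) (\<r>\<^sup>- X \<otimes> \<i>\<d> Y)"
    unfolding triangle[OF X Y]
    using X Y by (intro inverse_arrows_tensor coherence_inverses inverse_arrows_id)
qed

lemma triangle_inv':
  assumes X: "X \<in> Obj C" and Y: "Y \<in> Obj C"
  shows "(\<r> X \<otimes> \<i>\<d> Y) \<cdot> \<a>\<^sup>- X \<one> Y = \<i>\<d> X \<otimes> \<l> Y"
  using X Y triangle[OF X Y, symmetric] by simp

lemma lunit_eq_runit_unit: "\<l> \<one> = \<r> \<one>"
proof (rule tensor_unit_faithful)
  have "\<l> (\<one> \<odot> \<one>) = \<i>\<d> \<one> \<otimes> \<l> \<one>"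
    by (rule iso_cancel_left[OF coherence_inverses(2)[of \<one>]]) (simp_all add: lunit_nat)
  then show "\<l> \<one> \<otimes> \<i>\<d> \<one> = \<r> \<one> \<otimes> \<i>\<d> \<one>"
    using lunit_tensor[of \<one> \<one>] triangle[of \<one> \<one>] by simp
qed simp_all

lemma pentagon_inv:
  assumes "W \<in> Obj C" and "X \<in> Obj C" and "Y \<in> Obj C" and "Z \<in> Obj C"
  shows "\<a>\<^sup>- (W \<odot> X) Y Z \<cdot> \<a>\<^sup>- W X (Y \<odot> Z) =
    (\<a>\<^sup>- W X Y \<otimes> \<i>\<d> Z) \<cdot> (\<a>\<^sup>- W (X \<odot> Y) Z \<cdot> (\<i>\<d> W \<otimes> \<a>\<^sup>- X Y Z))"
proof (rule inverse_arrows_unique)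
  show "inverse_arrows C (\<a> W X (Y \<odot> Z) \<cdot> \<a> (W \<odot> X) Y Z) (\<a>\<^sup>- (W \<odot> X) Y Z \<cdot> \<a>\<^sup>- W X (Y \<odot> Z))"
    using assms by (intro inverse_arrows_comp coherence_inverses) simp_all
  have "inverse_arrows C ((\<i>\<d> W \<otimes> \<a> X Y Z) \<cdot> \<a> W (X \<odot> Y) Z \<cdot> (\<a> W X Y \<otimes> \<i>\<d> Z))
     ((\<a>\<^sup>- W X Y \<otimes> \<i>\<d> Z) \<cdot> (\<a>\<^sup>- W (X \<odot> Y) Z \<cdot> (\<i>\<d> W \<otimes> \<a>\<^sup>- X Y Z)))"
    using assms
    by (intro inverse_arrows_comp inverse_arrows_tensor coherence_inverses inverse_arrows_id) simp_all
  then show "inverse_arrows C (\<a> W X (Y \<odot> Z) \<cdot> \<a> (W \<odot> X) Y Z)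
     ((\<a>\<^sup>- W X Y \<otimes> \<i>\<d> Z) \<cdot> (\<a>\<^sup>- W (X \<odot> Y) Z \<cdot> (\<i>\<d> W \<otimes> \<a>\<^sup>- X Y Z)))"
    using pentagon[OF assms] by simp
qed

end

section \<open>Coherence of the braiding\<close>

context symmetric_monoidal_category
begin

lemma braid_typing [simp]:
  assumes "X \<in> Obj C" and "Y \<in> Obj C"
  shows "\<s> X Y \<in> Arr C" and "Dom C (\<s> X Y) = X \<odot> Y" and "Cod C (\<s> X Y) = Y \<odot> X"
  using braid_hom[OF assms] by simp_all

lemma braid_inverse: "\<lbrakk>X \<in> Obj C; Y \<in> Obj C\<rbrakk> \<Longrightarrow> inverse_arrows C (\<s> X Y) (\<s> Y X)"
  by (intro inverse_arrowsI) (simp_all add: braid_symmetric)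

lemma braid_nat:
  "\<lbrakk>f \<in> Arr C; g \<in> Arr C; Cod C f = X; Cod C g = Y\<rbrakk> \<Longrightarrow>
    \<s> X Y \<cdot> (f \<otimes> g) = (g \<otimes> f) \<cdot> \<s> (Dom C f) (Dom C g)"
  using braid_natural[of f "Dom C f" X g "Dom C g" Y] by simp

lemma hexagon_inv:
  assumes "X \<in> Obj C" and "Y \<in> Obj C" and "Z \<in> Obj C"
  shows "\<a>\<^sup>- X Y Z \<cdot> (\<s> (Y \<odot> Z) X \<cdot> \<a>\<^sup>- Y Z X) =
    (\<s> Y X \<otimes> \<i>\<d> Z) \<cdot> (\<a>\<^sup>- Y X Z \<cdot> (\<i>\<d> Y \<otimes> \<s> Z X))"
proof (rule inverse_arrows_unique)
  have "inverse_arrows C (\<a> Y Z X \<cdot> \<s> X (Y \<odot> Z) \<cdot> \<a> X Y Z)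
     (\<a>\<^sup>- X Y Z \<cdot> (\<s> (Y \<odot> Z) X \<cdot> \<a>\<^sup>- Y Z X))"
    using assms by (intro inverse_arrows_comp coherence_inverses braid_inverse) simp_all
  then show "inverse_arrows C ((\<i>\<d> Y \<otimes> \<s> X Z) \<cdot> \<a> Y X Z \<cdot> (\<s> X Y \<otimes> \<i>\<d> Z))
     (\<a>\<^sup>- X Y Z \<cdot> (\<s> (Y \<odot> Z) X \<cdot> \<a>\<^sup>- Y Z X))"
    using hexagon[OF assms] by simp
  show "inverse_arrows C ((\<i>\<d> Y \<otimes> \<s> X Z) \<cdot> \<a> Y X Z \<cdot> (\<s> X Y \<otimes> \<i>\<d> Z))
     ((\<s> Y X \<otimes> \<i>\<d> Z) \<cdot> (\<a>\<^sup>- Y X Z \<cdot> (\<i>\<d> Y \<otimes> \<s> Z X)))"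
    using assms
    by (intro inverse_arrows_comp inverse_arrows_tensor coherence_inverses inverse_arrows_id
        braid_inverse) simp_all
qed

text \<open>
  The hexagon for \<open>X, \<one>, \<one>\<close> reads \<open>\<s> X \<one> \<cdot> (\<r> X \<otimes> \<i>\<d> \<one>) = \<s> X \<one> \<cdot> ((\<l> X \<cdot> \<s> X \<one>) \<otimes> \<i>\<d> \<one>)\<close> after the left
  unitor of \<open>\<one> \<odot> X\<close> is applied, and the braiding can be cancelled.
\<close>

lemma lunit_braid:
  assumes X: "X \<in> Obj C"
  shows "\<l> X \<cdot> \<s> X \<one> = \<r> X"
proof (rule tensor_unit_faithful)
  have "\<s> X \<one> \<cdot> (\<r> X \<otimes> \<i>\<d> \<one>) = \<s> X \<one> \<cdot> ((\<i>\<d> X \<otimes> \<l> \<one>) \<cdot> \<a> X \<one> \<one>)"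
    using X by (simp add: triangle)
  also have "\<dots> = (\<l> \<one> \<otimes> \<i>\<d> X) \<cdot> (\<s> X (\<one> \<odot> \<one>) \<cdot> \<a> X \<one> \<one>)"
    using X by (simp add: comp_tail2[OF braid_nat])
  also have "\<dots> = \<l> (\<one> \<odot> X) \<cdot> (\<a> \<one> \<one> X \<cdot> \<s> X (\<one> \<odot> \<one>) \<cdot> \<a> X \<one> \<one>)"
    using X by (simp add: comp_tail[OF lunit_tensor])
  also have "\<dots> = \<l> (\<one> \<odot> X) \<cdot> ((\<i>\<d> \<one> \<otimes> \<s> X \<one>) \<cdot> \<a> \<one> X \<one> \<cdot> (\<s> X \<one> \<otimes> \<i>\<d> \<one>))"
    using X by (simp only: hexagon unit_obj)
  also have "\<dots> = \<s> X \<one> \<cdot> ((\<l> X \<cdot> \<s> X \<one>) \<otimes> \<i>\<d> \<one>)"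
    using X by (simp add: comp_tail2[OF lunit_nat] comp_tail[OF lunit_tensor] interchange)
  finally show "(\<l> X \<cdot> \<s> X \<one>) \<otimes> \<i>\<d> \<one> = \<r> X \<otimes> \<i>\<d> \<one>"
    using X by (elim iso_cancel_left[OF braid_inverse[OF X unit_obj] sym]) simp_all
qed (use X in simp_all)

lemma runit_braid:
  assumes X: "X \<in> Obj C"
  shows "\<r> X \<cdot> \<s> \<one> X = \<l> X"
  unfolding lunit_braid[OF X, symmetric] using X by (simp add: braid_symmetric)

lemma middle_swap_typing [simp]:
  assumes "W \<in> Obj C" and "X \<in> Obj C" and "Y \<in> Obj C" and "Z \<in> Obj C"
  shows "middle_swap C W X Y Z \<in> Arr C"
    and "Dom C (middle_swap C W X Y Z) = (W \<odot> X) \<odot> (Y \<odot> Z)"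
    and "Cod C (middle_swap C W X Y Z) = (W \<odot> Y) \<odot> (X \<odot> Z)"
  using assms by (simp_all add: middle_swap_def)

lemma middle_swap_nat:
  assumes "f \<in> Arr C" and "g \<in> Arr C" and "h \<in> Arr C" and "k \<in> Arr C"
    and "Cod C f = W" and "Cod C g = X" and "Cod C h = Y" and "Cod C k = Z"
  shows "middle_swap C W X Y Z \<cdot> ((f \<otimes> g) \<otimes> (h \<otimes> k)) =
    ((f \<otimes> h) \<otimes> (g \<otimes> k)) \<cdot> middle_swap C (Dom C f) (Dom C g) (Dom C h) (Dom C k)"
proof -
  have O: "W \<in> Obj C" "X \<in> Obj C" "Y \<in> Obj C" "Z \<in> Obj C" using assms by auto
  have inner: "(\<a> Y X Z \<cdot> (\<s> X Y \<otimes> \<i>\<d> Z) \<cdot> \<a>\<^sup>- X Y Z) \<cdot> (g \<otimes> (h \<otimes> k)) =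
    (h \<otimes> (g \<otimes> k)) \<cdot> (\<a> (Dom C h) (Dom C g) (Dom C k) \<cdot>
      (\<s> (Dom C g) (Dom C h) \<otimes> \<i>\<d> (Dom C k)) \<cdot> \<a>\<^sup>- (Dom C g) (Dom C h) (Dom C k))"
    using assms O
    by (simp add: assoc_inv_nat interchange_tail braid_nat comp_tail2[OF assoc_nat, symmetric])
  have outer: "((f \<otimes> h) \<otimes> (g \<otimes> k)) \<cdot> \<a>\<^sup>- (Dom C f) (Dom C h) (Dom C g \<odot> Dom C k) =
      \<a>\<^sup>- W Y (X \<odot> Z) \<cdot> (f \<otimes> (h \<otimes> (g \<otimes> k)))"
    using assms assoc_inv_nat[of f h "g \<otimes> k" W Y "X \<odot> Z"] by simp
  show ?thesis
    unfolding middle_swap_def using assms O inner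
    by (simp add: assoc_nat interchange_tail interchange comp_tail2[OF outer])
qed

text \<open>
  A factor \<open>\<one>\<close> in the second place makes the braiding inside the middle swap trivial. The counit
  of a bimonoid produces such factors.
\<close>

lemma middle_swap_unit:
  assumes "W \<in> Obj C" and "Y \<in> Obj C" and "Z \<in> Obj C"
  shows "(\<i>\<d> (W \<odot> Y) \<otimes> \<l> Z) \<cdot> middle_swap C W \<one> Y Z = \<a>\<^sup>- W Y Z \<cdot> (\<r> W \<otimes> \<i>\<d> (Y \<odot> Z))"
proof -
  have inner: "(\<i>\<d> Y \<otimes> \<l> Z) \<cdot> (\<a> Y \<one> Z \<cdot> (\<s> \<one> Y \<otimes> \<i>\<d> Z) \<cdot> \<a>\<^sup>- \<one> Y Z) = \<l> (Y \<odot> Z)"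
    using assms
    by (simp add: comp_tail[OF triangle] interchange_tail runit_braid lunit_tensor[symmetric])
  have outer: "(\<i>\<d> (W \<odot> Y) \<otimes> \<l> Z) \<cdot> \<a>\<^sup>- W Y (\<one> \<odot> Z) =
      \<a>\<^sup>- W Y Z \<cdot> (\<i>\<d> W \<otimes> (\<i>\<d> Y \<otimes> \<l> Z))"
    using assms assoc_inv_nat[of "\<i>\<d> W" "\<i>\<d> Y" "\<l> Z" W Y Z] by simp
  show ?thesis
    unfolding middle_swap_def using assms inner
    by (simp add: comp_tail2[OF outer] interchange_tail triangle)
qed

end

section \<open>Opposite and mirrored categories\<close>

text \<open>
  Every notion about bimonoids comes in four versions: left or right, for actions or for coactions.
  The opposite category exchanges actions with coactions and kernels with cokernels, the mirrored
  category exchanges left with right. Both are again symmetric monoidal categories. The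
  mirrored one has the same bimonoids, and in the opposite one multiplication and comultiplication
  change places. So most arguments are carried out on one side and for one variance only.
\<close>

definition opposite :: "('o, 'm) sm_category \<Rightarrow> ('o, 'm) sm_category" where
  "opposite C =
    \<lparr>Obj = Obj C, Arr = Arr C, Dom = Cod C, Cod = Dom C, Id = Id C, Comp = (\<lambda>g f. Comp C f g),
     TensorObj = TensorObj C, TensorArr = TensorArr C, UnitObj = UnitObj C,
     Assoc = (\<lambda>X Y Z. inv_arrow C (Assoc C X Y Z)), Lunit = (\<lambda>X. inv_arrow C (Lunit C X)),
     Runit = (\<lambda>X. inv_arrow C (Runit C X)), Braid = (\<lambda>X Y. Braid C Y X)\<rparr>"

definition mirror :: "('o, 'm) sm_category \<Rightarrow> ('o, 'm) sm_category" where
  "mirror C =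
    \<lparr>Obj = Obj C, Arr = Arr C, Dom = Dom C, Cod = Cod C, Id = Id C, Comp = Comp C,
     TensorObj = (\<lambda>X Y. TensorObj C Y X), TensorArr = (\<lambda>f g. TensorArr C g f), UnitObj = UnitObj C,
     Assoc = (\<lambda>X Y Z. inv_arrow C (Assoc C Z Y X)), Lunit = Runit C, Runit = Lunit C,
     Braid = (\<lambda>X Y. Braid C Y X)\<rparr>"

definition dual :: "('o, 'm) bimonoid_data \<Rightarrow> ('o, 'm) bimonoid_data" where
  "dual A = \<lparr>obj = obj A, mult = comult A, unit = counit A, comult = mult A, counit = unit A\<rparr>"

lemma opposite_simps [simp]:
  "Obj (opposite C) = Obj C" "Arr (opposite C) = Arr C" "Dom (opposite C) = Cod C"
  "Cod (opposite C) = Dom C" "Id (opposite C) = Id C" "Comp (opposite C) g f = Comp C f g"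
  "TensorObj (opposite C) = TensorObj C" "TensorArr (opposite C) = TensorArr C"
  "UnitObj (opposite C) = UnitObj C" "Assoc (opposite C) X Y Z = inv_arrow C (Assoc C X Y Z)"
  "Lunit (opposite C) X = inv_arrow C (Lunit C X)" "Runit (opposite C) X = inv_arrow C (Runit C X)"
  "Braid (opposite C) X Y = Braid C Y X"
  by (simp_all add: opposite_def)

lemma mirror_simps [simp]:
  "Obj (mirror C) = Obj C" "Arr (mirror C) = Arr C" "Dom (mirror C) = Dom C"
  "Cod (mirror C) = Cod C" "Id (mirror C) = Id C" "Comp (mirror C) = Comp C"
  "TensorObj (mirror C) X Y = TensorObj C Y X" "TensorArr (mirror C) f g = TensorArr C g f"
  "UnitObj (mirror C) = UnitObj C" "Assoc (mirror C) X Y Z = inv_arrow C (Assoc C Z Y X)"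
  "Lunit (mirror C) = Runit C" "Runit (mirror C) = Lunit C"
  "Braid (mirror C) X Y = Braid C Y X"
  by (simp_all add: mirror_def)

lemma dual_simps [simp]:
  "obj (dual A) = obj A" "mult (dual A) = comult A" "unit (dual A) = counit A"
  "comult (dual A) = mult A" "counit (dual A) = unit A" "dual (dual A) = A"
  by (simp_all add: dual_def)

lemma hom_opposite [simp]: "hom (opposite C) X Y = hom C Y X"
  by (auto simp: hom_def)

lemma hom_mirror [simp]: "hom (mirror C) X Y = hom C X Y"
  by (simp add: hom_def)

lemma inverse_arrows_opposite [simp]: "inverse_arrows (opposite C) f g = inverse_arrows C f g"
  by (auto simp: inverse_arrows_def hom_def)

lemma inverse_arrows_mirror [simp]: "inverse_arrows (mirror C) f g = inverse_arrows C f g"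
  by (simp add: inverse_arrows_def hom_def)

lemma inv_arrow_dual [simp]:
  "inv_arrow (opposite C) f = inv_arrow C f" "inv_arrow (mirror C) f = inv_arrow C f"
  by (simp_all add: inv_arrow_def)

lemma is_iso_dual [simp]:
  "is_iso (opposite C) f = is_iso C f" "is_iso (mirror C) f = is_iso C f"
  by (simp_all add: is_iso_def)

text \<open>
  The two dualities commute strictly, with equal structure arrows. A right coaction can therefore be
  read as a left action in either order of passage.
\<close>

lemma mirror_opposite: "mirror (opposite C) = opposite (mirror C)"
  by (rule sm_category.equality) (simp_all add: fun_eq_iff)

lemma idempotents_split_opposite: "idempotents_split C \<Longrightarrow> idempotents_split (opposite C)"
  unfolding idempotents_split_def by simp metis

lemma idempotents_split_mirror: "idempotents_split C \<Longrightarrow> idempotents_split (mirror C)"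
  unfolding idempotents_split_def by simp

context symmetric_monoidal_category
begin

lemma coherence_isos:
  "\<lbrakk>X \<in> Obj C; Y \<in> Obj C; Z \<in> Obj C\<rbrakk> \<Longrightarrow> is_iso C (\<a>\<^sup>- X Y Z)"
  "X \<in> Obj C \<Longrightarrow> is_iso C (\<l>\<^sup>- X)" "X \<in> Obj C \<Longrightarrow> is_iso C (\<r>\<^sup>- X)"
  unfolding is_iso_def by (metis coherence_inverses inverse_arrows_sym)+

lemma symmetric_monoidal_category_opposite: "symmetric_monoidal_category (opposite C)"
  by unfold_locales
    (simp_all add: interchange assoc_inv_nat lunit_inv_nat runit_inv_nat pentagon_inv triangle_inv
      hexagon_inv coherence_isos braid_nat braid_symmetric)

lemma symmetric_monoidal_category_mirror: "symmetric_monoidal_category (mirror C)"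
  by unfold_locales
    (simp_all add: interchange assoc_inv_nat lunit_nat runit_nat pentagon_inv triangle_inv'
      hexagon_inv coherence_isos lunit_iso runit_iso braid_nat braid_symmetric)

lemma middle_swap_opposite:
  assumes "W \<in> Obj C" and "X \<in> Obj C" and "Y \<in> Obj C" and "Z \<in> Obj C"
  shows "middle_swap (opposite C) W X Y Z = middle_swap C W Y X Z"
  using assms by (simp add: middle_swap_def inv_inv assoc_iso)

text \<open>
  The two bracketings of the middle swap, with the inner associator taken on the right or on the left,
  differ by two pentagons. For this reason a bimonoid remains one in the mirrored category.
\<close>

lemma middle_swap_mirror:
  assumes "W \<in> Obj C" and "X \<in> Obj C" and "Y \<in> Obj C" and "Z \<in> Obj C"
  shows "middle_swap (mirror C) W X Y Z = middle_swap C Z Y X W"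
proof -
  have left: "\<a> (Z \<odot> X) Y W \<cdot> (\<a>\<^sup>- Z X Y \<otimes> \<i>\<d> W) =
      \<a>\<^sup>- Z X (Y \<odot> W) \<cdot> ((\<i>\<d> Z \<otimes> \<a> X Y W) \<cdot> \<a> Z (X \<odot> Y) W)"
  proof (rule iso_cancel_left[OF coherence_inverses(1)[of Z X "Y \<odot> W"]])
    show "\<a> Z X (Y \<odot> W) \<cdot> (\<a> (Z \<odot> X) Y W \<cdot> (\<a>\<^sup>- Z X Y \<otimes> \<i>\<d> W)) =
        \<a> Z X (Y \<odot> W) \<cdot> (\<a>\<^sup>- Z X (Y \<odot> W) \<cdot> ((\<i>\<d> Z \<otimes> \<a> X Y W) \<cdot> \<a> Z (X \<odot> Y) W))"
      using assms by (simp add: comp_tail2[OF pentagon_right[symmetric]] interchange)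
  qed (use assms in simp_all)
  have right: "\<a> Z (Y \<odot> X) W \<cdot> ((\<a> Z Y X \<otimes> \<i>\<d> W) \<cdot> \<a>\<^sup>- (Z \<odot> Y) X W) =
      (\<i>\<d> Z \<otimes> \<a>\<^sup>- Y X W) \<cdot> \<a> Z Y (X \<odot> W)"
  proof (rule iso_cancel_left[OF inverse_arrows_tensor[OF inverse_arrows_id
          coherence_inverses(1)[of Y X W]]])
    have "(\<i>\<d> Z \<otimes> \<a> Y X W) \<cdot> (\<a> Z (Y \<odot> X) W \<cdot> ((\<a> Z Y X \<otimes> \<i>\<d> W) \<cdot> \<a>\<^sup>- (Z \<odot> Y) X W)) =
        ((\<i>\<d> Z \<otimes> \<a> Y X W) \<cdot> (\<a> Z (Y \<odot> X) W \<cdot> (\<a> Z Y X \<otimes> \<i>\<d> W))) \<cdot> \<a>\<^sup>- (Z \<odot> Y) X W"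
      using assms by simp
    also have "\<dots> = (\<a> Z Y (X \<odot> W) \<cdot> \<a> (Z \<odot> Y) X W) \<cdot> \<a>\<^sup>- (Z \<odot> Y) X W"
      using assms by (simp only: pentagon_right)
    also have "\<dots> = (\<i>\<d> Z \<otimes> \<a> Y X W) \<cdot> ((\<i>\<d> Z \<otimes> \<a>\<^sup>- Y X W) \<cdot> \<a> Z Y (X \<odot> W))"
      using assms by (simp add: interchange_tail)
    finally show "(\<i>\<d> Z \<otimes> \<a> Y X W) \<cdot> (\<a> Z (Y \<odot> X) W \<cdot> ((\<a> Z Y X \<otimes> \<i>\<d> W) \<cdot> \<a>\<^sup>- (Z \<odot> Y) X W)) =
        (\<i>\<d> Z \<otimes> \<a> Y X W) \<cdot> ((\<i>\<d> Z \<otimes> \<a>\<^sup>- Y X W) \<cdot> \<a> Z Y (X \<odot> W))" .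
  qed (use assms in simp_all)
  have "middle_swap (mirror C) W X Y Z =
      (\<a> (Z \<odot> X) Y W \<cdot> (\<a>\<^sup>- Z X Y \<otimes> \<i>\<d> W)) \<cdot> (((\<i>\<d> Z \<otimes> \<s> Y X) \<otimes> \<i>\<d> W) \<cdot>
        ((\<a> Z Y X \<otimes> \<i>\<d> W) \<cdot> \<a>\<^sup>- (Z \<odot> Y) X W))"
    using assms by (simp add: middle_swap_def inv_inv assoc_iso interchange_tail)
  also have "\<dots> = \<a>\<^sup>- Z X (Y \<odot> W) \<cdot> ((\<i>\<d> Z \<otimes> \<a> X Y W) \<cdot> ((\<i>\<d> Z \<otimes> (\<s> Y X \<otimes> \<i>\<d> W)) \<cdot>
        (\<a> Z (Y \<odot> X) W \<cdot> ((\<a> Z Y X \<otimes> \<i>\<d> W) \<cdot> \<a>\<^sup>- (Z \<odot> Y) X W))))"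
    unfolding left using assms by (simp add: comp_tail2[OF assoc_nat])
  also have "\<dots> = middle_swap C Z Y X W"
    unfolding right using assms by (simp add: middle_swap_def interchange_tail)
  finally show ?thesis .
qed

end

section \<open>Duality for bimonoids and actions\<close>

context symmetric_monoidal_category
begin

lemma monoid_object_opposite: "monoid_object (opposite C) (dual A) \<longleftrightarrow> comonoid_object C A"
proof (cases "obj A \<in> Obj C \<and> \<Delta>\<^bsub>A\<^esub> \<in> hom C (obj A) (obj A \<odot> obj A) \<and> \<epsilon>\<^bsub>A\<^esub> \<in> hom C (obj A) \<one>")
  case True
  have "\<a> (obj A) (obj A) (obj A) \<cdot> ((\<Delta>\<^bsub>A\<^esub> \<otimes> \<i>\<d> (obj A)) \<cdot> \<Delta>\<^bsub>A\<^esub>) = (\<i>\<d> (obj A) \<otimes> \<Delta>\<^bsub>A\<^esub>) \<cdot> \<Delta>\<^bsub>A\<^esub> \<longleftrightarrow>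
      (\<Delta>\<^bsub>A\<^esub> \<otimes> \<i>\<d> (obj A)) \<cdot> \<Delta>\<^bsub>A\<^esub> = \<a>\<^sup>- (obj A) (obj A) (obj A) \<cdot> ((\<i>\<d> (obj A) \<otimes> \<Delta>\<^bsub>A\<^esub>) \<cdot> \<Delta>\<^bsub>A\<^esub>)"
    using True by (intro iso_transpose_left coherence_inverses) simp_all
  moreover have "\<l> (obj A) \<cdot> ((\<epsilon>\<^bsub>A\<^esub> \<otimes> \<i>\<d> (obj A)) \<cdot> \<Delta>\<^bsub>A\<^esub>) = \<i>\<d> (obj A) \<longleftrightarrow>
      (\<epsilon>\<^bsub>A\<^esub> \<otimes> \<i>\<d> (obj A)) \<cdot> \<Delta>\<^bsub>A\<^esub> = \<l>\<^sup>- (obj A) \<cdot> \<i>\<d> (obj A)"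
    using True by (intro iso_transpose_left coherence_inverses) simp_all
  moreover have "\<r> (obj A) \<cdot> ((\<i>\<d> (obj A) \<otimes> \<epsilon>\<^bsub>A\<^esub>) \<cdot> \<Delta>\<^bsub>A\<^esub>) = \<i>\<d> (obj A) \<longleftrightarrow>
      (\<i>\<d> (obj A) \<otimes> \<epsilon>\<^bsub>A\<^esub>) \<cdot> \<Delta>\<^bsub>A\<^esub> = \<r>\<^sup>- (obj A) \<cdot> \<i>\<d> (obj A)"
    using True by (intro iso_transpose_left coherence_inverses) simp_all
  ultimately show ?thesis
    using True by (simp add: monoid_object_def comonoid_object_def)
qed (auto simp: monoid_object_def comonoid_object_def)

lemma comonoid_object_opposite: "comonoid_object (opposite C) (dual A) \<longleftrightarrow> monoid_object C A"
proof (cases "obj A \<in> Obj C \<and> \<nabla>\<^bsub>A\<^esub> \<in> hom C (obj A \<odot> obj A) (obj A) \<and> \<eta>\<^bsub>A\<^esub> \<in> hom C \<one> (obj A)")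
  case True
  have "((\<nabla>\<^bsub>A\<^esub> \<cdot> (\<i>\<d> (obj A) \<otimes> \<nabla>\<^bsub>A\<^esub>)) \<cdot> \<a> (obj A) (obj A) (obj A) = \<nabla>\<^bsub>A\<^esub> \<cdot> (\<nabla>\<^bsub>A\<^esub> \<otimes> \<i>\<d> (obj A))) \<longleftrightarrow>
      \<nabla>\<^bsub>A\<^esub> \<cdot> (\<i>\<d> (obj A) \<otimes> \<nabla>\<^bsub>A\<^esub>) = (\<nabla>\<^bsub>A\<^esub> \<cdot> (\<nabla>\<^bsub>A\<^esub> \<otimes> \<i>\<d> (obj A))) \<cdot> \<a>\<^sup>- (obj A) (obj A) (obj A)"
    using True by (intro iso_transpose_right coherence_inverses) simp_all
  moreover have "\<i>\<d> (obj A) \<cdot> \<l> (obj A) = \<nabla>\<^bsub>A\<^esub> \<cdot> (\<eta>\<^bsub>A\<^esub> \<otimes> \<i>\<d> (obj A)) \<longleftrightarrow>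
      \<i>\<d> (obj A) = (\<nabla>\<^bsub>A\<^esub> \<cdot> (\<eta>\<^bsub>A\<^esub> \<otimes> \<i>\<d> (obj A))) \<cdot> \<l>\<^sup>- (obj A)"
    using True by (intro iso_transpose_right coherence_inverses) simp_all
  moreover have "\<i>\<d> (obj A) \<cdot> \<r> (obj A) = \<nabla>\<^bsub>A\<^esub> \<cdot> (\<i>\<d> (obj A) \<otimes> \<eta>\<^bsub>A\<^esub>) \<longleftrightarrow>
      \<i>\<d> (obj A) = (\<nabla>\<^bsub>A\<^esub> \<cdot> (\<i>\<d> (obj A) \<otimes> \<eta>\<^bsub>A\<^esub>)) \<cdot> \<r>\<^sup>- (obj A)"
    using True by (intro iso_transpose_right coherence_inverses) simp_all
  ultimately show ?thesis
    using True by (auto simp add: monoid_object_def comonoid_object_def)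
qed (auto simp: monoid_object_def comonoid_object_def)

lemma monoid_object_mirror: "monoid_object (mirror C) A \<longleftrightarrow> monoid_object C A"
proof (cases "obj A \<in> Obj C \<and> \<nabla>\<^bsub>A\<^esub> \<in> hom C (obj A \<odot> obj A) (obj A) \<and> \<eta>\<^bsub>A\<^esub> \<in> hom C \<one> (obj A)")
  case True
  have "((\<nabla>\<^bsub>A\<^esub> \<cdot> (\<i>\<d> (obj A) \<otimes> \<nabla>\<^bsub>A\<^esub>)) \<cdot> \<a> (obj A) (obj A) (obj A) = \<nabla>\<^bsub>A\<^esub> \<cdot> (\<nabla>\<^bsub>A\<^esub> \<otimes> \<i>\<d> (obj A))) \<longleftrightarrow>
      \<nabla>\<^bsub>A\<^esub> \<cdot> (\<i>\<d> (obj A) \<otimes> \<nabla>\<^bsub>A\<^esub>) = (\<nabla>\<^bsub>A\<^esub> \<cdot> (\<nabla>\<^bsub>A\<^esub> \<otimes> \<i>\<d> (obj A))) \<cdot> \<a>\<^sup>- (obj A) (obj A) (obj A)"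
    using True by (intro iso_transpose_right coherence_inverses) simp_all
  then show ?thesis
    using True by (auto simp add: monoid_object_def)
qed (auto simp: monoid_object_def)

lemma comonoid_object_mirror: "comonoid_object (mirror C) A \<longleftrightarrow> comonoid_object C A"
proof (cases "obj A \<in> Obj C \<and> \<Delta>\<^bsub>A\<^esub> \<in> hom C (obj A) (obj A \<odot> obj A) \<and> \<epsilon>\<^bsub>A\<^esub> \<in> hom C (obj A) \<one>")
  case True
  have "\<a> (obj A) (obj A) (obj A) \<cdot> ((\<Delta>\<^bsub>A\<^esub> \<otimes> \<i>\<d> (obj A)) \<cdot> \<Delta>\<^bsub>A\<^esub>) = (\<i>\<d> (obj A) \<otimes> \<Delta>\<^bsub>A\<^esub>) \<cdot> \<Delta>\<^bsub>A\<^esub> \<longleftrightarrow>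
      (\<Delta>\<^bsub>A\<^esub> \<otimes> \<i>\<d> (obj A)) \<cdot> \<Delta>\<^bsub>A\<^esub> = \<a>\<^sup>- (obj A) (obj A) (obj A) \<cdot> ((\<i>\<d> (obj A) \<otimes> \<Delta>\<^bsub>A\<^esub>) \<cdot> \<Delta>\<^bsub>A\<^esub>)"
    using True by (intro iso_transpose_left coherence_inverses) simp_all
  then show ?thesis
    using True by (auto simp add: comonoid_object_def)
qed (auto simp: comonoid_object_def)

lemma monoid_object_typing:
  assumes "monoid_object C A"
  shows "obj A \<in> Obj C" "\<nabla>\<^bsub>A\<^esub> \<in> Arr C" "Dom C \<nabla>\<^bsub>A\<^esub> = obj A \<odot> obj A" "Cod C \<nabla>\<^bsub>A\<^esub> = obj A"
    "\<eta>\<^bsub>A\<^esub> \<in> Arr C" "Dom C \<eta>\<^bsub>A\<^esub> = \<one>" "Cod C \<eta>\<^bsub>A\<^esub> = obj A"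
  using assms by (simp_all add: monoid_object_def)

lemma comonoid_object_typing:
  assumes "comonoid_object C A"
  shows "obj A \<in> Obj C" "\<Delta>\<^bsub>A\<^esub> \<in> Arr C" "Cod C \<Delta>\<^bsub>A\<^esub> = obj A \<odot> obj A" "Dom C \<Delta>\<^bsub>A\<^esub> = obj A"
    "\<epsilon>\<^bsub>A\<^esub> \<in> Arr C" "Cod C \<epsilon>\<^bsub>A\<^esub> = \<one>" "Dom C \<epsilon>\<^bsub>A\<^esub> = obj A"
  using assms by (simp_all add: comonoid_object_def)

lemma bimonoid_typing [simp]:
  assumes "bimonoid C A"
  shows "obj A \<in> Obj C" "\<nabla>\<^bsub>A\<^esub> \<in> Arr C" "Dom C \<nabla>\<^bsub>A\<^esub> = obj A \<odot> obj A" "Cod C \<nabla>\<^bsub>A\<^esub> = obj A"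
    "\<eta>\<^bsub>A\<^esub> \<in> Arr C" "Dom C \<eta>\<^bsub>A\<^esub> = \<one>" "Cod C \<eta>\<^bsub>A\<^esub> = obj A"
    "\<Delta>\<^bsub>A\<^esub> \<in> Arr C" "Cod C \<Delta>\<^bsub>A\<^esub> = obj A \<odot> obj A" "Dom C \<Delta>\<^bsub>A\<^esub> = obj A"
    "\<epsilon>\<^bsub>A\<^esub> \<in> Arr C" "Cod C \<epsilon>\<^bsub>A\<^esub> = \<one>" "Dom C \<epsilon>\<^bsub>A\<^esub> = obj A"
  using assms monoid_object_typing comonoid_object_typing by (simp_all add: bimonoid_def)

lemma bimonoid_opposite [simp]: "bimonoid (opposite C) (dual A) \<longleftrightarrow> bimonoid C A"
proof (cases "monoid_object C A \<and> comonoid_object C A")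
  case True
  note typing = monoid_object_typing[OF conjunct1[OF True]] comonoid_object_typing[OF conjunct2[OF True]]
  show ?thesis
    unfolding bimonoid_def using True typing
    by (auto simp: monoid_object_opposite comonoid_object_opposite
        middle_swap_opposite inv_inv lunit_iso)
next
  case False
  then show ?thesis
    unfolding bimonoid_def by (auto simp: monoid_object_opposite comonoid_object_opposite)
qed

lemma bimonoid_mirror [simp]: "bimonoid (mirror C) A \<longleftrightarrow> bimonoid C A"
  unfolding bimonoid_def
  by (auto simp: monoid_object_mirror comonoid_object_mirror
      middle_swap_mirror monoid_object_typing lunit_eq_runit_unit)

lemma bimonoid_hom_opposite [simp]:
  "bimonoid_hom (opposite C) (dual B) (dual A) f \<longleftrightarrow> bimonoid_hom C A B f"
  by (auto simp: bimonoid_hom_def)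

lemma bimonoid_hom_mirror [simp]: "bimonoid_hom (mirror C) A B f \<longleftrightarrow> bimonoid_hom C A B f"
  by (simp add: bimonoid_hom_def)

lemma is_kernel_opposite:
  assumes "is_cokernel C A B \<xi> Q q"
  shows "is_kernel (opposite C) (dual B) (dual A) \<xi> (dual Q) q"
proof -
  have "\<exists>!g. bimonoid_hom (opposite C) L (dual Q) g \<and> g \<cdot> q = f"
    if "bimonoid_hom (opposite C) L (dual B) f" and "f \<cdot> \<xi> = f \<cdot> (\<eta>\<^bsub>B\<^esub> \<cdot> \<epsilon>\<^bsub>A\<^esub>)" for L f
    using assms that bimonoid_hom_opposite[of "dual L"] unfolding is_cokernel_def by simp
  then show ?thesis
    using assms by (simp add: is_kernel_def is_cokernel_def)
qed

lemma is_cokernel_opposite: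
  assumes "is_kernel C A B \<xi> K k"
  shows "is_cokernel (opposite C) (dual B) (dual A) \<xi> (dual K) k"
proof -
  have "\<exists>!g. bimonoid_hom (opposite C) (dual K) L g \<and> k \<cdot> g = f"
    if "bimonoid_hom (opposite C) (dual A) L f" and "\<xi> \<cdot> f = (\<eta>\<^bsub>B\<^esub> \<cdot> \<epsilon>\<^bsub>A\<^esub>) \<cdot> f" for L f
    using assms that bimonoid_hom_opposite[of _ "dual L"] unfolding is_kernel_def by simp
  then show ?thesis
    using assms by (simp add: is_kernel_def is_cokernel_def)
qed

lemma left_action_opposite:
  "left_action (opposite C) (dual A) X \<alpha> \<longleftrightarrow> left_coaction C A X \<alpha>"
proof (cases "bimonoid C A \<and> X \<in> Obj C \<and> \<alpha> \<in> hom C X (obj A \<odot> X)")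
  case True
  have "\<a> (obj A) (obj A) X \<cdot> ((\<Delta>\<^bsub>A\<^esub> \<otimes> \<i>\<d> X) \<cdot> \<alpha>) = (\<i>\<d> (obj A) \<otimes> \<alpha>) \<cdot> \<alpha> \<longleftrightarrow>
      (\<Delta>\<^bsub>A\<^esub> \<otimes> \<i>\<d> X) \<cdot> \<alpha> = \<a>\<^sup>- (obj A) (obj A) X \<cdot> ((\<i>\<d> (obj A) \<otimes> \<alpha>) \<cdot> \<alpha>)"
    using True by (intro iso_transpose_left coherence_inverses) simp_all
  moreover have "\<l> X \<cdot> ((\<epsilon>\<^bsub>A\<^esub> \<otimes> \<i>\<d> X) \<cdot> \<alpha>) = \<i>\<d> X \<longleftrightarrow> (\<epsilon>\<^bsub>A\<^esub> \<otimes> \<i>\<d> X) \<cdot> \<alpha> = \<l>\<^sup>- X \<cdot> \<i>\<d> X"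
    using True by (intro iso_transpose_left coherence_inverses) simp_all
  ultimately show ?thesis
    using True by (simp add: left_action_def left_coaction_def)
qed (auto simp: left_action_def left_coaction_def)

lemma left_action_mirror: "left_action (mirror C) A X \<alpha> \<longleftrightarrow> right_action C A X \<alpha>"
proof (cases "bimonoid C A \<and> X \<in> Obj C \<and> \<alpha> \<in> hom C (X \<odot> obj A) X")
  case True
  have "(\<alpha> \<cdot> (\<i>\<d> X \<otimes> \<nabla>\<^bsub>A\<^esub>)) \<cdot> \<a> X (obj A) (obj A) = \<alpha> \<cdot> (\<alpha> \<otimes> \<i>\<d> (obj A)) \<longleftrightarrow>
      \<alpha> \<cdot> (\<i>\<d> X \<otimes> \<nabla>\<^bsub>A\<^esub>) = (\<alpha> \<cdot> (\<alpha> \<otimes> \<i>\<d> (obj A))) \<cdot> \<a>\<^sup>- X (obj A) (obj A)"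
    using True by (intro iso_transpose_right coherence_inverses) simp_all
  then show ?thesis
    using True by (auto simp: left_action_def right_action_def)
qed (auto simp: left_action_def right_action_def)

lemma left_coaction_mirror: "left_coaction (mirror C) A X \<beta> \<longleftrightarrow> right_coaction C A X \<beta>"
proof (cases "bimonoid C A \<and> X \<in> Obj C \<and> \<beta> \<in> hom C X (X \<odot> obj A)")
  case True
  have "\<a> X (obj A) (obj A) \<cdot> ((\<beta> \<otimes> \<i>\<d> (obj A)) \<cdot> \<beta>) = (\<i>\<d> X \<otimes> \<Delta>\<^bsub>A\<^esub>) \<cdot> \<beta> \<longleftrightarrow>
      (\<beta> \<otimes> \<i>\<d> (obj A)) \<cdot> \<beta> = \<a>\<^sup>- X (obj A) (obj A) \<cdot> ((\<i>\<d> X \<otimes> \<Delta>\<^bsub>A\<^esub>) \<cdot> \<beta>)"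
    using True by (intro iso_transpose_left coherence_inverses) simp_all
  then show ?thesis
    using True by (auto simp: left_coaction_def right_coaction_def)
qed (auto simp: left_coaction_def right_coaction_def)

end

lemma stabilized_dual:
  "left_action_stabilized (opposite C) (dual A) X \<alpha> S p = left_coaction_stabilized C A X \<alpha> S p"
  "left_action_stabilized (mirror C) A X \<alpha> S p = right_action_stabilized C A X \<alpha> S p"
  "left_coaction_stabilized (mirror C) A X \<beta> S j = right_coaction_stabilized C A X \<beta> S j"
  by (auto simp: left_action_stabilized_def left_coaction_stabilized_def
      right_action_stabilized_def right_coaction_stabilized_def is_equalizer_def is_coequalizer_def
      trivial_left_action_def trivial_left_coaction_def trivial_right_action_def
      trivial_right_coaction_def)

lemma invariant_dual:
  "left_action_invariant (opposite C) (dual A) X \<alpha> I i = left_coaction_invariant C A X \<alpha> I i"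
  "left_action_invariant (mirror C) A X \<alpha> I i = right_action_invariant C A X \<alpha> I i"
  "left_coaction_invariant (mirror C) A X \<beta> I i = right_coaction_invariant C A X \<beta> I i"
  by (simp_all add: left_action_invariant_def left_coaction_invariant_def
      right_action_invariant_def right_coaction_invariant_def)

lemma integral_mirror:
  "right_integral (mirror C) A B \<xi> \<mu> = left_integral C A B \<xi> \<mu>"
  "left_integral (mirror C) A B \<xi> \<mu> = right_integral C A B \<xi> \<mu>"
  by (simp_all add: right_integral_def left_integral_def)

context symmetric_monoidal_category
begin

lemma bimonoid_homD:
  assumes "bimonoid_hom C A B f"
  shows "bimonoid C A" "bimonoid C B" "f \<in> Arr C" "Dom C f = obj A" "Cod C f = obj B"
    "f \<cdot> \<nabla>\<^bsub>A\<^esub> = \<nabla>\<^bsub>B\<^esub> \<cdot> (f \<otimes> f)" "f \<cdot> \<eta>\<^bsub>A\<^esub> = \<eta>\<^bsub>B\<^esub>"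
    "\<Delta>\<^bsub>B\<^esub> \<cdot> f = (f \<otimes> f) \<cdot> \<Delta>\<^bsub>A\<^esub>" "\<epsilon>\<^bsub>B\<^esub> \<cdot> f = \<epsilon>\<^bsub>A\<^esub>"
  using assms by (simp_all add: bimonoid_hom_def)

lemma bimonoid_hom_comp:
  assumes "bimonoid_hom C A B f" and "bimonoid_hom C B D g"
  shows "bimonoid_hom C A D (g \<cdot> f)"
proof -
  note f = bimonoid_homD[OF assms(1)] and g = bimonoid_homD[OF assms(2)]
  show ?thesis
    using f(1-5) g(1-5)
    by (simp add: bimonoid_hom_def f(6-9) g(6-9) comp_tail[OF g(6)] comp_tail[OF g(8)]
        comp_tail[OF g(9)] interchange interchange_tail)
qed

lemma integral_opposite:
  assumes "bimonoid_hom C A B \<xi>"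
  shows "right_integral (opposite C) (dual B) (dual A) \<xi> \<mu> = right_integral C A B \<xi> \<mu>"
    and "left_integral (opposite C) (dual B) (dual A) \<xi> \<mu> = left_integral C A B \<xi> \<mu>"
  using bimonoid_homD(1-5)[OF assms] by (auto simp: right_integral_def left_integral_def)

end

section \<open>Small bimonoids and normalized integrals\<close>

text \<open>The part of smallness that concerns left actions. The remaining part is the same property in
  the mirrored category.\<close>

definition left_small :: "('o, 'm) sm_category \<Rightarrow> ('o, 'm) bimonoid_data \<Rightarrow> bool" where
  "left_small C A \<longleftrightarrow>
     bimonoid C A \<and>
     (\<forall>X \<alpha>. left_action C A X \<alpha> \<longrightarrow>
       (\<exists>I i S p. left_action_invariant C A X \<alpha> I i \<and> left_action_stabilized C A X \<alpha> S p \<and>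
         is_iso C (Comp C p i)))"

context
  fixes C :: "('o, 'm) sm_category" (structure)
begin

text \<open>In elements, \<open>x \<sigma> = \<epsilon>(x) \<sigma>\<close>.\<close>

definition left_integral_in :: "('o, 'm) bimonoid_data \<Rightarrow> 'm \<Rightarrow> bool" where
  "left_integral_in K \<sigma> \<longleftrightarrow>
     \<sigma> \<in> hom C \<one> (obj K) \<and> \<nabla>\<^bsub>K\<^esub> \<cdot> (\<i>\<d> (obj K) \<otimes> \<sigma>) = \<l> (obj K) \<cdot> (\<epsilon>\<^bsub>K\<^esub> \<otimes> \<sigma>)"

definition act_by :: "'o \<Rightarrow> 'm \<Rightarrow> 'm \<Rightarrow> 'm" where
  "act_by X \<alpha> x = \<alpha> \<cdot> ((x \<otimes> \<i>\<d> X) \<cdot> inv_arrow C (\<l> X))"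

end

text \<open>
  The two-sided integrals of Hopf algebra theory with counit one. A normalized integral of the dual
  bimonoid in the opposite category is a normalized cointegral, that is, an invariant functional.
\<close>

definition normalized_integral_in ::
    "('o, 'm) sm_category \<Rightarrow> ('o, 'm) bimonoid_data \<Rightarrow> 'm \<Rightarrow> bool" where
  "normalized_integral_in C K \<sigma> \<longleftrightarrow>
     bimonoid C K \<and> left_integral_in C K \<sigma> \<and> left_integral_in (mirror C) K \<sigma> \<and>
     Comp C (counit K) \<sigma> = Id C (UnitObj C)"

context symmetric_monoidal_category
begin

lemma small_iff_left_small: "small C K \<longleftrightarrow> left_small C K \<and> left_small (mirror C) K"
  by (auto simp: small_def left_small_def left_action_mirror stabilized_dual invariant_dual)

lemma left_small_opposite:
  "left_small (opposite C) (dual K) \<longleftrightarrow>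
     bimonoid C K \<and>
     (\<forall>Y \<beta>. left_coaction C K Y \<beta> \<longrightarrow>
       (\<exists>S j Q q. left_coaction_stabilized C K Y \<beta> S j \<and> left_coaction_invariant C K Y \<beta> Q q \<and>
         is_iso C (q \<cdot> j)))"
  by (simp add: left_small_def left_action_opposite stabilized_dual invariant_dual) metis

lemma normalized_integral_in_mirror:
  "normalized_integral_in (mirror C) K \<sigma> \<longleftrightarrow> normalized_integral_in C K \<sigma>"
  by (auto simp: normalized_integral_in_def left_integral_in_def)

lemma cosmall_iff_small: "cosmall C K \<longleftrightarrow> small (opposite C) (dual K)"
proof -
  interpret O: symmetric_monoidal_category "opposite C" by (rule symmetric_monoidal_category_opposite)
  interpret M: symmetric_monoidal_category "mirror C" by (rule symmetric_monoidal_category_mirror)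
  show ?thesis
    unfolding O.small_iff_left_small mirror_opposite left_small_opposite M.left_small_opposite
    by (auto simp: cosmall_def left_coaction_mirror stabilized_dual invariant_dual)
qed

text \<open>
  Comparing \<open>\<one> \<odot> X\<close> with \<open>Z \<odot> \<one>\<close> uses that the two unitors of \<open>\<one>\<close> agree. This is how
  \<open>x \<sigma> = \<epsilon>(x) \<sigma>\<close> becomes the statement that the endomorphism \<open>x \<mapsto> x \<sigma>\<close> is \<open>\<sigma> \<cdot> \<epsilon>\<close>.
\<close>

lemma lunit_scalar:
  assumes "f \<in> hom C Z \<one>" and "x \<in> hom C \<one> X"
  shows "\<l> X \<cdot> ((f \<otimes> x) \<cdot> \<r>\<^sup>- Z) = x \<cdot> f"
proof -
  have Z: "Z \<in> Obj C" "X \<in> Obj C" using assms by auto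
  have "\<l> X \<cdot> ((f \<otimes> x) \<cdot> \<r>\<^sup>- Z) = (\<l> X \<cdot> (\<i>\<d> \<one> \<otimes> x)) \<cdot> ((f \<otimes> \<i>\<d> \<one>) \<cdot> \<r>\<^sup>- Z)"
    using assms Z by (simp add: interchange_tail)
  also have "\<dots> = x \<cdot> ((\<r> \<one> \<cdot> (f \<otimes> \<i>\<d> \<one>)) \<cdot> \<r>\<^sup>- Z)"
    using assms Z by (simp add: lunit_nat lunit_eq_runit_unit)
  also have "\<dots> = x \<cdot> f"
    using assms Z by (simp add: runit_nat)
  finally show ?thesis .
qed

lemma runit_scalar:
  assumes "f \<in> hom C Z \<one>" and "x \<in> hom C \<one> X"
  shows "\<r> X \<cdot> ((x \<otimes> f) \<cdot> \<l>\<^sup>- Z) = x \<cdot> f"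
  using symmetric_monoidal_category.lunit_scalar[OF symmetric_monoidal_category_mirror, of f Z x X]
    assms by simp

lemma left_integral_in_typing:
  assumes "left_integral_in C K \<sigma>"
  shows "\<sigma> \<in> Arr C" "Dom C \<sigma> = \<one>" "Cod C \<sigma> = obj K"
  using assms by (simp_all add: left_integral_in_def)

lemma normalized_integral_inD:
  assumes "normalized_integral_in C K \<sigma>"
  shows "bimonoid C K" "\<sigma> \<in> Arr C" "Dom C \<sigma> = \<one>" "Cod C \<sigma> = obj K" 
    "\<nabla>\<^bsub>K\<^esub> \<cdot> (\<i>\<d> (obj K) \<otimes> \<sigma>) = \<l> (obj K) \<cdot> (\<epsilon>\<^bsub>K\<^esub> \<otimes> \<sigma>)"
    "\<nabla>\<^bsub>K\<^esub> \<cdot> (\<sigma> \<otimes> \<i>\<d> (obj K)) = \<r> (obj K) \<cdot> (\<sigma> \<otimes> \<epsilon>\<^bsub>K\<^esub>)"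
    "\<epsilon>\<^bsub>K\<^esub> \<cdot> \<sigma> = \<i>\<d> \<one>"
  using assms by (simp_all add: normalized_integral_in_def left_integral_in_def)

lemma bimonoidD:
  assumes "bimonoid C A"
  shows "\<nabla>\<^bsub>A\<^esub> \<cdot> (\<nabla>\<^bsub>A\<^esub> \<otimes> \<i>\<d> (obj A)) =
      \<nabla>\<^bsub>A\<^esub> \<cdot> ((\<i>\<d> (obj A) \<otimes> \<nabla>\<^bsub>A\<^esub>) \<cdot> \<a> (obj A) (obj A) (obj A))"
    and "\<nabla>\<^bsub>A\<^esub> \<cdot> (\<eta>\<^bsub>A\<^esub> \<otimes> \<i>\<d> (obj A)) = \<l> (obj A)"
    and "\<nabla>\<^bsub>A\<^esub> \<cdot> (\<i>\<d> (obj A) \<otimes> \<eta>\<^bsub>A\<^esub>) = \<r> (obj A)"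
    and "\<Delta>\<^bsub>A\<^esub> \<cdot> \<nabla>\<^bsub>A\<^esub> =
       (\<nabla>\<^bsub>A\<^esub> \<otimes> \<nabla>\<^bsub>A\<^esub>) \<cdot> (middle_swap C (obj A) (obj A) (obj A) (obj A) \<cdot> (\<Delta>\<^bsub>A\<^esub> \<otimes> \<Delta>\<^bsub>A\<^esub>))"
    and "\<Delta>\<^bsub>A\<^esub> \<cdot> \<eta>\<^bsub>A\<^esub> = (\<eta>\<^bsub>A\<^esub> \<otimes> \<eta>\<^bsub>A\<^esub>) \<cdot> \<l>\<^sup>- \<one>"
    and "\<epsilon>\<^bsub>A\<^esub> \<cdot> \<nabla>\<^bsub>A\<^esub> = \<l> \<one> \<cdot> (\<epsilon>\<^bsub>A\<^esub> \<otimes> \<epsilon>\<^bsub>A\<^esub>)"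
    and "\<epsilon>\<^bsub>A\<^esub> \<cdot> \<eta>\<^bsub>A\<^esub> = \<i>\<d> \<one>"
    and "\<r> (obj A) \<cdot> ((\<i>\<d> (obj A) \<otimes> \<epsilon>\<^bsub>A\<^esub>) \<cdot> \<Delta>\<^bsub>A\<^esub>) = \<i>\<d> (obj A)"
  using assms bimonoid_typing[OF assms] unfolding bimonoid_def monoid_object_def comonoid_object_def
  by simp_all

text \<open>
  The regular action has the counit as its stabilized object, so the inverse of the canonical
  arrow turns the unit of the bimonoid into an invariant element of counit one.
\<close>

lemma left_small_imp_integral:
  assumes "left_small C K"
  shows "\<exists>\<sigma>. left_integral_in C K \<sigma> \<and> \<epsilon>\<^bsub>K\<^esub> \<cdot> \<sigma> = \<i>\<d> \<one>"
proof -
  have K: "bimonoid C K" using assms by (simp add: left_small_def)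
  have "left_action C K (obj K) \<nabla>\<^bsub>K\<^esub>"
    using K by (simp add: left_action_def bimonoidD)
  then obtain I i S p where inv: "left_action_invariant C K (obj K) \<nabla>\<^bsub>K\<^esub> I i"
    and stab: "left_action_stabilized C K (obj K) \<nabla>\<^bsub>K\<^esub> S p" and "is_iso C (p \<cdot> i)"
    using assms unfolding left_small_def by blast
  then obtain g where iso: "inverse_arrows C (p \<cdot> i) g" unfolding is_iso_def by blast
  have i: "i \<in> Arr C" "Dom C i = I" "Cod C i = obj K"
      "\<nabla>\<^bsub>K\<^esub> \<cdot> (\<i>\<d> (obj K) \<otimes> i) = \<l> (obj K) \<cdot> (\<epsilon>\<^bsub>K\<^esub> \<otimes> i)"
    using inv by (simp_all add: left_action_invariant_def)
  have p: "p \<in> Arr C" "Dom C p = obj K" "Cod C p = S"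
      "p \<cdot> \<nabla>\<^bsub>K\<^esub> = p \<cdot> (\<l> (obj K) \<cdot> (\<epsilon>\<^bsub>K\<^esub> \<otimes> \<i>\<d> (obj K)))"
    using stab by (simp_all add: left_action_stabilized_def is_coequalizer_def trivial_left_action_def)
  have g: "g \<in> Arr C" "Dom C g = S" "Cod C g = I" "p \<cdot> (i \<cdot> g) = \<i>\<d> S"
    using inverse_arrowsD[OF iso] i p by simp_all
  have nat: "\<epsilon>\<^bsub>K\<^esub> \<cdot> \<l> (obj K) = \<l> \<one> \<cdot> (\<i>\<d> \<one> \<otimes> \<epsilon>\<^bsub>K\<^esub>)"
    using K by (simp add: lunit_nat)
  have "\<epsilon>\<^bsub>K\<^esub> \<cdot> \<nabla>\<^bsub>K\<^esub> = \<epsilon>\<^bsub>K\<^esub> \<cdot> (\<l> (obj K) \<cdot> (\<epsilon>\<^bsub>K\<^esub> \<otimes> \<i>\<d> (obj K)))"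
    using K by (simp add: bimonoidD comp_tail2[OF nat] interchange)
  then obtain k where k: "k \<in> hom C S \<one>" "k \<cdot> p = \<epsilon>\<^bsub>K\<^esub>"
    using stab K unfolding left_action_stabilized_def is_coequalizer_def trivial_left_action_def
    by (metis bimonoid_typing(11-13) in_hom_iff)
  have ip: "p \<cdot> (\<eta>\<^bsub>K\<^esub> \<cdot> \<epsilon>\<^bsub>K\<^esub>) = p"
  proof -
    have "p = (p \<cdot> \<nabla>\<^bsub>K\<^esub>) \<cdot> ((\<i>\<d> (obj K) \<otimes> \<eta>\<^bsub>K\<^esub>) \<cdot> \<r>\<^sup>- (obj K))"
      using K p(1-3) by (simp add: comp_tail[OF bimonoidD(3)])
    also have "\<dots> = p \<cdot> (\<eta>\<^bsub>K\<^esub> \<cdot> \<epsilon>\<^bsub>K\<^esub>)"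
      unfolding p(4) using K p(1-3) lunit_scalar[of "\<epsilon>\<^bsub>K\<^esub>" "obj K" "\<eta>\<^bsub>K\<^esub>" "obj K"]
      by (simp add: interchange_tail)
    finally show ?thesis by simp
  qed
  define \<sigma> where "\<sigma> = i \<cdot> (g \<cdot> (p \<cdot> \<eta>\<^bsub>K\<^esub>))"
  have "\<epsilon>\<^bsub>K\<^esub> \<cdot> \<sigma> = \<i>\<d> \<one>"
  proof -
    have "\<epsilon>\<^bsub>K\<^esub> \<cdot> \<sigma> = k \<cdot> ((p \<cdot> (i \<cdot> g)) \<cdot> (p \<cdot> \<eta>\<^bsub>K\<^esub>))"
      unfolding \<sigma>_def k(2)[symmetric] using K i(1-3) p(1-3) g(1-3) k(1) by simp
    also have "\<dots> = (k \<cdot> p) \<cdot> \<eta>\<^bsub>K\<^esub>"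
      unfolding g(4) using K p(1-3) k(1) by simp
    also have "\<dots> = \<i>\<d> \<one>"
      unfolding k(2) using K by (simp add: bimonoidD)
    finally show ?thesis .
  qed
  moreover have "left_integral_in C K \<sigma>"
  proof -
    have "\<nabla>\<^bsub>K\<^esub> \<cdot> (\<i>\<d> (obj K) \<otimes> \<sigma>) =
        (\<nabla>\<^bsub>K\<^esub> \<cdot> (\<i>\<d> (obj K) \<otimes> i)) \<cdot> (\<i>\<d> (obj K) \<otimes> (g \<cdot> (p \<cdot> \<eta>\<^bsub>K\<^esub>)))"
      unfolding \<sigma>_def using K i(1-3) p(1-3) g(1-3) by (simp add: interchange)
    also have "\<dots> = \<l> (obj K) \<cdot> (\<epsilon>\<^bsub>K\<^esub> \<otimes> \<sigma>)"
      unfolding i(4) \<sigma>_def using K i(1-3) p(1-3) g(1-3) by (simp add: interchange)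
    finally show ?thesis
      unfolding left_integral_in_def \<sigma>_def using K i(1-3) p(1-3) g(1-3) by simp
  qed
  ultimately show ?thesis by blast
qed

text \<open>
  Left actions give a left integral and right actions give a right integral, both of counit one.
  Their product is equal to each of them.
\<close>

lemma small_imp_normalized_integral:
  assumes "small C K"
  shows "\<exists>\<sigma>. normalized_integral_in C K \<sigma>"
proof -
  interpret M: symmetric_monoidal_category "mirror C" by (rule symmetric_monoidal_category_mirror)
  have small: "left_small C K" "left_small (mirror C) K"
    using assms by (simp_all add: small_iff_left_small)
  then have K: "bimonoid C K" by (simp add: left_small_def)
  obtain \<sigma> where \<sigma>: "left_integral_in C K \<sigma>" "\<epsilon>\<^bsub>K\<^esub> \<cdot> \<sigma> = \<i>\<d> \<one>"
    using left_small_imp_integral[OF small(1)] by blast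
  obtain \<tau> where \<tau>: "left_integral_in (mirror C) K \<tau>" "\<epsilon>\<^bsub>K\<^esub> \<cdot> \<tau> = \<i>\<d> \<one>"
    using M.left_small_imp_integral[OF small(2)] by auto
  note typing = left_integral_in_typing[OF \<sigma>(1)] M.left_integral_in_typing[OF \<tau>(1), simplified]
  have "\<sigma> \<cdot> \<l> \<one> = \<l> (obj K) \<cdot> ((\<epsilon>\<^bsub>K\<^esub> \<cdot> \<tau>) \<otimes> \<sigma>)"
    unfolding \<tau>(2) using K typing by (simp add: lunit_nat)
  also have "\<dots> = (\<nabla>\<^bsub>K\<^esub> \<cdot> (\<i>\<d> (obj K) \<otimes> \<sigma>)) \<cdot> (\<tau> \<otimes> \<i>\<d> \<one>)"
    using \<sigma>(1) K typing by (simp add: left_integral_in_def interchange)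
  also have "\<dots> = (\<nabla>\<^bsub>K\<^esub> \<cdot> (\<tau> \<otimes> \<i>\<d> (obj K))) \<cdot> (\<i>\<d> \<one> \<otimes> \<sigma>)"
    using K typing by (simp add: interchange)
  also have "\<dots> = \<r> (obj K) \<cdot> (\<tau> \<otimes> (\<epsilon>\<^bsub>K\<^esub> \<cdot> \<sigma>))"
    using \<tau>(1) K typing by (simp add: left_integral_in_def interchange)
  also have "\<dots> = \<tau> \<cdot> \<l> \<one>"
    unfolding \<sigma>(2) using K typing by (simp add: runit_nat lunit_eq_runit_unit)
  finally have "\<sigma> \<cdot> \<l> \<one> = \<tau> \<cdot> \<l> \<one>" .
  then have "\<sigma> = \<tau>"
    by (rule iso_cancel_right[OF coherence_inverses(2)[OF unit_obj]]) (use typing in simp_all)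
  then show ?thesis
    using \<sigma> \<tau> K by (auto simp: normalized_integral_in_def)
qed

lemma left_actionD:
  assumes "left_action C K X \<alpha>"
  shows "bimonoid C K" "X \<in> Obj C" "\<alpha> \<in> Arr C" "Dom C \<alpha> = obj K \<odot> X" "Cod C \<alpha> = X"
    "\<alpha> \<cdot> (\<nabla>\<^bsub>K\<^esub> \<otimes> \<i>\<d> X) = \<alpha> \<cdot> ((\<i>\<d> (obj K) \<otimes> \<alpha>) \<cdot> \<a> (obj K) (obj K) X)"
    "\<alpha> \<cdot> (\<eta>\<^bsub>K\<^esub> \<otimes> \<i>\<d> X) = \<l> X"
  using assms by (simp_all add: left_action_def)

lemma left_action_assoc:
  assumes "left_action C K X \<alpha>"
  shows "\<alpha> \<cdot> (\<i>\<d> (obj K) \<otimes> \<alpha>) = \<alpha> \<cdot> ((\<nabla>\<^bsub>K\<^esub> \<otimes> \<i>\<d> X) \<cdot> \<a>\<^sup>- (obj K) (obj K) X)"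
  using left_actionD(1-5)[OF assms]
  by (simp add: comp_tail[OF left_actionD(6)[OF assms]])

lemma act_by_typing [simp]:
  assumes "\<alpha> \<in> Arr C" and "Dom C \<alpha> = Y \<odot> X" and "Cod C \<alpha> = X"
    and "x \<in> Arr C" and "Dom C x = \<one>" and "Cod C x = Y"
  shows "act_by C X \<alpha> x \<in> Arr C" and "Dom C (act_by C X \<alpha> x) = X" and "Cod C (act_by C X \<alpha> x) = X"
proof -
  have "X \<in> Obj C" using assms by auto
  then show "act_by C X \<alpha> x \<in> Arr C" "Dom C (act_by C X \<alpha> x) = X" "Cod C (act_by C X \<alpha> x) = X"
    using assms by (simp_all add: act_by_def)
qed

lemma act_by_trivial:
  assumes "left_action C K X \<alpha>" and "\<sigma> \<in> hom C \<one> (obj K)"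
  shows "act_by C X \<alpha> \<sigma> \<cdot> (\<l> X \<cdot> (\<epsilon>\<^bsub>K\<^esub> \<otimes> \<i>\<d> X)) = \<alpha> \<cdot> ((\<sigma> \<cdot> \<epsilon>\<^bsub>K\<^esub>) \<otimes> \<i>\<d> X)"
  using assms left_actionD(1-5)[OF assms(1)] by (simp add: act_by_def interchange)

text \<open>
  Acting by an integral projects onto the invariants: a left integral makes the image invariant,
  a right integral makes the action trivial after projection.
\<close>

lemma act_by_integral_invariant:
  assumes \<alpha>: "left_action C K X \<alpha>" and \<sigma>: "normalized_integral_in C K \<sigma>"
  shows "\<alpha> \<cdot> (\<i>\<d> (obj K) \<otimes> act_by C X \<alpha> \<sigma>) = \<l> X \<cdot> (\<epsilon>\<^bsub>K\<^esub> \<otimes> act_by C X \<alpha> \<sigma>)"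
proof -
  note typing = left_actionD(1-5)[OF \<alpha>] normalized_integral_inD(2-4)[OF \<sigma>]
  let ?K = "obj K"
  have "\<alpha> \<cdot> (\<i>\<d> ?K \<otimes> act_by C X \<alpha> \<sigma>) =
      (\<alpha> \<cdot> (\<i>\<d> ?K \<otimes> \<alpha>)) \<cdot> ((\<i>\<d> ?K \<otimes> (\<sigma> \<otimes> \<i>\<d> X)) \<cdot> (\<i>\<d> ?K \<otimes> \<l>\<^sup>- X))"
    using typing by (simp add: act_by_def interchange)
  also have "\<dots> = \<alpha> \<cdot> ((\<nabla>\<^bsub>K\<^esub> \<otimes> \<i>\<d> X) \<cdot>
      ((\<a>\<^sup>- ?K ?K X \<cdot> (\<i>\<d> ?K \<otimes> (\<sigma> \<otimes> \<i>\<d> X))) \<cdot> (\<i>\<d> ?K \<otimes> \<l>\<^sup>- X)))"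
    unfolding left_action_assoc[OF \<alpha>] using typing by simp
  also have "\<dots> = \<alpha> \<cdot> (((\<nabla>\<^bsub>K\<^esub> \<cdot> (\<i>\<d> ?K \<otimes> \<sigma>)) \<cdot> \<r>\<^sup>- ?K) \<otimes> \<i>\<d> X)"
    using typing by (simp add: assoc_inv_nat triangle_inv interchange)
  also have "\<dots> = \<alpha> \<cdot> ((\<sigma> \<cdot> \<epsilon>\<^bsub>K\<^esub>) \<otimes> \<i>\<d> X)"
    unfolding normalized_integral_inD(5)[OF \<sigma>]
    using typing lunit_scalar[of "\<epsilon>\<^bsub>K\<^esub>" ?K \<sigma> ?K] by simp
  also have "\<dots> = act_by C X \<alpha> \<sigma> \<cdot> (\<l> X \<cdot> (\<epsilon>\<^bsub>K\<^esub> \<otimes> \<i>\<d> X))"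
    using act_by_trivial[OF \<alpha>] typing by simp
  also have "\<dots> = (\<l> X \<cdot> (\<i>\<d> \<one> \<otimes> act_by C X \<alpha> \<sigma>)) \<cdot> (\<epsilon>\<^bsub>K\<^esub> \<otimes> \<i>\<d> X)"
    using typing by (simp add: lunit_nat)
  also have "\<dots> = \<l> X \<cdot> (\<epsilon>\<^bsub>K\<^esub> \<otimes> act_by C X \<alpha> \<sigma>)"
    using typing by (simp add: interchange)
  finally show ?thesis .
qed

lemma act_by_integral_coinvariant:
  assumes \<alpha>: "left_action C K X \<alpha>" and \<sigma>: "normalized_integral_in C K \<sigma>"
  shows "act_by C X \<alpha> \<sigma> \<cdot> \<alpha> = act_by C X \<alpha> \<sigma> \<cdot> (\<l> X \<cdot> (\<epsilon>\<^bsub>K\<^esub> \<otimes> \<i>\<d> X))"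
proof -
  note typing = left_actionD(1-5)[OF \<alpha>] normalized_integral_inD(2-4)[OF \<sigma>]
  let ?K = "obj K"
  have nat: "\<a>\<^sup>- ?K ?K X \<cdot> (\<sigma> \<otimes> \<i>\<d> (?K \<odot> X)) = ((\<sigma> \<otimes> \<i>\<d> ?K) \<otimes> \<i>\<d> X) \<cdot> \<a>\<^sup>- \<one> ?K X"
    using typing assoc_inv_nat[of \<sigma> "\<i>\<d> ?K" "\<i>\<d> X" ?K ?K X] by simp
  have "act_by C X \<alpha> \<sigma> \<cdot> \<alpha> = (\<alpha> \<cdot> (\<i>\<d> ?K \<otimes> \<alpha>)) \<cdot> ((\<sigma> \<otimes> \<i>\<d> (?K \<odot> X)) \<cdot> \<l>\<^sup>- (?K \<odot> X))"
    using typing by (simp add: act_by_def interchange_tail lunit_inv_nat)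
  also have "\<dots> = \<alpha> \<cdot> (((\<nabla>\<^bsub>K\<^esub> \<cdot> (\<sigma> \<otimes> \<i>\<d> ?K)) \<cdot> \<l>\<^sup>- ?K) \<otimes> \<i>\<d> X)"
    unfolding left_action_assoc[OF \<alpha>] using typing
    by (simp add: comp_tail2[OF nat] lunit_inv_tensor interchange)
  also have "\<dots> = \<alpha> \<cdot> ((\<sigma> \<cdot> \<epsilon>\<^bsub>K\<^esub>) \<otimes> \<i>\<d> X)"
    unfolding normalized_integral_inD(6)[OF \<sigma>]
    using typing runit_scalar[of "\<epsilon>\<^bsub>K\<^esub>" ?K \<sigma> ?K] by simp
  finally show ?thesis
    using act_by_trivial[OF \<alpha>] typing by simp
qed

lemma act_by_fixes_invariant:
  assumes \<alpha>: "left_action C K X \<alpha>" and \<sigma>: "normalized_integral_in C K \<sigma>"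
    and f: "f \<in> hom C Z X" and inv: "\<alpha> \<cdot> (\<i>\<d> (obj K) \<otimes> f) = \<l> X \<cdot> (\<epsilon>\<^bsub>K\<^esub> \<otimes> f)"
  shows "act_by C X \<alpha> \<sigma> \<cdot> f = f"
proof -
  note typing = left_actionD(1-5)[OF \<alpha>] normalized_integral_inD(2-4)[OF \<sigma>]
  have Z: "Z \<in> Obj C" using f by auto
  have "act_by C X \<alpha> \<sigma> \<cdot> f = (\<alpha> \<cdot> (\<i>\<d> (obj K) \<otimes> f)) \<cdot> ((\<sigma> \<otimes> \<i>\<d> Z) \<cdot> \<l>\<^sup>- Z)"
    using typing f Z by (simp add: act_by_def lunit_inv_nat interchange_tail)
  also have "\<dots> = (\<l> X \<cdot> (\<i>\<d> \<one> \<otimes> f)) \<cdot> \<l>\<^sup>- Z"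
    unfolding inv using typing f Z
    by (simp add: interchange_tail normalized_integral_inD(7)[OF \<sigma>])
  also have "\<dots> = f"
    using f Z by (simp add: lunit_nat)
  finally show ?thesis .
qed

lemma coinvariant_absorbs_act_by:
  assumes \<alpha>: "left_action C K X \<alpha>" and \<sigma>: "normalized_integral_in C K \<sigma>"
    and h: "h \<in> hom C X Z" and coinv: "h \<cdot> \<alpha> = h \<cdot> (\<l> X \<cdot> (\<epsilon>\<^bsub>K\<^esub> \<otimes> \<i>\<d> X))"
  shows "h \<cdot> act_by C X \<alpha> \<sigma> = h"
proof -
  note typing = left_actionD(1-5)[OF \<alpha>] normalized_integral_inD(2-4)[OF \<sigma>]
  have "h \<cdot> act_by C X \<alpha> \<sigma> = (h \<cdot> \<alpha>) \<cdot> ((\<sigma> \<otimes> \<i>\<d> X) \<cdot> \<l>\<^sup>- X)"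
    using typing h by (simp add: act_by_def)
  also have "\<dots> = h"
    unfolding coinv using typing h
    by (simp add: interchange_tail normalized_integral_inD(7)[OF \<sigma>])
  finally show ?thesis .
qed

text \<open>
  The idempotent by which \<open>\<sigma>\<close> acts fixes exactly the invariant arrows into \<open>X\<close> and is absorbed by
  exactly the arrows out of \<open>X\<close> that do not see the action. Both halves of a splitting of it are
  therefore universal, and their composite is an identity.
\<close>

lemma normalized_integral_imp_left_small:
  assumes split: "idempotents_split C" and \<sigma>: "normalized_integral_in C K \<sigma>"
  shows "left_small C K"
  unfolding left_small_def
proof (intro conjI allI impI)
  show "bimonoid C K" by (rule normalized_integral_inD(1)[OF \<sigma>])
next
  fix X \<alpha>
  assume \<alpha>: "left_action C K X \<alpha>"
  note typing = left_actionD(1-5)[OF \<alpha>] normalized_integral_inD(2-4)[OF \<sigma>]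
  define e where "e = act_by C X \<alpha> \<sigma>"
  have e: "e \<in> Arr C" "Dom C e = X" "Cod C e = X"
    unfolding e_def using typing by simp_all
  note e_inv = act_by_integral_invariant[OF \<alpha> \<sigma>, folded e_def]
    and e_coinv = act_by_integral_coinvariant[OF \<alpha> \<sigma>, folded e_def]
  have "e \<cdot> e = e"
    unfolding e_def by (rule act_by_fixes_invariant[OF \<alpha> \<sigma> _ act_by_integral_invariant[OF \<alpha> \<sigma>]])
      (use e e_def in simp)
  then obtain Y \<iota> \<pi> where "\<iota> \<in> hom C Y X" "\<pi> \<in> hom C X Y" and
    sec: "\<pi> \<cdot> \<iota> = \<i>\<d> Y" and ret: "\<iota> \<cdot> \<pi> = e"
    using split typing e unfolding idempotents_split_def in_hom_iff by metis
  then have s: "\<iota> \<in> Arr C" "Dom C \<iota> = Y" "Cod C \<iota> = X" "\<pi> \<in> Arr C" "Dom C \<pi> = X" "Cod C \<pi> = Y"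
    by simp_all
  have Y: "Y \<in> Obj C" using s by auto
  have e\<iota>: "e \<cdot> \<iota> = \<iota>" and \<pi>e: "\<pi> \<cdot> e = \<pi>"
    unfolding ret[symmetric] using s sec Y by (simp_all add: comp_tail[OF sec])
  have "left_action_invariant C K X \<alpha> Y \<iota>"
    unfolding left_action_invariant_def
  proof (intro conjI allI impI)
    have "\<alpha> \<cdot> (\<i>\<d> (obj K) \<otimes> (e \<cdot> \<iota>)) = (\<alpha> \<cdot> (\<i>\<d> (obj K) \<otimes> e)) \<cdot> (\<i>\<d> (obj K) \<otimes> \<iota>)"
      using typing s e by (simp add: interchange)
    also have "\<dots> = \<l> X \<cdot> (\<epsilon>\<^bsub>K\<^esub> \<otimes> (e \<cdot> \<iota>))"
      unfolding e_inv using typing s e by (simp add: interchange)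
    finally show "\<alpha> \<cdot> (\<i>\<d> (obj K) \<otimes> \<iota>) = \<l> X \<cdot> (\<epsilon>\<^bsub>K\<^esub> \<otimes> \<iota>)"
      by (simp add: e\<iota>)
  next
    fix Z f
    assume f: "f \<in> hom C Z X \<and> \<alpha> \<cdot> (\<i>\<d> (obj K) \<otimes> f) = \<l> X \<cdot> (\<epsilon>\<^bsub>K\<^esub> \<otimes> f)"
    have ef: "e \<cdot> f = f"
      unfolding e_def using f by (intro act_by_fixes_invariant[OF \<alpha> \<sigma>]) auto
    show "\<exists>!g. g \<in> hom C Z Y \<and> \<iota> \<cdot> g = f"
    proof (intro ex1I[of _ "\<pi> \<cdot> f"])
      show "\<pi> \<cdot> f \<in> hom C Z Y \<and> \<iota> \<cdot> (\<pi> \<cdot> f) = f"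
        using f s by (simp add: comp_tail[OF ret] ef)
    next
      fix g
      assume "g \<in> hom C Z Y \<and> \<iota> \<cdot> g = f"
      then show "g = \<pi> \<cdot> f"
        using s by (auto simp: comp_tail[OF sec])
    qed
  qed (use s in simp)
  moreover have "left_action_stabilized C K X \<alpha> Y \<pi>"
    unfolding left_action_stabilized_def is_coequalizer_def trivial_left_action_def
  proof (intro conjI allI impI)
    have "(\<pi> \<cdot> e) \<cdot> \<alpha> = \<pi> \<cdot> (e \<cdot> \<alpha>)"
      using typing s e by simp
    also have "\<dots> = (\<pi> \<cdot> e) \<cdot> (\<l> X \<cdot> (\<epsilon>\<^bsub>K\<^esub> \<otimes> \<i>\<d> X))"
      unfolding e_coinv using typing s e by simp
    finally show "\<pi> \<cdot> \<alpha> = \<pi> \<cdot> (\<l> X \<cdot> (\<epsilon>\<^bsub>K\<^esub> \<otimes> \<i>\<d> X))"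
      by (simp add: \<pi>e)
  next
    fix Z h
    assume h: "h \<in> hom C X Z \<and> h \<cdot> \<alpha> = h \<cdot> (\<l> X \<cdot> (\<epsilon>\<^bsub>K\<^esub> \<otimes> \<i>\<d> X))"
    have he: "h \<cdot> e = h"
      unfolding e_def using h by (intro coinvariant_absorbs_act_by[OF \<alpha> \<sigma>]) auto
    show "\<exists>!k. k \<in> hom C Y Z \<and> k \<cdot> \<pi> = h"
    proof (intro ex1I[of _ "h \<cdot> \<iota>"])
      show "h \<cdot> \<iota> \<in> hom C Y Z \<and> h \<cdot> \<iota> \<cdot> \<pi> = h"
        using h s by (simp add: ret he)
    next
      fix k
      assume "k \<in> hom C Y Z \<and> k \<cdot> \<pi> = h"
      then show "k = h \<cdot> \<iota>"
        using s sec by auto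
    qed
  qed (use typing s in simp_all)
  moreover have "is_iso C (\<pi> \<cdot> \<iota>)"
    unfolding sec is_iso_def using inverse_arrows_id[OF Y] by blast
  ultimately show "\<exists>I i S p. left_action_invariant C K X \<alpha> I i \<and> left_action_stabilized C K X \<alpha> S p \<and>
      is_iso C (p \<cdot> i)"
    by blast
qed

theorem small_iff_normalized_integral:
  assumes "idempotents_split C"
  shows "small C K \<longleftrightarrow> (\<exists>\<sigma>. normalized_integral_in C K \<sigma>)"
proof
  assume "\<exists>\<sigma>. normalized_integral_in C K \<sigma>"
  then obtain \<sigma> where \<sigma>: "normalized_integral_in C K \<sigma>" ..
  moreover have "left_small (mirror C) K"
    using \<sigma> normalized_integral_in_mirror[of K \<sigma>] idempotents_split_mirror[OF assms]
    by (intro symmetric_monoidal_category.normalized_integral_imp_left_small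
        [OF symmetric_monoidal_category_mirror]) simp_all
  ultimately show "small C K"
    using normalized_integral_imp_left_small[OF assms] by (simp add: small_iff_left_small)
qed (rule small_imp_normalized_integral)

end

section \<open>Quotients by translations and their sections\<close>

text \<open>
  The object of \<open>D\<close> is the quotient of \<open>A\<close> by the left translations by elements of \<open>K\<close>. Read in the
  opposite category, it is the subobject of coinvariants of a coaction.
\<close>

definition left_quotient ::
    "('o, 'm) sm_category \<Rightarrow> ('o, 'm) bimonoid_data \<Rightarrow> ('o, 'm) bimonoid_data \<Rightarrow> 'm \<Rightarrow>
      ('o, 'm) bimonoid_data \<Rightarrow> 'm \<Rightarrow> bool" where
  "left_quotient C K A k D c \<longleftrightarrow>
     bimonoid_hom C K A k \<and> bimonoid_hom C A D c \<and>
     left_action_stabilized C K (obj A) (Comp C (mult A) (TensorArr C k (Id C (obj A)))) (obj D) c"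

definition two_sided_quotient ::
    "('o, 'm) sm_category \<Rightarrow> ('o, 'm) bimonoid_data \<Rightarrow> ('o, 'm) bimonoid_data \<Rightarrow> 'm \<Rightarrow>
      ('o, 'm) bimonoid_data \<Rightarrow> 'm \<Rightarrow> bool" where
  "two_sided_quotient C K A k D c \<longleftrightarrow>
     left_quotient C K A k D c \<and> left_quotient (mirror C) K A k D c"

abbreviation left_translation ::
    "('o, 'm) sm_category \<Rightarrow> ('o, 'm) bimonoid_data \<Rightarrow> 'm \<Rightarrow> 'm" where
  "left_translation C A x \<equiv> act_by C (obj A) (mult A) x"

context symmetric_monoidal_category
begin

lemma left_quotientD:
  assumes "left_quotient C K A k D c"
  shows "bimonoid_hom C K A k" "bimonoid_hom C A D c"
    "c \<cdot> (\<nabla>\<^bsub>A\<^esub> \<cdot> (k \<otimes> \<i>\<d> (obj A))) = c \<cdot> (\<l> (obj A) \<cdot> (\<epsilon>\<^bsub>K\<^esub> \<otimes> \<i>\<d> (obj A)))"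
  using assms
  by (simp_all add: left_quotient_def left_action_stabilized_def is_coequalizer_def
      trivial_left_action_def)

lemma left_quotient_epi:
  assumes "left_quotient C K A k D c" and "f \<cdot> c = g \<cdot> c"
    and "f \<in> Arr C" and "g \<in> Arr C" and "Dom C f = obj D" and "Dom C g = obj D"
  shows "f = g"
  using assms is_coequalizer_epi unfolding left_quotient_def left_action_stabilized_def by blast

lemma left_quotient_factor:
  assumes "left_quotient C K A k D c" and "h \<in> hom C (obj A) Z"
    and "h \<cdot> (\<nabla>\<^bsub>A\<^esub> \<cdot> (k \<otimes> \<i>\<d> (obj A))) = h \<cdot> (\<l> (obj A) \<cdot> (\<epsilon>\<^bsub>K\<^esub> \<otimes> \<i>\<d> (obj A)))"
  shows "\<exists>s. s \<in> hom C (obj D) Z \<and> s \<cdot> c = h"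
  using assms
  unfolding left_quotient_def left_action_stabilized_def is_coequalizer_def trivial_left_action_def
  by blast

lemma left_quotient_zero:
  assumes "left_quotient C K A k D c"
  shows "c \<cdot> k = \<eta>\<^bsub>D\<^esub> \<cdot> \<epsilon>\<^bsub>K\<^esub>"
proof -
  note k = bimonoid_homD(1-5)[OF left_quotientD(1)[OF assms]]
    and c = bimonoid_homD(2-5)[OF left_quotientD(2)[OF assms]]
  have "\<nabla>\<^bsub>A\<^esub> \<cdot> ((\<i>\<d> (obj A) \<otimes> \<eta>\<^bsub>A\<^esub>) \<cdot> ((k \<otimes> \<i>\<d> \<one>) \<cdot> \<r>\<^sup>- (obj K))) = k"
    using k by (simp add: comp_tail[OF bimonoidD(3)] comp_tail2[OF runit_nat])
  then have "c \<cdot> k = (c \<cdot> (\<nabla>\<^bsub>A\<^esub> \<cdot> (k \<otimes> \<i>\<d> (obj A)))) \<cdot> ((\<i>\<d> (obj K) \<otimes> \<eta>\<^bsub>A\<^esub>) \<cdot> \<r>\<^sup>- (obj K))"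
    using k c by (simp add: interchange_tail)
  also have "\<dots> = c \<cdot> (\<l> (obj A) \<cdot> ((\<epsilon>\<^bsub>K\<^esub> \<otimes> \<eta>\<^bsub>A\<^esub>) \<cdot> \<r>\<^sup>- (obj K)))"
    unfolding left_quotientD(3)[OF assms] using k c by (simp add: interchange_tail)
  also have "\<dots> = c \<cdot> (\<eta>\<^bsub>A\<^esub> \<cdot> \<epsilon>\<^bsub>K\<^esub>)"
    using k by (simp add: lunit_scalar)
  also have "\<dots> = \<eta>\<^bsub>D\<^esub> \<cdot> \<epsilon>\<^bsub>K\<^esub>"
    using k c by (simp add: comp_tail[OF bimonoid_homD(7)[OF left_quotientD(2)[OF assms]]])
  finally show ?thesis .
qed

lemma left_action_along_hom:
  assumes "bimonoid_hom C K A k"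
  shows "left_action C K (obj A) (\<nabla>\<^bsub>A\<^esub> \<cdot> (k \<otimes> \<i>\<d> (obj A)))"
proof -
  note k = bimonoid_homD[OF assms]
  have "\<nabla>\<^bsub>A\<^esub> \<cdot> ((k \<cdot> \<nabla>\<^bsub>K\<^esub>) \<otimes> \<i>\<d> (obj A)) =
      (\<nabla>\<^bsub>A\<^esub> \<cdot> (\<nabla>\<^bsub>A\<^esub> \<otimes> \<i>\<d> (obj A))) \<cdot> ((k \<otimes> k) \<otimes> \<i>\<d> (obj A))"
    unfolding k(6) using k(1-5) by (simp add: interchange)
  also have "\<dots> = \<nabla>\<^bsub>A\<^esub> \<cdot> ((\<i>\<d> (obj A) \<otimes> \<nabla>\<^bsub>A\<^esub>) \<cdot> ((k \<otimes> (k \<otimes> \<i>\<d> (obj A))) \<cdot> \<a> (obj K) (obj K) (obj A)))"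
    unfolding bimonoidD(1)[OF k(2)] using k(1-5) by (simp add: assoc_nat)
  finally have "\<nabla>\<^bsub>A\<^esub> \<cdot> ((k \<otimes> \<i>\<d> (obj A)) \<cdot> (\<nabla>\<^bsub>K\<^esub> \<otimes> \<i>\<d> (obj A))) =
    \<nabla>\<^bsub>A\<^esub> \<cdot> ((k \<otimes> \<i>\<d> (obj A)) \<cdot> ((\<i>\<d> (obj K) \<otimes> (\<nabla>\<^bsub>A\<^esub> \<cdot> (k \<otimes> \<i>\<d> (obj A)))) \<cdot>
      \<a> (obj K) (obj K) (obj A)))"
    using k(1-5) by (simp add: interchange interchange_tail)
  then show ?thesis
    using k(1-5) by (simp add: left_action_def interchange interchange_tail k(7) bimonoidD)
qed

lemma act_by_along_hom:
  assumes "bimonoid_hom C K A k" and "\<sigma> \<in> hom C \<one> (obj K)"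
  shows "act_by C (obj A) (\<nabla>\<^bsub>A\<^esub> \<cdot> (k \<otimes> \<i>\<d> (obj A))) \<sigma> = left_translation C A (k \<cdot> \<sigma>)"
  using bimonoid_homD(1-5)[OF assms(1)] assms(2) by (simp add: act_by_def interchange_tail)

lemma left_translation_mult:
  assumes "bimonoid C A" and "x \<in> hom C \<one> (obj A)"
  shows "left_translation C A x \<cdot> \<nabla>\<^bsub>A\<^esub> = \<nabla>\<^bsub>A\<^esub> \<cdot> (left_translation C A x \<otimes> \<i>\<d> (obj A))"
proof -
  let ?A = "obj A"
  have nat: "\<a> ?A ?A ?A \<cdot> (((x \<otimes> \<i>\<d> ?A) \<cdot> \<l>\<^sup>- ?A) \<otimes> \<i>\<d> ?A) = (x \<otimes> \<i>\<d> (?A \<odot> ?A)) \<cdot> \<l>\<^sup>- (?A \<odot> ?A)"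
  proof -
    have "((x \<otimes> \<i>\<d> ?A) \<cdot> \<l>\<^sup>- ?A) \<otimes> \<i>\<d> ?A = ((x \<otimes> \<i>\<d> ?A) \<otimes> \<i>\<d> ?A) \<cdot> (\<a>\<^sup>- \<one> ?A ?A \<cdot> \<l>\<^sup>- (?A \<odot> ?A))"
      using assms by (simp add: interchange lunit_inv_tensor)
    then show ?thesis
      using assms by (simp add: comp_tail2[OF assoc_nat])
  qed
  have "left_translation C A x \<cdot> \<nabla>\<^bsub>A\<^esub> =
      \<nabla>\<^bsub>A\<^esub> \<cdot> ((\<i>\<d> ?A \<otimes> \<nabla>\<^bsub>A\<^esub>) \<cdot> ((x \<otimes> \<i>\<d> (?A \<odot> ?A)) \<cdot> \<l>\<^sup>- (?A \<odot> ?A)))"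
    using assms by (simp add: act_by_def lunit_inv_nat interchange_tail)
  also have "\<dots> = (\<nabla>\<^bsub>A\<^esub> \<cdot> (\<nabla>\<^bsub>A\<^esub> \<otimes> \<i>\<d> ?A)) \<cdot> (((x \<otimes> \<i>\<d> ?A) \<cdot> \<l>\<^sup>- ?A) \<otimes> \<i>\<d> ?A)"
    unfolding bimonoidD(1)[OF assms(1)] nat[symmetric] using assms by simp
  also have "\<dots> = \<nabla>\<^bsub>A\<^esub> \<cdot> (left_translation C A x \<otimes> \<i>\<d> ?A)"
    using assms by (simp add: act_by_def interchange)
  finally show ?thesis .
qed

text \<open>
  In elements, for \<open>x = k(\<sigma>)\<close>: \<open>(x a)\<^sub>1 \<otimes> c ((x a)\<^sub>2) = x\<^sub>1 a\<^sub>1 \<otimes> c (x\<^sub>2 a\<^sub>2)\<close>, and \<open>c\<close> forgets the factor \<open>x\<^sub>2\<close>.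
\<close>

lemma left_translation_comult:
  assumes Q: "left_quotient C K A k D c" and \<sigma>: "\<sigma> \<in> hom C \<one> (obj K)"
  shows "(\<i>\<d> (obj A) \<otimes> c) \<cdot> (\<Delta>\<^bsub>A\<^esub> \<cdot> left_translation C A (k \<cdot> \<sigma>)) =
    (left_translation C A (k \<cdot> \<sigma>) \<otimes> c) \<cdot> \<Delta>\<^bsub>A\<^esub>"
proof -
  let ?A = "obj A" and ?K = "obj K"
  note k = bimonoid_homD[OF left_quotientD(1)[OF Q]]
    and c = bimonoid_homD(2-5)[OF left_quotientD(2)[OF Q]]
  let ?kA = "\<nabla>\<^bsub>A\<^esub> \<cdot> (k \<otimes> \<i>\<d> ?A)"
  have nat_k: "middle_swap C ?A ?A ?A ?A \<cdot> ((k \<otimes> k) \<otimes> \<i>\<d> (?A \<odot> ?A)) =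
      ((k \<otimes> \<i>\<d> ?A) \<otimes> (k \<otimes> \<i>\<d> ?A)) \<cdot> middle_swap C ?K ?K ?A ?A"
    using k(1-5) middle_swap_nat[of k k "\<i>\<d> ?A" "\<i>\<d> ?A" ?A ?A ?A ?A] by simp
  have nat_\<epsilon>: "(\<i>\<d> (?K \<odot> ?A) \<otimes> (\<epsilon>\<^bsub>K\<^esub> \<otimes> \<i>\<d> ?A)) \<cdot> middle_swap C ?K ?K ?A ?A =
      middle_swap C ?K \<one> ?A ?A \<cdot> ((\<i>\<d> ?K \<otimes> \<epsilon>\<^bsub>K\<^esub>) \<otimes> \<i>\<d> (?A \<odot> ?A))"
    using k(1-5) middle_swap_nat[of "\<i>\<d> ?K" "\<epsilon>\<^bsub>K\<^esub>" "\<i>\<d> ?A" "\<i>\<d> ?A" ?K \<one> ?A ?A] by simp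
  have \<Delta>x: "\<Delta>\<^bsub>A\<^esub> \<cdot> (k \<cdot> \<sigma>) = (k \<otimes> k) \<cdot> (\<Delta>\<^bsub>K\<^esub> \<cdot> \<sigma>)"
    using k(1-5) \<sigma> by (simp add: comp_tail2[OF k(8)])
  have "(\<i>\<d> ?A \<otimes> c) \<cdot> (\<Delta>\<^bsub>A\<^esub> \<cdot> left_translation C A (k \<cdot> \<sigma>)) =
      (\<i>\<d> ?A \<otimes> c) \<cdot> ((\<nabla>\<^bsub>A\<^esub> \<otimes> \<nabla>\<^bsub>A\<^esub>) \<cdot> (middle_swap C ?A ?A ?A ?A \<cdot>
        (((\<Delta>\<^bsub>A\<^esub> \<cdot> (k \<cdot> \<sigma>)) \<otimes> \<Delta>\<^bsub>A\<^esub>) \<cdot> \<l>\<^sup>- ?A)))"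
    using k(1-5) c \<sigma>
    by (simp add: act_by_def comp_tail[OF bimonoidD(4)] interchange_tail)
  also have "\<dots> = (\<i>\<d> ?A \<otimes> c) \<cdot> ((\<nabla>\<^bsub>A\<^esub> \<otimes> \<nabla>\<^bsub>A\<^esub>) \<cdot> ((middle_swap C ?A ?A ?A ?A \<cdot>
        ((k \<otimes> k) \<otimes> \<i>\<d> (?A \<odot> ?A))) \<cdot> (((\<Delta>\<^bsub>K\<^esub> \<cdot> \<sigma>) \<otimes> \<Delta>\<^bsub>A\<^esub>) \<cdot> \<l>\<^sup>- ?A)))"
    unfolding \<Delta>x using k(1-5) c \<sigma> by (simp add: interchange_tail)
  also have "\<dots> = (?kA \<otimes> (c \<cdot> ?kA)) \<cdot>
        (middle_swap C ?K ?K ?A ?A \<cdot> (((\<Delta>\<^bsub>K\<^esub> \<cdot> \<sigma>) \<otimes> \<Delta>\<^bsub>A\<^esub>) \<cdot> \<l>\<^sup>- ?A))"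
    unfolding nat_k using k(1-5) c \<sigma> by (simp add: interchange_tail)
  also have "\<dots> = (?kA \<otimes> c) \<cdot> ((\<i>\<d> (?K \<odot> ?A) \<otimes> \<l> ?A) \<cdot>
        (((\<i>\<d> (?K \<odot> ?A) \<otimes> (\<epsilon>\<^bsub>K\<^esub> \<otimes> \<i>\<d> ?A)) \<cdot> middle_swap C ?K ?K ?A ?A) \<cdot>
          (((\<Delta>\<^bsub>K\<^esub> \<cdot> \<sigma>) \<otimes> \<Delta>\<^bsub>A\<^esub>) \<cdot> \<l>\<^sup>- ?A)))"
    unfolding left_quotientD(3)[OF Q] using k(1-5) c \<sigma> by (simp add: interchange_tail)
  also have "\<dots> = (?kA \<otimes> c) \<cdot> (((\<i>\<d> (?K \<odot> ?A) \<otimes> \<l> ?A) \<cdot> middle_swap C ?K \<one> ?A ?A) \<cdot>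
          (((\<i>\<d> ?K \<otimes> \<epsilon>\<^bsub>K\<^esub>) \<otimes> \<i>\<d> (?A \<odot> ?A)) \<cdot> (((\<Delta>\<^bsub>K\<^esub> \<cdot> \<sigma>) \<otimes> \<Delta>\<^bsub>A\<^esub>) \<cdot> \<l>\<^sup>- ?A)))"
    unfolding nat_\<epsilon> using k(1-5) c \<sigma> by simp
  also have "\<dots> = (?kA \<otimes> c) \<cdot> (\<a>\<^sup>- ?K ?A ?A \<cdot>
        ((((\<r> ?K \<cdot> ((\<i>\<d> ?K \<otimes> \<epsilon>\<^bsub>K\<^esub>) \<cdot> \<Delta>\<^bsub>K\<^esub>)) \<cdot> \<sigma>) \<otimes> \<Delta>\<^bsub>A\<^esub>) \<cdot> \<l>\<^sup>- ?A))"
    using k(1-5) c \<sigma> by (simp add: middle_swap_unit interchange_tail)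
  also have "\<dots> = (?kA \<otimes> c) \<cdot> (\<a>\<^sup>- ?K ?A ?A \<cdot> ((\<sigma> \<otimes> \<Delta>\<^bsub>A\<^esub>) \<cdot> \<l>\<^sup>- ?A))"
    unfolding bimonoidD(8)[OF k(1)] using k(1-5) \<sigma> by simp
  also have "\<dots> = (?kA \<otimes> c) \<cdot> ((\<a>\<^sup>- ?K ?A ?A \<cdot> (\<sigma> \<otimes> (\<i>\<d> ?A \<otimes> \<i>\<d> ?A))) \<cdot> (\<l>\<^sup>- (?A \<odot> ?A) \<cdot> \<Delta>\<^bsub>A\<^esub>))"
    using k(1-5) c \<sigma> by (simp add: lunit_inv_nat interchange_tail)
  also have "\<dots> = (?kA \<otimes> c) \<cdot> (((\<sigma> \<otimes> \<i>\<d> ?A) \<otimes> \<i>\<d> ?A) \<cdot> ((\<a>\<^sup>- \<one> ?A ?A \<cdot> \<l>\<^sup>- (?A \<odot> ?A)) \<cdot> \<Delta>\<^bsub>A\<^esub>))"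
    using k(1-5) c \<sigma> by (subst assoc_inv_nat) simp_all
  also have "\<dots> = (left_translation C A (k \<cdot> \<sigma>) \<otimes> c) \<cdot> \<Delta>\<^bsub>A\<^esub>"
    using k(1-5) c \<sigma> by (simp add: act_by_def lunit_inv_tensor interchange_tail)
  finally show ?thesis .
qed

text \<open>
  Left translation by the image of a normalized integral is constant on the fibres of \<open>c\<close>, so it
  descends to a section of \<open>c\<close>. Since \<open>c\<close> is a split epimorphism, the two identities of a
  right integral along \<open>c\<close> can be checked on \<open>A\<close>, where the section becomes the translation: they
  say that left translation commutes with right multiplication and with the right coaction of \<open>D\<close>.
\<close>

lemma left_quotient_section:
  assumes Q: "left_quotient C K A k D c" and \<sigma>: "normalized_integral_in C K \<sigma>"
  shows "\<exists>s. right_integral C A D c s \<and> c \<cdot> s = \<i>\<d> (obj D) \<and>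
    s \<cdot> c = left_translation C A (k \<cdot> \<sigma>)"
proof -
  note k = bimonoid_homD(1-5)[OF left_quotientD(1)[OF Q]]
    and c = bimonoid_homD[OF left_quotientD(2)[OF Q]]
    and s = normalized_integral_inD(2-4)[OF \<sigma>]
  define e where "e = left_translation C A (k \<cdot> \<sigma>)"
  note act = left_action_along_hom[OF left_quotientD(1)[OF Q]]
  have e_act: "e = act_by C (obj A) (\<nabla>\<^bsub>A\<^esub> \<cdot> (k \<otimes> \<i>\<d> (obj A))) \<sigma>"
    unfolding e_def using act_by_along_hom[OF left_quotientD(1)[OF Q]] s by simp
  have e: "e \<in> Arr C" "Dom C e = obj A" "Cod C e = obj A"
    unfolding e_def using k s by simp_all
  have "\<exists>s. s \<in> hom C (obj D) (obj A) \<and> s \<cdot> c = e"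
    using act_by_integral_coinvariant[OF act \<sigma>, folded e_act] e
    by (intro left_quotient_factor[OF Q]) simp_all
  then obtain s where s: "s \<in> Arr C" "Dom C s = obj D" "Cod C s = obj A" and sc: "s \<cdot> c = e"
    by auto
  have "c \<cdot> e = c"
    unfolding e_act using left_quotientD(3)[OF Q] c(1-5) k
    by (intro coinvariant_absorbs_act_by[OF act \<sigma>]) simp_all
  then have "(c \<cdot> s) \<cdot> c = \<i>\<d> (obj D) \<cdot> c"
    using s c(1-5) sc by simp
  then have cs: "c \<cdot> s = \<i>\<d> (obj D)"
    by (rule left_quotient_epi[OF Q]) (use s c(1-5) in simp_all)
  have "\<nabla>\<^bsub>A\<^esub> \<cdot> (s \<otimes> \<i>\<d> (obj A)) = s \<cdot> (\<nabla>\<^bsub>D\<^esub> \<cdot> (\<i>\<d> (obj D) \<otimes> c))"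
  proof (rule retraction_epi[where c = "c \<otimes> \<i>\<d> (obj A)" and s = "s \<otimes> \<i>\<d> (obj A)"])
    have "\<nabla>\<^bsub>A\<^esub> \<cdot> ((s \<cdot> c) \<otimes> \<i>\<d> (obj A)) = (s \<cdot> c) \<cdot> \<nabla>\<^bsub>A\<^esub>"
      unfolding sc e_def using left_translation_mult[of A "k \<cdot> \<sigma>"] k normalized_integral_inD(2-4)[OF \<sigma>]
      by simp
    also have "\<dots> = s \<cdot> (\<nabla>\<^bsub>D\<^esub> \<cdot> (c \<otimes> c))"
      using s c(1-5) by (simp add: c(6))
    finally show "(\<nabla>\<^bsub>A\<^esub> \<cdot> (s \<otimes> \<i>\<d> (obj A))) \<cdot> (c \<otimes> \<i>\<d> (obj A)) =
        (s \<cdot> (\<nabla>\<^bsub>D\<^esub> \<cdot> (\<i>\<d> (obj D) \<otimes> c))) \<cdot> (c \<otimes> \<i>\<d> (obj A))"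
      using s c(1-5) by (simp add: interchange)
  qed (use s c(1-5) cs in \<open>simp_all add: interchange\<close>)
  moreover have "(s \<otimes> \<i>\<d> (obj D)) \<cdot> \<Delta>\<^bsub>D\<^esub> = (\<i>\<d> (obj A) \<otimes> c) \<cdot> (\<Delta>\<^bsub>A\<^esub> \<cdot> s)"
  proof (rule left_quotient_epi[OF Q])
    have "((s \<otimes> \<i>\<d> (obj D)) \<cdot> \<Delta>\<^bsub>D\<^esub>) \<cdot> c = ((s \<cdot> c) \<otimes> c) \<cdot> \<Delta>\<^bsub>A\<^esub>"
      using s c(1-5) by (simp add: c(8) interchange_tail)
    also have "\<dots> = (\<i>\<d> (obj A) \<otimes> c) \<cdot> (\<Delta>\<^bsub>A\<^esub> \<cdot> (s \<cdot> c))"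
      unfolding sc e_def using left_translation_comult[OF Q] normalized_integral_inD(2-4)[OF \<sigma>] by simp
    finally show "((s \<otimes> \<i>\<d> (obj D)) \<cdot> \<Delta>\<^bsub>D\<^esub>) \<cdot> c = ((\<i>\<d> (obj A) \<otimes> c) \<cdot> (\<Delta>\<^bsub>A\<^esub> \<cdot> s)) \<cdot> c"
      using s c(1-5) by simp
  qed (use s c(1-5) in simp_all)
  ultimately have "right_integral C A D c s"
    using s c(1-5) by (simp add: right_integral_def)
  then show ?thesis
    using cs sc e_def by blast
qed

section \<open>Integrals along a homomorphism\<close>

lemma right_integral_comp:
  assumes \<xi>: "bimonoid_hom C A B \<xi>" and \<zeta>: "bimonoid_hom C B D \<zeta>"
    and \<mu>: "right_integral C A B \<xi> \<mu>" and \<nu>: "right_integral C B D \<zeta> \<nu>"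
  shows "right_integral C A D (\<zeta> \<cdot> \<xi>) (\<mu> \<cdot> \<nu>)"
proof -
  note h = bimonoid_homD(1-5)[OF \<xi>] bimonoid_homD(2-5)[OF \<zeta>]
  have m: "\<mu> \<in> Arr C" "Dom C \<mu> = obj B" "Cod C \<mu> = obj A"
      "\<nabla>\<^bsub>A\<^esub> \<cdot> (\<mu> \<otimes> \<i>\<d> (obj A)) = \<mu> \<cdot> \<nabla>\<^bsub>B\<^esub> \<cdot> (\<i>\<d> (obj B) \<otimes> \<xi>)"
      "(\<mu> \<otimes> \<i>\<d> (obj B)) \<cdot> \<Delta>\<^bsub>B\<^esub> = (\<i>\<d> (obj A) \<otimes> \<xi>) \<cdot> \<Delta>\<^bsub>A\<^esub> \<cdot> \<mu>"
    using \<mu> unfolding right_integral_def by simp_all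
  have n: "\<nu> \<in> Arr C" "Dom C \<nu> = obj D" "Cod C \<nu> = obj B"
      "\<nabla>\<^bsub>B\<^esub> \<cdot> (\<nu> \<otimes> \<i>\<d> (obj B)) = \<nu> \<cdot> \<nabla>\<^bsub>D\<^esub> \<cdot> (\<i>\<d> (obj D) \<otimes> \<zeta>)"
      "(\<nu> \<otimes> \<i>\<d> (obj D)) \<cdot> \<Delta>\<^bsub>D\<^esub> = (\<i>\<d> (obj B) \<otimes> \<zeta>) \<cdot> \<Delta>\<^bsub>B\<^esub> \<cdot> \<nu>"
    using \<nu> unfolding right_integral_def by simp_all
  have "\<nabla>\<^bsub>A\<^esub> \<cdot> ((\<mu> \<cdot> \<nu>) \<otimes> \<i>\<d> (obj A)) = (\<nabla>\<^bsub>A\<^esub> \<cdot> (\<mu> \<otimes> \<i>\<d> (obj A))) \<cdot> (\<nu> \<otimes> \<i>\<d> (obj A))"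
    using h m(1-3) n(1-3) by (simp add: interchange)
  also have "\<dots> = \<mu> \<cdot> ((\<nabla>\<^bsub>B\<^esub> \<cdot> (\<nu> \<otimes> \<i>\<d> (obj B))) \<cdot> (\<i>\<d> (obj D) \<otimes> \<xi>))"
    unfolding m(4) using h m(1-3) n(1-3) by (simp add: interchange)
  also have "\<dots> = (\<mu> \<cdot> \<nu>) \<cdot> \<nabla>\<^bsub>D\<^esub> \<cdot> (\<i>\<d> (obj D) \<otimes> (\<zeta> \<cdot> \<xi>))"
    unfolding n(4) using h m(1-3) n(1-3) by (simp add: interchange)
  finally have 1: "\<nabla>\<^bsub>A\<^esub> \<cdot> ((\<mu> \<cdot> \<nu>) \<otimes> \<i>\<d> (obj A)) = (\<mu> \<cdot> \<nu>) \<cdot> \<nabla>\<^bsub>D\<^esub> \<cdot> (\<i>\<d> (obj D) \<otimes> (\<zeta> \<cdot> \<xi>))" .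
  have "((\<mu> \<cdot> \<nu>) \<otimes> \<i>\<d> (obj D)) \<cdot> \<Delta>\<^bsub>D\<^esub> = (\<mu> \<otimes> \<i>\<d> (obj D)) \<cdot> ((\<nu> \<otimes> \<i>\<d> (obj D)) \<cdot> \<Delta>\<^bsub>D\<^esub>)"
    using h m(1-3) n(1-3) by (simp add: interchange_tail)
  also have "\<dots> = (\<i>\<d> (obj A) \<otimes> \<zeta>) \<cdot> (((\<mu> \<otimes> \<i>\<d> (obj B)) \<cdot> \<Delta>\<^bsub>B\<^esub>) \<cdot> \<nu>)"
    unfolding n(5) using h m(1-3) n(1-3) by (simp add: interchange_tail)
  also have "\<dots> = (\<i>\<d> (obj A) \<otimes> (\<zeta> \<cdot> \<xi>)) \<cdot> \<Delta>\<^bsub>A\<^esub> \<cdot> (\<mu> \<cdot> \<nu>)"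
    unfolding m(5) using h m(1-3) n(1-3) by (simp add: interchange_tail)
  finally show ?thesis
    using 1 m(1-3) n(1-3) by (simp add: right_integral_def)
qed

text \<open>
  In elements: \<open>x \<mu>(b) = \<mu>(\<xi>(x) b) = \<mu>(b)\<close>.
\<close>

lemma left_integral_absorbs_translation:
  assumes \<xi>: "bimonoid_hom C A B \<xi>" and \<mu>: "left_integral C A B \<xi> \<mu>"
    and x: "x \<in> hom C \<one> (obj A)" and \<xi>x: "\<xi> \<cdot> x = \<eta>\<^bsub>B\<^esub>"
  shows "left_translation C A x \<cdot> \<mu> = \<mu>"
proof -
  note h = bimonoid_homD(1-5)[OF \<xi>]
  have m: "\<mu> \<in> Arr C" "Dom C \<mu> = obj B" "Cod C \<mu> = obj A"
      "\<nabla>\<^bsub>A\<^esub> \<cdot> (\<i>\<d> (obj A) \<otimes> \<mu>) = \<mu> \<cdot> \<nabla>\<^bsub>B\<^esub> \<cdot> (\<xi> \<otimes> \<i>\<d> (obj B))"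
    using \<mu> unfolding left_integral_def by simp_all
  have "left_translation C A x \<cdot> \<mu> =
      (\<nabla>\<^bsub>A\<^esub> \<cdot> (\<i>\<d> (obj A) \<otimes> \<mu>)) \<cdot> ((x \<otimes> \<i>\<d> (obj B)) \<cdot> \<l>\<^sup>- (obj B))"
    using h m(1-3) x by (simp add: act_by_def lunit_inv_nat interchange_tail)
  also have "\<dots> = \<mu> \<cdot> ((\<nabla>\<^bsub>B\<^esub> \<cdot> ((\<xi> \<cdot> x) \<otimes> \<i>\<d> (obj B))) \<cdot> \<l>\<^sup>- (obj B))"
    unfolding m(4) using h m(1-3) x by (simp add: interchange_tail)
  also have "\<dots> = \<mu>"
    unfolding \<xi>x using h m(1-3) by (simp add: bimonoidD)
  finally show ?thesis .
qed

section \<open>Two-sided quotients\<close>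

text \<open>
  The double opposite of a category replaces its structure isomorphisms by inverses of inverses. It
  agrees with the original on objects but need not be the same record, so notions have to be carried
  over to it.
\<close>

lemma left_quotient_opposite_opposite:
  assumes "left_quotient C K A k D c"
  shows "left_quotient (opposite (opposite C)) (dual (dual K)) (dual (dual A)) k (dual (dual D)) c"
proof -
  interpret O: symmetric_monoidal_category "opposite C" by (rule symmetric_monoidal_category_opposite)
  show ?thesis
    using assms O.bimonoid_hom_opposite[of "dual K" "dual A"] O.bimonoid_hom_opposite[of "dual A" "dual D"]
      bimonoid_homD(1-5)[OF left_quotientD(1)[OF assms]] stabilized_dual(1)[of "opposite C" "dual K"]
    by (simp add: left_quotient_def left_coaction_stabilized_def left_action_stabilized_def
        trivial_left_action_def trivial_left_coaction_def is_equalizer_def is_coequalizer_def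
        inv_inv lunit_iso)
qed

lemma two_sided_quotient_opposite_opposite:
  assumes "two_sided_quotient C K A k D c"
  shows "two_sided_quotient (opposite (opposite C)) (dual (dual K)) (dual (dual A)) k (dual (dual D)) c"
  using assms symmetric_monoidal_category.left_quotient_opposite_opposite
    [OF symmetric_monoidal_category_mirror, of K A k D c] left_quotient_opposite_opposite[of K A k D c]
  by (simp only: two_sided_quotient_def mirror_opposite simp_thms)

text \<open>
  Two sections of \<open>c\<close> arise, from left and from right translation. The first is a right integral
  along \<open>c\<close>, hence it absorbs right translation, and this identifies it with the second.
\<close>

lemma two_sided_quotient_section:
  assumes Q: "two_sided_quotient C K A k D c" and \<sigma>: "normalized_integral_in C K \<sigma>"
  shows "\<exists>s. integral_along C A D c s \<and> c \<cdot> s = \<i>\<d> (obj D) \<and>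
    s \<cdot> c = left_translation C A (k \<cdot> \<sigma>) \<and> s \<cdot> c = left_translation (mirror C) A (k \<cdot> \<sigma>)"
proof -
  interpret M: symmetric_monoidal_category "mirror C" by (rule symmetric_monoidal_category_mirror)
  from Q have QL: "left_quotient C K A k D c" and QR: "left_quotient (mirror C) K A k D c"
    by (simp_all add: two_sided_quotient_def)
  note k = bimonoid_homD(1-5)[OF left_quotientD(1)[OF QL]]
    and c = bimonoid_homD(2-5)[OF left_quotientD(2)[OF QL]] and \<sigma>' = normalized_integral_inD(2-4)[OF \<sigma>]
  obtain s where s: "right_integral C A D c s" "c \<cdot> s = \<i>\<d> (obj D)" "s \<cdot> c = left_translation C A (k \<cdot> \<sigma>)"
    using left_quotient_section[OF QL \<sigma>] by blast
  obtain t where t: "left_integral C A D c t" "t \<cdot> c = left_translation (mirror C) A (k \<cdot> \<sigma>)"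
    using M.left_quotient_section[OF QR] \<sigma> by (auto simp: normalized_integral_in_mirror integral_mirror)
  have st: "s \<in> Arr C" "Dom C s = obj D" "Cod C s = obj A" "t \<in> Arr C" "Dom C t = obj D" "Cod C t = obj A"
    using s(1) t(1) by (simp_all add: right_integral_def left_integral_def)
  have "c \<cdot> (k \<cdot> \<sigma>) = \<eta>\<^bsub>D\<^esub>"
    using k c \<sigma>' by (simp add: comp_tail[OF left_quotient_zero[OF QL]] normalized_integral_inD(7)[OF \<sigma>])
  then have "left_translation (mirror C) A (k \<cdot> \<sigma>) \<cdot> s = s"
    using M.left_integral_absorbs_translation[of A D c s "k \<cdot> \<sigma>"] left_quotientD(2)[OF QL] s(1) k \<sigma>'
    by (simp add: integral_mirror)
  then have "s = t"
    unfolding t(2)[symmetric] using st c s(2) by simp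
  then show ?thesis
    using s t by (auto simp: integral_along_def)
qed

lemma integral_along_comp:
  assumes "bimonoid_hom C A B \<xi>" and "bimonoid_hom C B D \<zeta>"
    and "integral_along C A B \<xi> \<mu>" and "integral_along C B D \<zeta> \<nu>"
  shows "integral_along C A D (\<zeta> \<cdot> \<xi>) (\<mu> \<cdot> \<nu>)"
  using assms right_integral_comp symmetric_monoidal_category.right_integral_comp
    [OF symmetric_monoidal_category_mirror, of A B \<xi> D \<zeta> \<mu> \<nu>]
  by (simp add: integral_along_def integral_mirror)

text \<open>
  A left integral absorbs left translations and a right integral absorbs right translations. An
  endomorphism that is both kinds of translation is absorbed by one-sided integrals of either kind,
  as the definition of a generator demands.
\<close>

lemma integral_absorbs_translation:
  assumes \<xi>: "bimonoid_hom C A B \<xi>" and \<mu>: "right_integral C A B \<xi> \<mu> \<or> left_integral C A B \<xi> \<mu>"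
    and x: "x \<in> hom C \<one> (obj A)" "\<xi> \<cdot> x = \<eta>\<^bsub>B\<^esub>"
    and e: "e = left_translation C A x" "e = left_translation (mirror C) A x"
  shows "e \<cdot> \<mu> = \<mu>"
proof -
  interpret M: symmetric_monoidal_category "mirror C" by (rule symmetric_monoidal_category_mirror)
  show ?thesis
    using \<mu> left_integral_absorbs_translation[OF \<xi> _ x] M.left_integral_absorbs_translation[of A B \<xi> \<mu> x]
      \<xi> x e(1)[symmetric] e(2)[symmetric]
    by (auto simp: integral_mirror)
qed

section \<open>From integrals on kernel and cokernel to a generator\<close>

text \<open>
  The generator is \<open>s \<cdot> t\<close>, for \<open>s\<close> the section of \<open>c\<close> obtained from \<open>\<sigma>\<close> and \<open>t\<close> the retraction of \<open>i\<close>
  obtained from \<open>\<tau>\<close>. Its composites with \<open>i \<cdot> c\<close> are \<open>s \<cdot> c\<close> and \<open>i \<cdot> t\<close>, which are translations by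
  \<open>k(\<sigma>)\<close> in \<open>A\<close> and by \<open>\<tau> \<cdot> q\<close> in the opposite category; the facts \<open>x\<close> and \<open>y\<close> make both of them
  absorbable.
\<close>

lemma normalized_generator_exists:
  assumes Q1: "two_sided_quotient C K A k D c" and \<sigma>: "normalized_integral_in C K \<sigma>"
    and Q2: "two_sided_quotient (opposite C) (dual Q) (dual B) q (dual D) i"
    and \<tau>: "normalized_integral_in (opposite C) (dual Q) \<tau>"
  shows "\<exists>\<mu>. generator_integral C A B (i \<cdot> c) \<mu> \<and> normalized C (i \<cdot> c) \<mu>"
proof -
  interpret O: symmetric_monoidal_category "opposite C" by (rule symmetric_monoidal_category_opposite)
  have L1: "left_quotient C K A k D c" and L2: "left_quotient (opposite C) (dual Q) (dual B) q (dual D) i"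
    using Q1 Q2 by (simp_all add: two_sided_quotient_def)
  note homs = left_quotientD(1,2)[OF L1] O.left_quotientD(1,2)[OF L2, simplified]
  note \<xi> = bimonoid_hom_comp[OF homs(2,4)]
  note k = bimonoid_homD(1-5)[OF homs(1)] and c = bimonoid_homD(2-5)[OF homs(2)]
    and q = bimonoid_homD(1-5)[OF homs(3)] and i = bimonoid_homD(2-5)[OF homs(4)]
    and \<sigma>' = normalized_integral_inD(2-4)[OF \<sigma>] and \<tau>' = O.normalized_integral_inD(2-4)[OF \<tau>, simplified]
  obtain s where s: "integral_along C A D c s" "c \<cdot> s = \<i>\<d> (obj D)"
      "s \<cdot> c = left_translation C A (k \<cdot> \<sigma>)" "s \<cdot> c = left_translation (mirror C) A (k \<cdot> \<sigma>)"
    using two_sided_quotient_section[OF Q1 \<sigma>] by blast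
  obtain t where t: "integral_along C D B i t" "t \<cdot> i = \<i>\<d> (obj D)"
      "i \<cdot> t = left_translation (opposite C) (dual B) (\<tau> \<cdot> q)"
      "i \<cdot> t = left_translation (mirror (opposite C)) (dual B) (\<tau> \<cdot> q)"
    using O.two_sided_quotient_section[OF Q2 \<tau>] integral_opposite[OF homs(4)]
    by (auto simp: integral_along_def)
  have st: "s \<in> Arr C" "Dom C s = obj D" "Cod C s = obj A" "t \<in> Arr C" "Dom C t = obj B" "Cod C t = obj D"
    using s(1) t(1) by (simp_all add: integral_along_def right_integral_def)
  have x: "(i \<cdot> c) \<cdot> (k \<cdot> \<sigma>) = \<eta>\<^bsub>B\<^esub>"
    using k c i \<sigma>' bimonoid_homD(7)[OF homs(4)]
    by (simp add: comp_tail[OF left_quotient_zero[OF L1]] normalized_integral_inD(7)[OF \<sigma>])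
  have y: "(\<tau> \<cdot> q) \<cdot> (i \<cdot> c) = \<epsilon>\<^bsub>A\<^esub>"
  proof -
    have "(\<tau> \<cdot> q) \<cdot> (i \<cdot> c) = (\<tau> \<cdot> (q \<cdot> i)) \<cdot> c"
      using q i c \<tau>' by simp
    also have "q \<cdot> i = \<eta>\<^bsub>Q\<^esub> \<cdot> \<epsilon>\<^bsub>D\<^esub>"
      using O.left_quotient_zero[OF L2] by simp
    also have "(\<tau> \<cdot> (\<eta>\<^bsub>Q\<^esub> \<cdot> \<epsilon>\<^bsub>D\<^esub>)) \<cdot> c = (\<tau> \<cdot> \<eta>\<^bsub>Q\<^esub>) \<cdot> (\<epsilon>\<^bsub>D\<^esub> \<cdot> c)"
      using q i c \<tau>' by simp
    also have "\<dots> = \<epsilon>\<^bsub>A\<^esub>"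
      using O.normalized_integral_inD(7)[OF \<tau>] bimonoid_homD(9)[OF homs(2)] k by simp
    finally show ?thesis .
  qed
  have \<mu>: "integral_along C A B (i \<cdot> c) (s \<cdot> t)"
    by (rule integral_along_comp[OF homs(2,4) s(1) t(1)])
  have \<mu>\<xi>: "(s \<cdot> t) \<cdot> (i \<cdot> c) = s \<cdot> c"
    using st c i by (simp add: comp_tail[OF t(2)])
  have \<xi>\<mu>: "(i \<cdot> c) \<cdot> (s \<cdot> t) = i \<cdot> t"
    using st c i by (simp add: comp_tail[OF s(2)])
  have "(s \<cdot> t) \<cdot> (i \<cdot> c) \<cdot> \<mu>' = \<mu>' \<and> \<mu>' = \<mu>' \<cdot> (i \<cdot> c) \<cdot> (s \<cdot> t)"
    if \<mu>': "right_integral C A B (i \<cdot> c) \<mu>' \<or> left_integral C A B (i \<cdot> c) \<mu>'" for \<mu>'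
  proof
    have m: "\<mu>' \<in> Arr C" "Dom C \<mu>' = obj B" "Cod C \<mu>' = obj A"
      using \<mu>' by (auto simp: right_integral_def left_integral_def)
    have "(s \<cdot> c) \<cdot> \<mu>' = \<mu>'"
      using k \<sigma>' x by (intro integral_absorbs_translation[OF \<xi> \<mu>' _ _ s(3,4)]) simp_all
    then show "(s \<cdot> t) \<cdot> (i \<cdot> c) \<cdot> \<mu>' = \<mu>'"
      unfolding \<mu>\<xi> .
    have "\<mu>' \<cdot> (i \<cdot> t) = \<mu>'"
      using O.integral_absorbs_translation[of "dual B" "dual A" "i \<cdot> c" \<mu>' "\<tau> \<cdot> q" "i \<cdot> t"]
        \<xi> \<mu>' integral_opposite[OF \<xi>] q \<tau>' y t(3,4) by simp
    then show "\<mu>' = \<mu>' \<cdot> (i \<cdot> c) \<cdot> (s \<cdot> t)"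
      using \<xi>\<mu> m st c i by simp
  qed
  moreover have "normalized C (i \<cdot> c) (s \<cdot> t)"
    unfolding normalized_def \<xi>\<mu> using st c i by (simp add: comp_tail[OF t(2)])
  ultimately show ?thesis
    using \<mu> by (auto simp: generator_integral_def)
qed

text \<open>
  \<open>\<mu> = \<mu> \<xi> \<mu> = \<mu> (\<xi> \<nu> \<xi>) \<mu> = (\<mu> \<xi> \<nu>) \<xi> \<mu> = \<nu> \<xi> \<mu> = \<nu>\<close>: the second equality is the
  normalization of \<open>\<nu>\<close>, and the generator property of \<open>\<mu>\<close> is applied to \<open>\<mu>\<close> once and to \<open>\<nu>\<close> twice.
\<close>

lemma normalized_generator_unique:
  assumes \<xi>: "\<xi> \<in> hom C (obj A) (obj B)"
    and \<mu>: "generator_integral C A B \<xi> \<mu>" and \<nu>: "integral_along C A B \<xi> \<nu>" "normalized C \<xi> \<nu>"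
  shows "\<nu> = \<mu>"
proof -
  have m: "\<mu> \<in> Arr C" "Dom C \<mu> = obj B" "Cod C \<mu> = obj A" 
    and n: "\<nu> \<in> Arr C" "Dom C \<nu> = obj B" "Cod C \<nu> = obj A"
    using \<mu> \<nu> by (simp_all add: generator_integral_def integral_along_def right_integral_def)
  have gen: "\<mu> \<cdot> \<xi> \<cdot> \<mu> = \<mu>" "\<mu> \<cdot> \<xi> \<cdot> \<nu> = \<nu>" "\<nu> \<cdot> \<xi> \<cdot> \<mu> = \<nu>"
    using \<mu> \<nu>(1) unfolding generator_integral_def integral_along_def by metis+
  have "\<mu> = \<mu> \<cdot> (\<xi> \<cdot> \<nu> \<cdot> \<xi>) \<cdot> \<mu>"
    using \<nu>(2) gen(1) by (simp add: normalized_def)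
  also have "\<dots> = (\<mu> \<cdot> \<xi> \<cdot> \<nu>) \<cdot> \<xi> \<cdot> \<mu>"
    using \<xi> m n by simp
  also have "\<dots> = \<nu>"
    unfolding gen ..
  finally show ?thesis ..
qed

section \<open>From a normalized integral to integrals on kernel and cokernel\<close>

text \<open>
  In elements, for \<open>k(\<sigma>) = \<mu>(1)\<close>: \<open>k(x \<sigma>) = k(x) \<mu>(1) = \<mu>(\<xi>(k(x))) = \<epsilon>(x) \<mu>(1) = k(\<epsilon>(x) \<sigma>)\<close>, and \<open>k\<close> is
  monic.
\<close>

lemma left_integral_restricts:
  assumes K: "left_quotient (opposite C) (dual B) (dual A) \<xi> (dual K) k"
    and \<mu>: "left_integral C A B \<xi> \<mu>" and \<sigma>: "\<sigma> \<in> hom C \<one> (obj K)" and k\<sigma>: "k \<cdot> \<sigma> = \<mu> \<cdot> \<eta>\<^bsub>B\<^esub>"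
  shows "left_integral_in C K \<sigma>"
proof -
  interpret O: symmetric_monoidal_category "opposite C" by (rule symmetric_monoidal_category_opposite)
  have \<xi>: "bimonoid_hom C A B \<xi>" and k: "bimonoid_hom C K A k"
    using O.left_quotientD(1,2)[OF K] by simp_all
  have \<xi>k: "\<xi> \<cdot> k = \<eta>\<^bsub>B\<^esub> \<cdot> \<epsilon>\<^bsub>K\<^esub>"
    using O.left_quotient_zero[OF K] by simp
  note t = bimonoid_homD(1-5)[OF \<xi>] bimonoid_homD(1-5)[OF k]
  have m: "\<mu> \<in> Arr C" "Dom C \<mu> = obj B" "Cod C \<mu> = obj A"
      "\<nabla>\<^bsub>A\<^esub> \<cdot> (\<i>\<d> (obj A) \<otimes> \<mu>) = \<mu> \<cdot> (\<nabla>\<^bsub>B\<^esub> \<cdot> (\<xi> \<otimes> \<i>\<d> (obj B)))"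
    using \<mu> t unfolding left_integral_def by simp_all
  have "k \<cdot> (\<nabla>\<^bsub>K\<^esub> \<cdot> (\<i>\<d> (obj K) \<otimes> \<sigma>)) = \<nabla>\<^bsub>A\<^esub> \<cdot> (k \<otimes> (k \<cdot> \<sigma>))"
    using t \<sigma> by (simp add: comp_tail[OF bimonoid_homD(6)[OF k]] interchange)
  also have "\<dots> = (\<nabla>\<^bsub>A\<^esub> \<cdot> (\<i>\<d> (obj A) \<otimes> \<mu>)) \<cdot> (k \<otimes> \<eta>\<^bsub>B\<^esub>)"
    unfolding k\<sigma> using t m(1-3) by (simp add: interchange)
  also have "\<dots> = \<mu> \<cdot> (\<nabla>\<^bsub>B\<^esub> \<cdot> ((\<xi> \<cdot> k) \<otimes> \<eta>\<^bsub>B\<^esub>))"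
    unfolding m(4) using t m(1-3) by (simp add: interchange)
  also have "\<dots> = \<mu> \<cdot> ((\<nabla>\<^bsub>B\<^esub> \<cdot> (\<eta>\<^bsub>B\<^esub> \<otimes> \<i>\<d> (obj B))) \<cdot> (\<epsilon>\<^bsub>K\<^esub> \<otimes> \<eta>\<^bsub>B\<^esub>))"
    unfolding \<xi>k using t m(1-3) by (simp add: interchange)
  also have "\<dots> = \<mu> \<cdot> ((\<l> (obj B) \<cdot> (\<i>\<d> \<one> \<otimes> \<eta>\<^bsub>B\<^esub>)) \<cdot> (\<epsilon>\<^bsub>K\<^esub> \<otimes> \<i>\<d> \<one>))"
    unfolding bimonoidD(2)[OF t(2)] using t m(1-3) by (simp add: interchange)
  also have "\<dots> = (k \<cdot> \<sigma>) \<cdot> (\<l> \<one> \<cdot> (\<epsilon>\<^bsub>K\<^esub> \<otimes> \<i>\<d> \<one>))"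
    unfolding k\<sigma> using t m(1-3) by (simp add: lunit_nat)
  also have "\<dots> = k \<cdot> ((\<l> (obj K) \<cdot> (\<i>\<d> \<one> \<otimes> \<sigma>)) \<cdot> (\<epsilon>\<^bsub>K\<^esub> \<otimes> \<i>\<d> \<one>))"
    using t \<sigma> by (simp add: lunit_nat)
  also have "\<dots> = k \<cdot> (\<l> (obj K) \<cdot> (\<epsilon>\<^bsub>K\<^esub> \<otimes> \<sigma>))"
    using t \<sigma> by (simp add: interchange)
  finally have "\<nabla>\<^bsub>K\<^esub> \<cdot> (\<i>\<d> (obj K) \<otimes> \<sigma>) = \<l> (obj K) \<cdot> (\<epsilon>\<^bsub>K\<^esub> \<otimes> \<sigma>)"
    using O.left_quotient_epi[OF K] t \<sigma> by simp
  then show ?thesis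
    using \<sigma> by (simp add: left_integral_in_def)
qed

text \<open>
  The comultiplication identity of \<open>\<mu>\<close> at \<open>1\<close> is \<open>1 \<otimes> \<mu>(1) = \<xi>(\<mu>(1)\<^sub>1) \<otimes> \<mu>(1)\<^sub>2\<close>. So \<open>\<mu>(1)\<close> is coinvariant,
  and the coinvariants are the kernel. Its counit is one since normalization of \<open>\<mu>\<close> gives
  \<open>\<xi>(\<mu>(1)) = \<xi>(\<mu>(\<xi>(1))) = \<xi>(1) = 1\<close>.
\<close>

lemma normalized_integral_restricts:
  assumes K: "two_sided_quotient (opposite C) (dual B) (dual A) \<xi> (dual K) k"
    and \<mu>: "integral_along C A B \<xi> \<mu>" and norm: "normalized C \<xi> \<mu>"
  shows "\<exists>\<sigma>. normalized_integral_in C K \<sigma>"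
proof -
  interpret O: symmetric_monoidal_category "opposite C" by (rule symmetric_monoidal_category_opposite)
  interpret M: symmetric_monoidal_category "mirror C" by (rule symmetric_monoidal_category_mirror)
  have KL: "left_quotient (opposite C) (dual B) (dual A) \<xi> (dual K) k"
    and KR: "left_quotient (opposite (mirror C)) (dual B) (dual A) \<xi> (dual K) k"
    using K by (simp_all add: two_sided_quotient_def mirror_opposite)
  have \<xi>: "bimonoid_hom C A B \<xi>" and k: "bimonoid_hom C K A k"
    using O.left_quotientD(1,2)[OF KL] by simp_all
  note t = bimonoid_homD(1-5)[OF \<xi>] bimonoid_homD(1-5)[OF k]
  have m: "\<mu> \<in> Arr C" "Dom C \<mu> = obj B" "Cod C \<mu> = obj A"
      "(\<i>\<d> (obj B) \<otimes> \<mu>) \<cdot> \<Delta>\<^bsub>B\<^esub> = (\<xi> \<otimes> \<i>\<d> (obj A)) \<cdot> (\<Delta>\<^bsub>A\<^esub> \<cdot> \<mu>)"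
    using \<mu> t unfolding left_integral_def integral_along_def by simp_all
  have "(\<xi> \<otimes> \<i>\<d> (obj A)) \<cdot> (\<Delta>\<^bsub>A\<^esub> \<cdot> (\<mu> \<cdot> \<eta>\<^bsub>B\<^esub>)) = ((\<i>\<d> (obj B) \<otimes> \<mu>) \<cdot> \<Delta>\<^bsub>B\<^esub>) \<cdot> \<eta>\<^bsub>B\<^esub>"
    unfolding m(4) using t m(1-3) by simp
  also have "\<dots> = (\<eta>\<^bsub>B\<^esub> \<otimes> (\<mu> \<cdot> \<eta>\<^bsub>B\<^esub>)) \<cdot> \<l>\<^sup>- \<one>"
    using t m(1-3) by (simp add: bimonoidD(5) interchange_tail)
  also have "\<dots> = (\<eta>\<^bsub>B\<^esub> \<otimes> \<i>\<d> (obj A)) \<cdot> (\<l>\<^sup>- (obj A) \<cdot> (\<mu> \<cdot> \<eta>\<^bsub>B\<^esub>))"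
    using t m(1-3) by (simp add: lunit_inv_nat interchange_tail)
  finally obtain \<sigma> where \<sigma>: "\<sigma> \<in> hom C \<one> (obj K)" and k\<sigma>: "k \<cdot> \<sigma> = \<mu> \<cdot> \<eta>\<^bsub>B\<^esub>"
    using O.left_quotient_factor[OF KL, of "\<mu> \<cdot> \<eta>\<^bsub>B\<^esub>" \<one>] t m(1-3) by auto
  have "\<epsilon>\<^bsub>K\<^esub> \<cdot> \<sigma> = \<epsilon>\<^bsub>B\<^esub> \<cdot> (\<xi> \<cdot> (k \<cdot> \<sigma>))"
    using t \<sigma> bimonoid_homD(9)[OF k]
    by (simp add: comp_tail[OF bimonoid_homD(9)[OF \<xi>]] comp_tail[OF bimonoid_homD(9)[OF k]])
  also have "\<dots> = \<epsilon>\<^bsub>B\<^esub> \<cdot> ((\<xi> \<cdot> \<mu> \<cdot> \<xi>) \<cdot> \<eta>\<^bsub>A\<^esub>)"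
    unfolding k\<sigma> using t m(1-3) bimonoid_homD(7)[OF \<xi>] by simp
  also have "\<dots> = \<i>\<d> \<one>"
    using norm t bimonoid_homD(7)[OF \<xi>] unfolding normalized_def by (simp add: bimonoidD)
  finally have "\<epsilon>\<^bsub>K\<^esub> \<cdot> \<sigma> = \<i>\<d> \<one>" .
  moreover have "left_integral_in C K \<sigma>"
    using \<mu> \<sigma> k\<sigma> by (intro left_integral_restricts[OF KL]) (simp_all add: integral_along_def)
  moreover have "left_integral_in (mirror C) K \<sigma>"
    using \<mu> \<sigma> k\<sigma> by (intro M.left_integral_restricts[OF KR]) (simp_all add: integral_along_def integral_mirror)
  ultimately show ?thesis
    using t by (auto simp: normalized_integral_in_def)
qed

section \<open>Kernels and cokernels of binormal homomorphisms\<close>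

lemma bimonoid_hom_id: "bimonoid C A \<Longrightarrow> bimonoid_hom C A A (\<i>\<d> (obj A))"
  by (simp add: bimonoid_hom_def)

lemma cokernel_unique:
  assumes Q: "is_cokernel C A B \<xi> Q q" and R: "is_cokernel C A B \<xi> R r"
  shows "\<exists>j. bimonoid_iso C Q R j \<and> j \<cdot> q = r"
proof -
  have q: "bimonoid_hom C B Q q" and r: "bimonoid_hom C B R r"
    using Q R by (simp_all add: is_cokernel_def)
  note t = bimonoid_homD(1-5)[OF q] bimonoid_homD(1-5)[OF r]
  have epi: "f = id'" if "bimonoid_hom C P P f" "bimonoid_hom C P P id'" "f \<cdot> p = p" "id' \<cdot> p = p"
      "is_cokernel C A B \<xi> P p" for P p f id'
    using that unfolding is_cokernel_def by metis
  obtain j where j: "bimonoid_hom C Q R j" "j \<cdot> q = r"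
    using Q R unfolding is_cokernel_def by metis
  obtain j' where j': "bimonoid_hom C R Q j'" "j' \<cdot> r = q"
    using Q R unfolding is_cokernel_def by metis
  note jt = bimonoid_homD(3-5)[OF j(1)] bimonoid_homD(3-5)[OF j'(1)]
  have "j' \<cdot> j = \<i>\<d> (obj Q)"
    by (rule epi[OF bimonoid_hom_comp[OF j(1) j'(1)] bimonoid_hom_id _ _ Q])
      (use t jt j j' in simp_all)
  moreover have "j \<cdot> j' = \<i>\<d> (obj R)"
    by (rule epi[OF bimonoid_hom_comp[OF j'(1) j(1)] bimonoid_hom_id _ _ R])
      (use t jt j j' in simp_all)
  ultimately show ?thesis
    using j j' by (auto simp: bimonoid_iso_def)
qed

lemma left_quotient_iso:
  assumes Q: "left_quotient C K A k D c" and j: "bimonoid_iso C D E j"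
  shows "left_quotient C K A k E (j \<cdot> c)"
proof -
  from j obtain j' where hj: "bimonoid_hom C D E j" and hj': "bimonoid_hom C E D j'"
      and j'j: "j' \<cdot> j = \<i>\<d> (obj D)" and jj': "j \<cdot> j' = \<i>\<d> (obj E)"
    by (auto simp: bimonoid_iso_def)
  note t = bimonoid_homD(1-5)[OF left_quotientD(1)[OF Q]] bimonoid_homD(2-5)[OF left_quotientD(2)[OF Q]]
    bimonoid_homD(2-5)[OF hj] bimonoid_homD(3-5)[OF hj']
  note zero = left_quotientD(3)[OF Q]
  have "\<exists>!g. g \<in> hom C (obj E) Z \<and> g \<cdot> (j \<cdot> c) = h"
    if h: "h \<in> hom C (obj A) Z" "h \<cdot> (\<nabla>\<^bsub>A\<^esub> \<cdot> (k \<otimes> \<i>\<d> (obj A))) = h \<cdot> (\<l> (obj A) \<cdot> (\<epsilon>\<^bsub>K\<^esub> \<otimes> \<i>\<d> (obj A)))"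
    for Z h
  proof -
    obtain s where s: "s \<in> hom C (obj D) Z" "s \<cdot> c = h"
      using left_quotient_factor[OF Q h] by blast
    show ?thesis
    proof (rule ex1I[of _ "s \<cdot> j'"])
      show "s \<cdot> j' \<in> hom C (obj E) Z \<and> s \<cdot> j' \<cdot> (j \<cdot> c) = h"
        using s t by (simp add: comp_tail[OF j'j])
    next
      fix g
      assume g: "g \<in> hom C (obj E) Z \<and> g \<cdot> (j \<cdot> c) = h"
      have "g \<cdot> j = s"
        by (rule left_quotient_epi[OF Q]) (use g s t in simp_all)
      then have "s \<cdot> j' = g \<cdot> (j \<cdot> j')"
        using g t by auto
      then show "g = s \<cdot> j'"
        using g t jj' by simp
    qed
  qed
  then have "left_action_stabilized C K (obj A) (\<nabla>\<^bsub>A\<^esub> \<cdot> (k \<otimes> \<i>\<d> (obj A))) (obj E) (j \<cdot> c)"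
    using t zero
    by (simp add: left_action_stabilized_def is_coequalizer_def trivial_left_action_def)
  then show ?thesis
    using left_quotientD(1)[OF Q] bimonoid_hom_comp[OF left_quotientD(2)[OF Q] hj]
    by (simp add: left_quotient_def)
qed

text \<open>
  Normality asks for some cokernel that is a left quotient and for some cokernel that is a right
  quotient. Cokernels are isomorphic, so every cokernel is both.
\<close>

lemma normal_two_sided_quotient:
  assumes "normal C A B \<xi>" and Q: "is_cokernel C A B \<xi> Q q"
  shows "two_sided_quotient C A B \<xi> Q q"
proof -
  interpret M: symmetric_monoidal_category "mirror C" by (rule symmetric_monoidal_category_mirror)
  obtain Q1 q1 Q2 q2 where
    1: "left_action_stabilized C A (obj B) (\<nabla>\<^bsub>B\<^esub> \<cdot> (\<xi> \<otimes> \<i>\<d> (obj B))) (obj Q1) q1" "is_cokernel C A B \<xi> Q1 q1" and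
    2: "right_action_stabilized C A (obj B) (\<nabla>\<^bsub>B\<^esub> \<cdot> (\<i>\<d> (obj B) \<otimes> \<xi>)) (obj Q2) q2" "is_cokernel C A B \<xi> Q2 q2"
    using assms(1) unfolding normal_def by blast
  obtain j1 where j1: "bimonoid_iso C Q1 Q j1" "j1 \<cdot> q1 = q"
    using cokernel_unique[OF 1(2) Q] by blast
  obtain j2 where j2: "bimonoid_iso C Q2 Q j2" "j2 \<cdot> q2 = q"
    using cokernel_unique[OF 2(2) Q] by blast
  have "left_quotient C A B \<xi> Q1 q1"
    using 1 by (simp add: left_quotient_def is_cokernel_def)
  from left_quotient_iso[OF this j1(1)] have "left_quotient C A B \<xi> Q q"
    unfolding j1(2) .
  moreover have "left_quotient (mirror C) A B \<xi> Q2 q2"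
    using 2 by (simp add: left_quotient_def is_cokernel_def stabilized_dual)
  from M.left_quotient_iso[OF this, of Q j2] j2 have "left_quotient (mirror C) A B \<xi> Q q"
    by (simp add: bimonoid_iso_def)
  ultimately show ?thesis
    by (simp add: two_sided_quotient_def)
qed

lemma conormal_imp_normal_opposite:
  assumes "conormal C A B \<xi>"
  shows "normal (opposite C) (dual B) (dual A) \<xi>"
proof -
  obtain K k L l where
    1: "left_coaction_stabilized C B (obj A) ((\<xi> \<otimes> \<i>\<d> (obj A)) \<cdot> \<Delta>\<^bsub>A\<^esub>) (obj K) k" "is_kernel C A B \<xi> K k" and
    2: "right_coaction_stabilized C B (obj A) ((\<i>\<d> (obj A) \<otimes> \<xi>) \<cdot> \<Delta>\<^bsub>A\<^esub>) (obj L) l" "is_kernel C A B \<xi> L l"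
    using assms unfolding conormal_def by blast
  have "right_action_stabilized (opposite C) (dual B) (obj A) ((\<i>\<d> (obj A) \<otimes> \<xi>) \<cdot> \<Delta>\<^bsub>A\<^esub>) (obj L) l"
    unfolding stabilized_dual(2)[symmetric] mirror_opposite
    using 2(1) by (simp add: stabilized_dual)
  moreover have "left_action_stabilized (opposite C) (dual B) (obj A) ((\<xi> \<otimes> \<i>\<d> (obj A)) \<cdot> \<Delta>\<^bsub>A\<^esub>) (obj K) k"
    using 1(1) by (simp add: stabilized_dual)
  ultimately show ?thesis
    unfolding normal_def using is_cokernel_opposite[OF 1(2)] is_cokernel_opposite[OF 2(2)]
    by (intro conjI exI[of _ "dual K"] exI[of _ k] exI[of _ "dual L"] exI[of _ l]) simp_all
qed

lemma conormal_two_sided_quotient: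
  assumes "conormal C A B \<xi>" and "is_kernel C A B \<xi> K k"
  shows "two_sided_quotient (opposite C) (dual B) (dual A) \<xi> (dual K) k"
  using symmetric_monoidal_category.normal_two_sided_quotient[OF symmetric_monoidal_category_opposite]
    conormal_imp_normal_opposite[OF assms(1)] is_cokernel_opposite[OF assms(2)] by blast

lemma bimonoid_iso_opposite:
  "bimonoid_iso (opposite C) (dual B) (dual A) f \<longleftrightarrow> bimonoid_iso C A B f"
  by (auto simp: bimonoid_iso_def)

lemma left_integral_in_iso:
  assumes j: "bimonoid_iso C L K j" and \<sigma>: "left_integral_in C L \<sigma>"
  shows "left_integral_in C K (j \<cdot> \<sigma>)"
proof -
  from j obtain j' where h: "bimonoid_hom C L K j" and h': "bimonoid_hom C K L j'"
      and jj': "j \<cdot> j' = \<i>\<d> (obj K)"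
    by (auto simp: bimonoid_iso_def)
  note t = bimonoid_homD(1-5)[OF h] bimonoid_homD(3-5)[OF h']
  from \<sigma> have \<sigma>': "\<sigma> \<in> Arr C" "Dom C \<sigma> = \<one>" "Cod C \<sigma> = obj L"
      "\<nabla>\<^bsub>L\<^esub> \<cdot> (\<i>\<d> (obj L) \<otimes> \<sigma>) = \<l> (obj L) \<cdot> (\<epsilon>\<^bsub>L\<^esub> \<otimes> \<sigma>)"
    by (simp_all add: left_integral_in_def)
  have nat: "\<l> (obj K) \<cdot> (\<i>\<d> \<one> \<otimes> j) = j \<cdot> \<l> (obj L)"
    using t by (simp add: lunit_nat)
  have "\<nabla>\<^bsub>K\<^esub> \<cdot> (\<i>\<d> (obj K) \<otimes> (j \<cdot> \<sigma>)) = (\<nabla>\<^bsub>K\<^esub> \<cdot> (j \<otimes> j)) \<cdot> (j' \<otimes> \<sigma>)"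
    using t \<sigma>'(1-3) by (simp add: interchange jj')
  also have "\<dots> = j \<cdot> ((\<nabla>\<^bsub>L\<^esub> \<cdot> (\<i>\<d> (obj L) \<otimes> \<sigma>)) \<cdot> (j' \<otimes> \<i>\<d> \<one>))"
    unfolding bimonoid_homD(6)[OF h, symmetric] using t \<sigma>'(1-3) by (simp add: interchange)
  also have "\<dots> = (j \<cdot> \<l> (obj L)) \<cdot> ((\<epsilon>\<^bsub>L\<^esub> \<cdot> j') \<otimes> \<sigma>)"
    unfolding \<sigma>'(4) using t \<sigma>'(1-3) by (simp add: interchange)
  also have "\<dots> = \<l> (obj K) \<cdot> (\<epsilon>\<^bsub>K\<^esub> \<otimes> (j \<cdot> \<sigma>))"
    unfolding nat[symmetric] bimonoid_homD(9)[OF h'] using t \<sigma>'(1-3) by (simp add: interchange)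
  finally show ?thesis
    using t \<sigma>'(1-3) by (simp add: left_integral_in_def)
qed

text \<open>
  A kernel that is known to be small need not be the one chosen to form the coimage, so integrals must
  be moved between kernels of the same homomorphism.
\<close>

lemma normalized_integral_in_kernel:
  assumes K: "is_kernel C A B \<xi> K k" and L: "is_kernel C A B \<xi> L l" and \<sigma>: "normalized_integral_in C L \<sigma>"
  shows "\<exists>\<sigma>. normalized_integral_in C K \<sigma>"
proof -
  interpret O: symmetric_monoidal_category "opposite C" by (rule symmetric_monoidal_category_opposite)
  interpret M: symmetric_monoidal_category "mirror C" by (rule symmetric_monoidal_category_mirror)
  obtain j where j: "bimonoid_iso C L K j"
    using O.cokernel_unique[OF is_cokernel_opposite[OF K] is_cokernel_opposite[OF L]]
    by (auto simp: bimonoid_iso_opposite)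
  then have h: "bimonoid_hom C L K j" by (simp add: bimonoid_iso_def)
  have "bimonoid_iso (mirror C) L K j" using j by (simp add: bimonoid_iso_def)
  then have "normalized_integral_in C K (j \<cdot> \<sigma>)"
    using \<sigma> j left_integral_in_iso[of L K j \<sigma>] M.left_integral_in_iso[of L K j \<sigma>]
      bimonoid_homD(1-5)[OF h] normalized_integral_inD(2-4)[OF \<sigma>]
    by (simp add: normalized_integral_in_def comp_tail[OF bimonoid_homD(9)[OF h]])
  then show ?thesis ..
qed

lemma is_kernel_iso:
  assumes K: "is_kernel C A B \<xi> K k" and j: "bimonoid_iso C L K j"
  shows "is_kernel C A B \<xi> L (k \<cdot> j)"
proof -
  from j obtain j' where h: "bimonoid_hom C L K j" and h': "bimonoid_hom C K L j'"
      and j'j: "j' \<cdot> j = \<i>\<d> (obj L)" and jj': "j \<cdot> j' = \<i>\<d> (obj K)"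
    by (auto simp: bimonoid_iso_def)
  have \<xi>: "bimonoid_hom C A B \<xi>" and k: "bimonoid_hom C K A k" "\<xi> \<cdot> k = (\<eta>\<^bsub>B\<^esub> \<cdot> \<epsilon>\<^bsub>A\<^esub>) \<cdot> k"
    using K by (simp_all add: is_kernel_def)
  note t = bimonoid_homD(1-5)[OF \<xi>] bimonoid_homD(1-5)[OF k(1)] bimonoid_homD(1-5)[OF h]
    bimonoid_homD(3-5)[OF h']
  have "\<exists>!g. bimonoid_hom C P L g \<and> k \<cdot> j \<cdot> g = f"
    if f: "bimonoid_hom C P A f" "\<xi> \<cdot> f = (\<eta>\<^bsub>B\<^esub> \<cdot> \<epsilon>\<^bsub>A\<^esub>) \<cdot> f" for P f
  proof -
    from K f have ex1: "\<exists>!g. bimonoid_hom C P K g \<and> k \<cdot> g = f"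
      unfolding is_kernel_def by blast
    then obtain g where g: "bimonoid_hom C P K g" "k \<cdot> g = f" by blast
    show ?thesis
    proof (rule ex1I[of _ "j' \<cdot> g"])
      show "bimonoid_hom C P L (j' \<cdot> g) \<and> k \<cdot> j \<cdot> (j' \<cdot> g) = f"
        using bimonoid_hom_comp[OF g(1) h'] g t bimonoid_homD(3-5)[OF g(1)]
        by (simp add: comp_tail[OF jj'])
    next
      fix g'
      assume g': "bimonoid_hom C P L g' \<and> k \<cdot> j \<cdot> g' = f"
      note t' = bimonoid_homD(3-5)[OF conjunct1[OF g']]
      have "bimonoid_hom C P K (j \<cdot> g')" "k \<cdot> (j \<cdot> g') = f"
        using bimonoid_hom_comp[OF conjunct1[OF g'] h] g' t t' by simp_all
      then have "j \<cdot> g' = g" using ex1 g by blast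
      then show "g' = j' \<cdot> g"
        using t t' by (auto simp: comp_tail[OF j'j])
    qed
  qed
  moreover have "\<xi> \<cdot> (k \<cdot> j) = (\<eta>\<^bsub>B\<^esub> \<cdot> \<epsilon>\<^bsub>A\<^esub>) \<cdot> (k \<cdot> j)"
    using t k(2) by (simp add: comp_tail2[OF k(2)])
  ultimately show ?thesis
    using \<xi> bimonoid_hom_comp[OF h k(1)] by (simp add: is_kernel_def)
qed

end

theorem corollary9p11:
  fixes C :: "('o, 'm) sm_category" and A B :: "('o, 'm) bimonoid_data" and \<xi> :: 'm
  assumes "symmetric_monoidal_category C"
    and "idempotents_split C"
    and "bimonoid C A" and "bimonoid C B"
    and "bimonoid_hom C A B \<xi>"
    and "well_decomposable C A B \<xi>"
  shows "((\<exists>\<mu>. generator_integral C A B \<xi> \<mu> \<and> normalized C \<xi> \<mu>) \<longleftrightarrow> weakly_pre_Fredholm C A B \<xi>) \<and>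
    ((\<exists>\<mu>. integral_along C A B \<xi> \<mu> \<and> normalized C \<xi> \<mu>) \<longrightarrow>
     (\<exists>!\<mu>. integral_along C A B \<xi> \<mu> \<and> normalized C \<xi> \<mu>))"
proof -
  interpret symmetric_monoidal_category C by (rule assms(1))
  interpret O: symmetric_monoidal_category "opposite C" by (rule symmetric_monoidal_category_opposite)
  note split = assms(2) and \<xi> = assms(5)
  from assms(6) obtain K k Q q D c I i \<zeta> where
    normal: "normal C A B \<xi>" and conormal: "conormal C A B \<xi>" and
    k: "is_kernel C A B \<xi> K k" "normal C K A k" and
    q: "is_cokernel C A B \<xi> Q q" "conormal C B Q q" and
    c: "is_cokernel C K A k D c" and i: "is_kernel C B Q q I i" and
    \<xi>_eq: "\<xi> = Comp C (Comp C i \<zeta>) c" and \<zeta>: "bimonoid_iso C D I \<zeta>"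
    unfolding well_decomposable_def binormal_def by blast
  \<comment> \<open>The image is replaced by the coimage along \<open>\<zeta>\<close>, which leaves \<open>\<xi>\<close> as \<open>(i \<cdot> \<zeta>) \<cdot> c\<close>.\<close>
  note quotients = normal_two_sided_quotient[OF k(2) c]
    conormal_two_sided_quotient[OF q(2) is_kernel_iso[OF i \<zeta>]]
  have generator: "\<exists>\<mu>. generator_integral C A B \<xi> \<mu> \<and> normalized C \<xi> \<mu>"
    if "\<exists>\<sigma>. normalized_integral_in C K \<sigma>" and "\<exists>\<tau>. normalized_integral_in (opposite C) (dual Q) \<tau>"
    using that normalized_generator_exists[OF quotients(1) _ quotients(2)] unfolding \<xi>_eq by blast
  have integrals: "(\<exists>\<sigma>. normalized_integral_in C K \<sigma>) \<and> (\<exists>\<tau>. normalized_integral_in (opposite C) (dual Q) \<tau>)"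
    if \<mu>: "integral_along C A B \<xi> \<mu>" "normalized C \<xi> \<mu>" for \<mu>
  proof
    show "\<exists>\<sigma>. normalized_integral_in C K \<sigma>"
      by (rule normalized_integral_restricts[OF conormal_two_sided_quotient[OF conormal k(1)] \<mu>])
    have "Comp C \<xi> (Comp C \<mu> \<xi>) = \<xi>"
      using \<mu> bimonoid_homD(3-5)[OF \<xi>] by (simp add: normalized_def integral_along_def right_integral_def)
    then show "\<exists>\<tau>. normalized_integral_in (opposite C) (dual Q) \<tau>"
      using \<mu>(1) integral_opposite[OF \<xi>]
        two_sided_quotient_opposite_opposite[OF normal_two_sided_quotient[OF normal q(1)]]
      by (intro O.normalized_integral_restricts[of "dual A" "dual B" \<xi> "dual Q" q \<mu>])
        (simp_all add: integral_along_def normalized_def)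
  qed
  have "(\<exists>\<mu>. generator_integral C A B \<xi> \<mu> \<and> normalized C \<xi> \<mu>) \<longleftrightarrow> weakly_pre_Fredholm C A B \<xi>"
  proof
    assume "\<exists>\<mu>. generator_integral C A B \<xi> \<mu> \<and> normalized C \<xi> \<mu>"
    then have "small C K" and "cosmall C Q"
      using integrals small_iff_normalized_integral[OF split]
        O.small_iff_normalized_integral[OF idempotents_split_opposite[OF split]]
      unfolding generator_integral_def cosmall_iff_small by blast+
    then show "weakly_pre_Fredholm C A B \<xi>"
      using assms(6) k(1) q(1) unfolding weakly_pre_Fredholm_def by blast
  next
    assume "weakly_pre_Fredholm C A B \<xi>"
    then obtain K' k' Q' q' where K': "is_kernel C A B \<xi> K' k'" "small C K'"
      and Q': "is_cokernel C A B \<xi> Q' q'" "cosmall C Q'"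
      unfolding weakly_pre_Fredholm_def by blast
    have "\<exists>\<sigma>. normalized_integral_in C K \<sigma>"
      using small_imp_normalized_integral[OF K'(2)] normalized_integral_in_kernel[OF k(1) K'(1)] by blast
    moreover have "\<exists>\<tau>. normalized_integral_in (opposite C) (dual Q) \<tau>"
      using O.small_imp_normalized_integral Q'(2) unfolding cosmall_iff_small
      using O.normalized_integral_in_kernel[OF is_kernel_opposite[OF q(1)] is_kernel_opposite[OF Q'(1)]]
      by blast
    ultimately show "\<exists>\<mu>. generator_integral C A B \<xi> \<mu> \<and> normalized C \<xi> \<mu>"
      by (rule generator)
  qed
  moreover have "\<exists>!\<mu>. integral_along C A B \<xi> \<mu> \<and> normalized C \<xi> \<mu>"
    if "\<exists>\<mu>. integral_along C A B \<xi> \<mu> \<and> normalized C \<xi> \<mu>"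
  proof -
    from that obtain \<nu> where \<nu>: "integral_along C A B \<xi> \<nu>" "normalized C \<xi> \<nu>" by blast
    from integrals[OF \<nu>] generator obtain \<mu>
      where \<mu>: "generator_integral C A B \<xi> \<mu>" "normalized C \<xi> \<mu>" by blast
    have "\<xi> \<in> hom C (obj A) (obj B)" using bimonoid_homD(3-5)[OF \<xi>] by simp
    then show ?thesis
      using \<mu> normalized_generator_unique[OF _ \<mu>(1)] unfolding generator_integral_def by blast
  qed
  ultimately show ?thesis by blast
qed

end
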